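(* Let $A\in\mathrm{GL}(2d,\mathbb{R})$ and let $T:M^1(\mathbb{R}^d)\to M^\infty(\mathbb{R}^d)$ be a continuous linear operator. Then there exist distributions $k,\sigma,F\in M^\infty(\mathbb{R}^{2d})$ such that $T$ admits the following representations: 1. as an integral operator with kernel $k$: $\langle Tf,g\rangle=\langle k,g\otimes\overline{f}\rangle$ for all $f,g\in M^1(\mathbb{R}^d)$; 2. as a pseudodifferential operator with symbol $\sigma$ associated with $\mathcal{B}_A$: $T=\sigma^A$; 3. as a superposition, in the weak sense, of time-frequency shifts: $$T=\iint_{\mathbb{R}^{2d}}F(x,\omega)\,M_\omega T_x\,dx\,d\omega .$$ The relations among $k,\sigma,F$ and $A$ are $$\sigma=|\det A|\,\mathcal{F}_2\mathfrak{T}_A k,\qquad F=\mathcal{F}_2\mathfrak{T}_{A_{ST}}k,\qquad\text{where } A_{ST}=\begin{pmatrix}0&I\\-I&I\end{pmatrix}.$$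
   Context: Brackets $\langle\cdot,\cdot\rangle$ denote the extension of the $L^2$ inner product (linear in the first, conjugate-linear in the second argument) to the duality $M^\infty\times M^1$. $T_xf(t)=f(t-x)$, $M_\omega f(t)=e^{2\pi i t\cdot\omega}f(t)$; the short-time Fourier transform is $V_gf(x,\omega)=\langle f,M_\omega T_xg\rangle$. $M^p(\mathbb{R}^n)$ ($p=1,\infty$) is the space of tempered distributions $f$ with $V_\varphi f\in L^p(\mathbb{R}^{2n})$ for a fixed nonzero Schwartz window $\varphi$, normed by $\|V_\varphi f\|_{L^p}$; $M^\infty=(M^1)'$. $f\otimes g(x,y)=f(x)g(y)$. For $B\in\mathrm{GL}(2d,\mathbb{R})$ and a function $\Phi$ on $\mathbb{R}^{2d}$, $\mathfrak{T}_B\Phi(x,y)=\Phi\big(B(x,y)^{\top}\big)$; on $M^\infty(\mathbb{R}^{2d})$ it is defined by $\langle\mathfrak{T}_B k,\Phi\rangle=|\det B|^{-1}\langle k,\mathfrak{T}_{B^{-1}}\Phi\rangle$, $\Phi\in M^1(\mathbb{R}^{2d})$. $\mathcal{F}_2$ is the partial Fourier transform in the second variable, $\mathcal{F}_2\Phi(x,\omega)=\int_{\mathbb{R}^d}e^{-2\pi i\omega\cdot t}\Phi(x,t)\,dt$, extended to $M^\infty(\mathbb{R}^{2d})$ by $\langle\mathcal{F}_2k,\Phi\rangle=\langle k,\mathcal{F}_2^{-1}\Phi\rangle$. Both are isomorphisms of $M^\infty(\mathbb{R}^{2d})$. The matrix-Wigner distribution associated with $A\in\mathrm{GL}(2d,\mathbb{R})$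 is $\mathcal{B}_A(f,g)=\mathcal{F}_2\mathfrak{T}_A(f\otimes\overline{g})$; it maps $M^1(\mathbb{R}^d)\times M^1(\mathbb{R}^d)$ continuously into $M^1(\mathbb{R}^{2d})$. For $\sigma\in M^\infty(\mathbb{R}^{2d})$ the operator $\sigma^A:M^1(\mathbb{R}^d)\to M^\infty(\mathbb{R}^d)$ is defined by $\langle\sigma^Af,g\rangle=\langle\sigma,\mathcal{B}_A(g,f)\rangle$ for $f,g\in M^1(\mathbb{R}^d)$. The superposition in representation 3 is understood weakly: $\langle Tf,g\rangle=\langle F,V_fg\rangle$ for all $f,g\in M^1(\mathbb{R}^d)$ (formally $\iint F(x,\omega)\langle M_\omega T_xf,g\rangle\,dx\,d\omega$). *)

theory Defs
  imports "HOL-Analysis.Analysis" "HOL-Probability.Essential_Supremum"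
begin

section \<open>Schwartz functions and tempered distributions\<close>

text \<open>
  Iterated partial derivatives are indexed by lists of standard basis vectors; for smooth functions
  a list represents the multi-index counting its entries.
\<close>

fun partials :: "'a::euclidean_space list \<Rightarrow> ('a \<Rightarrow> complex) \<Rightarrow> 'a \<Rightarrow> complex" where
  "partials [] f = f"
| "partials (b # bs) f = (\<lambda>x. frechet_derivative (partials bs f) (at x) b)"

definition smooth :: "('a::euclidean_space \<Rightarrow> complex) \<Rightarrow> bool" where
  "smooth f \<longleftrightarrow> (\<forall>bs x. set bs \<subseteq> Basis \<longrightarrow> partials bs f differentiable (at x))"

definition schwartz :: "('a::euclidean_space \<Rightarrow> complex) set" where
  "schwartz = {f. smooth f \<and>
     (\<forall>bs N. set bs \<subseteq> Basis \<longrightarrow> (\<exists>C. \<forall>x. (1 + norm x) ^ N * norm (partials bs f x) \<le> C))}"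

definition schwartz_seminorm :: "nat \<Rightarrow> ('a::euclidean_space \<Rightarrow> complex) \<Rightarrow> real" where
  "schwartz_seminorm N f =
     (\<Sum>bs | set bs \<subseteq> Basis \<and> length bs \<le> N. SUP x. (1 + norm x) ^ N * norm (partials bs f x))"

text \<open>
  A distribution \<open>u\<close> is represented by the functional \<open>\<lambda>\<psi>. \<langle>u, \<psi>\<rangle>\<close>, which is conjugate-linear because
  brackets are. Setting it to 0 off the Schwartz space makes equality of HOL functions
  coincide with equality of distributions.
\<close>

type_synonym 'a distr = "('a \<Rightarrow> complex) \<Rightarrow> complex"

definition tempered :: "'a::euclidean_space distr set" where
  "tempered = {u.
     (\<forall>f. f \<notin> schwartz \<longrightarrow> u f = 0) \<and>
     (\<forall>f\<in>schwartz. \<forall>g\<in>schwartz. u (\<lambda>x. f x + g x) = u f + u g) \<and>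
     (\<forall>f\<in>schwartz. \<forall>c. u (\<lambda>x. c * f x) = cnj c * u f) \<and>
     (\<exists>N C. \<forall>f\<in>schwartz. norm (u f) \<le> C * schwartz_seminorm N f)}"

definition L2_inner :: "('a::euclidean_space \<Rightarrow> complex) \<Rightarrow> ('a \<Rightarrow> complex) \<Rightarrow> complex" where
  "L2_inner f g = (LINT t|lborel. f t * cnj (g t))"

definition distr_of :: "('a::euclidean_space \<Rightarrow> complex) \<Rightarrow> 'a distr" where
  "distr_of f = (\<lambda>\<psi>. if \<psi> \<in> schwartz then L2_inner f \<psi> else 0)"

section \<open>Short-time Fourier transform and modulation spaces\<close>

definition translate :: "'a::euclidean_space \<Rightarrow> ('a \<Rightarrow> complex) \<Rightarrow> 'a \<Rightarrow> complex" where
  "translate x f = (\<lambda>t. f (t - x))"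

definition modulate :: "'a::euclidean_space \<Rightarrow> ('a \<Rightarrow> complex) \<Rightarrow> 'a \<Rightarrow> complex" where
  "modulate \<omega> f = (\<lambda>t. cis (2 * pi * (t \<bullet> \<omega>)) * f t)"

text \<open>The transform with window \<open>g\<close>, for functions and for distributions (Schwartz \<open>g\<close>).\<close>

definition stft :: "('a::euclidean_space \<Rightarrow> complex) \<Rightarrow> ('a \<Rightarrow> complex) \<Rightarrow> 'a \<times> 'a \<Rightarrow> complex" where
  "stft g f = (\<lambda>(x, \<omega>). L2_inner f (modulate \<omega> (translate x g)))"

definition stft_distr :: "('a::euclidean_space \<Rightarrow> complex) \<Rightarrow> 'a distr \<Rightarrow> 'a \<times> 'a \<Rightarrow> complex" where
  "stft_distr g u = (\<lambda>(x, \<omega>). u (modulate \<omega> (translate x g)))"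

definition Minf :: "('a::euclidean_space \<Rightarrow> complex) \<Rightarrow> 'a distr set" where
  "Minf \<phi> = {u \<in> tempered. stft_distr \<phi> u \<in> borel_measurable lborel \<and>
     esssup lborel (\<lambda>z. ereal (norm (stft_distr \<phi> u z))) < \<infinity>}"

definition Minf_norm :: "('a::euclidean_space \<Rightarrow> complex) \<Rightarrow> 'a distr \<Rightarrow> real" where
  "Minf_norm \<phi> u = real_of_ereal (esssup lborel (\<lambda>z. ereal (norm (stft_distr \<phi> u z))))"

definition M1_distr :: "('a::euclidean_space \<Rightarrow> complex) \<Rightarrow> 'a distr set" where
  "M1_distr \<phi> = {u \<in> tempered. integrable lborel (stft_distr \<phi> u)}"

text \<open>
  Every distribution in \<open>M1_distr \<phi>\<close> is given by a unique continuous function. Tensor products and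
  coordinate changes need pointwise values, so \<open>M1\<close> consists of these continuous functions. The
  integrability clause says that \<open>distr_of f\<close> is not a junk value of the Bochner integral.
\<close>

definition M1 :: "('a::euclidean_space \<Rightarrow> complex) \<Rightarrow> ('a \<Rightarrow> complex) set" where
  "M1 \<phi> = {f. continuous_on UNIV f \<and>
     (\<forall>\<psi>\<in>schwartz. integrable lborel (\<lambda>t. f t * cnj (\<psi> t))) \<and> distr_of f \<in> M1_distr \<phi>}"

definition M1_norm :: "('a::euclidean_space \<Rightarrow> complex) \<Rightarrow> ('a \<Rightarrow> complex) \<Rightarrow> real" where
  "M1_norm \<phi> f = (LINT z|lborel. norm (stft_distr \<phi> (distr_of f) z))"

text \<open>
  The duality bracket extends a distribution from Schwartz functions to \<open>M1 \<phi>\<close> by continuity: it is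
  the limit of \<open>u \<psi>\<close> as the Schwartz function \<open>\<psi>\<close> tends to \<open>g\<close> in the norm of \<open>M1 \<phi>\<close>.
\<close>

definition bracket :: "('a::euclidean_space \<Rightarrow> complex) \<Rightarrow> 'a distr \<Rightarrow> ('a \<Rightarrow> complex) \<Rightarrow> complex" where
  "bracket \<phi> u g =
     Lim (inf (principal schwartz) (filtercomap (\<lambda>\<psi>. M1_norm \<phi> (\<lambda>x. \<psi> x - g x)) (nhds 0))) u"

text \<open>The element \<open>u\<close> of \<open>Minf \<phi>\<close> defined by prescribing \<open>\<langle>u, g\<rangle> = L g\<close> for all \<open>g\<close> in \<open>M1 \<phi>\<close>.\<close>

definition Minf_by :: "('a::euclidean_space \<Rightarrow> complex) \<Rightarrow> (('a \<Rightarrow> complex) \<Rightarrow> complex) \<Rightarrow> 'a distr" where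
  "Minf_by \<phi> L = (THE u. u \<in> Minf \<phi> \<and> (\<forall>g\<in>M1 \<phi>. bracket \<phi> u g = L g))"

definition scale_distr :: "complex \<Rightarrow> 'a::euclidean_space distr \<Rightarrow> 'a distr" where
  "scale_distr c u = (\<lambda>\<psi>. c * u \<psi>)"

definition continuous_linear_M1_Minf ::
    "('a::euclidean_space \<Rightarrow> complex) \<Rightarrow> (('a \<Rightarrow> complex) \<Rightarrow> 'a distr) \<Rightarrow> bool" where
  "continuous_linear_M1_Minf \<phi> T \<longleftrightarrow>
     (\<forall>f\<in>M1 \<phi>. T f \<in> Minf \<phi>) \<and>
     (\<forall>f\<in>M1 \<phi>. \<forall>g\<in>M1 \<phi>. T (\<lambda>x. f x + g x) = (\<lambda>\<psi>. T f \<psi> + T g \<psi>)) \<and>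
     (\<forall>f\<in>M1 \<phi>. \<forall>c. T (\<lambda>x. c * f x) = scale_distr c (T f)) \<and>
     (\<forall>f\<in>M1 \<phi>. \<forall>\<epsilon>>0. \<exists>\<delta>>0. \<forall>g\<in>M1 \<phi>. M1_norm \<phi> (\<lambda>x. g x - f x) < \<delta> \<longrightarrow>
        Minf_norm \<phi> (\<lambda>\<psi>. T g \<psi> - T f \<psi>) < \<epsilon>)"

section \<open>Coordinate changes and the partial Fourier transform on phase space\<close>

text \<open>
  Functions on \<open>\<real>\<^bsup>2d\<^esup>\<close> take pairs of vectors as arguments; matrices of size \<open>2d\<close> are indexed by
  \<open>'d + 'd\<close>, where \<open>Inl\<close> marks the first block of coordinates and \<open>Inr\<close> the second.
\<close>

type_synonym 'd phase = "(real^'d) \<times> (real^'d)"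
type_synonym 'd matrix2d = "real^('d + 'd)^('d + 'd)"

definition vec_join :: "('d::finite) phase \<Rightarrow> real^('d + 'd)" where
  "vec_join = (\<lambda>(x, y). \<chi> i. case i of Inl j \<Rightarrow> x $ j | Inr j \<Rightarrow> y $ j)"

definition vec_split :: "real^('d::finite + 'd) \<Rightarrow> 'd phase" where
  "vec_split v = ((\<chi> j. v $ Inl j), (\<chi> j. v $ Inr j))"

definition block_matrix ::
    "real^('d::finite)^'d \<Rightarrow> real^'d^'d \<Rightarrow> real^'d^'d \<Rightarrow> real^'d^'d \<Rightarrow> 'd matrix2d" where
  "block_matrix P Q R S = (\<chi> i j. case i of
       Inl a \<Rightarrow> (case j of Inl b \<Rightarrow> P $ a $ b | Inr b \<Rightarrow> Q $ a $ b)
     | Inr a \<Rightarrow> (case j of Inl b \<Rightarrow> R $ a $ b | Inr b \<Rightarrow> S $ a $ b))"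

definition A_ST :: "('d::finite) matrix2d" where
  "A_ST = block_matrix 0 (mat 1) (- mat 1) (mat 1)"

definition coord_change ::
    "('d::finite) matrix2d \<Rightarrow> ('d phase \<Rightarrow> complex) \<Rightarrow> 'd phase \<Rightarrow> complex" where
  "coord_change B \<Phi> = (\<lambda>z. \<Phi> (vec_split (B *v vec_join z)))"

lemma coord_change_A_ST:
  fixes x y :: "real^('d::finite)"
  shows "coord_change A_ST \<Phi> (x, y) = \<Phi> (y, y - x)"
proof -
  have *: "(\<Sum>k\<in>UNIV. f k) = (\<Sum>b\<in>UNIV. f (Inl b)) + (\<Sum>b\<in>UNIV. f (Inr b))"
    for f :: "'d + 'd \<Rightarrow> real"
    by (simp add: UNIV_Plus_UNIV [symmetric] sum.Plus del: UNIV_Plus_UNIV)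
  show ?thesis
    unfolding coord_change_def A_ST_def block_matrix_def vec_split_def vec_join_def
    by (simp add: matrix_vector_mult_def * mat_def if_distrib [of "\<lambda>c. c * _"]
        if_distrib [of uminus] sum_negf cong: if_cong)
      (rule arg_cong [where f = \<Phi>], simp add: vec_eq_iff)
qed

definition fourier2 :: "(('d::finite) phase \<Rightarrow> complex) \<Rightarrow> 'd phase \<Rightarrow> complex" where
  "fourier2 \<Phi> = (\<lambda>(x, \<omega>). LINT t|lborel. cis (- (2 * pi * (\<omega> \<bullet> t))) * \<Phi> (x, t))"

definition inv_fourier2 :: "(('d::finite) phase \<Rightarrow> complex) \<Rightarrow> 'd phase \<Rightarrow> complex" where
  "inv_fourier2 \<Phi> = (\<lambda>(x, t). LINT \<omega>|lborel. cis (2 * pi * (\<omega> \<bullet> t)) * \<Phi> (x, \<omega>))"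

text \<open>The extensions to \<open>Minf \<psi>\<close>, by duality.\<close>

definition coord_change_Minf :: "(('d::finite) phase \<Rightarrow> complex) \<Rightarrow> 'd matrix2d \<Rightarrow>
    'd phase distr \<Rightarrow> 'd phase distr" where
  "coord_change_Minf \<psi> B k =
     Minf_by \<psi> (\<lambda>\<Phi>. of_real (inverse \<bar>det B\<bar>) * bracket \<psi> k (coord_change (matrix_inv B) \<Phi>))"

definition fourier2_Minf :: "(('d::finite) phase \<Rightarrow> complex) \<Rightarrow>
    'd phase distr \<Rightarrow> 'd phase distr" where
  "fourier2_Minf \<psi> k = Minf_by \<psi> (\<lambda>\<Phi>. bracket \<psi> k (inv_fourier2 \<Phi>))"

section \<open>Matrix-Wigner distributions and the associated operators\<close>

definition tensor :: "('a \<Rightarrow> complex) \<Rightarrow> ('b \<Rightarrow> complex) \<Rightarrow> 'a \<times> 'b \<Rightarrow> complex" where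
  "tensor f g = (\<lambda>(x, y). f x * g y)"

definition matrix_wigner :: "('d::finite) matrix2d \<Rightarrow> (real^'d \<Rightarrow> complex) \<Rightarrow>
    (real^'d \<Rightarrow> complex) \<Rightarrow> 'd phase \<Rightarrow> complex" where
  "matrix_wigner A f g = fourier2 (coord_change A (tensor f (\<lambda>y. cnj (g y))))"

text \<open>Here \<open>\<phi>\<close> is the window on \<open>\<real>\<^bsup>d\<^esup>\<close> and \<open>\<psi>\<close> the one on \<open>\<real>\<^bsup>2d\<^esup>\<close>.\<close>

definition pseudodiff :: "(real^('d::finite) \<Rightarrow> complex) \<Rightarrow> ('d phase \<Rightarrow> complex) \<Rightarrow>
    'd matrix2d \<Rightarrow> 'd phase distr \<Rightarrow> (real^'d \<Rightarrow> complex) \<Rightarrow> (real^'d) distr" where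
  "pseudodiff \<phi> \<psi> A \<sigma> f = Minf_by \<phi> (\<lambda>g. bracket \<psi> \<sigma> (matrix_wigner A g f))"

end

theory Submission
  imports Defs "HOL-Probability.Characteristic_Functions"
begin

text \<open>
  Everything rests on reconstruction: by Fourier inversion, \<open>f t\<close> is, up to the constant
  \<open>\<integral>\<bar>\<phi>\<bar>\<^sup>2\<close>, the integral of \<open>stft \<phi> f w\<close> against the time-frequency shifts \<open>tfs w \<phi> t\<close>. Hence
  \<open>M1\<close> consists of the absolutely convergent superpositions of time-frequency shifts of a Schwartz
  function. Coordinate changes, the partial Fourier transform and tensor products map such shifts
  to such shifts, which makes them bounded on \<open>M1\<close>. A tempered distribution may be applied under
  the superposition integral, so that \<open>\<langle>u, g\<rangle>\<close> is the \<open>L\<^sup>2\<close> pairing of the short-time Fourier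
  transforms of \<open>u\<close> and \<open>g\<close>, and \<open>Minf\<close> is the space of bounded antilinear functionals on \<open>M1\<close>.
  The kernel \<open>k\<close> of \<open>T\<close> is the functional whose coefficients with respect to the window
  \<open>tensor \<phi> (cnj \<phi>)\<close> are the matrix coefficients of \<open>T\<close> between shifts of \<open>\<phi>\<close>; the symbol and the
  spreading function are obtained from \<open>k\<close> by duality.
\<close>

section \<open>Schwartz functions\<close>

text \<open>\<open>bracket\<close> is a limit and \<open>Minf_by\<close> a definite description, so
  both are informative only once the functional in question is known to be antilinear and bounded on
  \<open>M1\<close>. This is why the maps behind the dual definitions must first be bounded on
  \<open>M1\<close>. The choice of the kernel is forced: a shift of the tensor window is a shift of
  \<phi> times a conjugated shift of \<phi>, so testing k against it must give \<open>T\<close>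
  between two shifts. Since the prescribed window \<psi> is unrelated to this tensor, independence
  of \<open>M1\<close> from the window enters. The two other representations come from one identity:
  \<open>matrix_wigner A g f\<close> and \<open>stft f g\<close> are images of the same tensor under
  a coordinate change, by A or by \<open>A_ST\<close>, followed by \<open>fourier2\<close>. Duality
  then contributes the inverse of the absolute determinant, which the factor in \<sigma> cancels and
  which equals 1 for \<open>A_ST\<close>.\<close>

abbreviation pd :: "'a::euclidean_space \<Rightarrow> ('a \<Rightarrow> complex) \<Rightarrow> 'a \<Rightarrow> complex" where
  "pd b f \<equiv> partials [b] f"

lemma partials_append: "partials (bs @ cs) f = partials bs (partials cs f)"
  by (induction bs) auto

lemma pd_eqI:
  assumes "\<And>x. (f has_derivative f' x) (at x)"
  shows "pd b f = (\<lambda>x. f' x b)"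
  using frechet_derivative_at[OF assms] by (simp add: fun_eq_iff)

text \<open>Iterated partials of f stay in any class that contains f and is closed under first-order
  partials, so differentiability and decay only have to be checked on the class. This replaces
  Leibniz formulas for \<open>partials bs\<close>. In the applications C collects all functions of
  one shape, such as shifts or tensors of Schwartz functions.\<close>

lemma schwartz_coinduct:
  assumes "f \<in> C"
    and "\<And>g x. g \<in> C \<Longrightarrow> g differentiable (at x)"
    and "\<And>g b. g \<in> C \<Longrightarrow> b \<in> Basis \<Longrightarrow> pd b g \<in> C"
    and "\<And>g N. g \<in> C \<Longrightarrow> \<exists>K. \<forall>x. (1 + norm x) ^ N * norm (g x) \<le> K"
  shows "f \<in> schwartz"
proof -
  have "set bs \<subseteq> Basis \<Longrightarrow> partials bs f \<in> C" for bs
    by (induction bs) (use assms(1,3) in auto)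
  with assms(2,4) show ?thesis unfolding schwartz_def smooth_def by blast
qed

lemma schwartz_partials:
  assumes "f \<in> schwartz" "set cs \<subseteq> Basis"
  shows "partials cs f \<in> schwartz"
  using assms by (auto simp: schwartz_def smooth_def simp flip: partials_append)

lemma schwartz_pd: "f \<in> schwartz \<Longrightarrow> b \<in> Basis \<Longrightarrow> pd b f \<in> schwartz"
  by (rule schwartz_partials) auto

lemma schwartz_differentiable: "f \<in> schwartz \<Longrightarrow> f differentiable (at x)"
  unfolding schwartz_def smooth_def by (auto dest!: spec[of _ "[]"])

lemma schwartz_decay:
  assumes "f \<in> schwartz"
  obtains K where "K > 0" "\<And>x. (1 + norm x) ^ N * norm (f x) \<le> K"
proof -
  obtain K where "\<forall>x. (1 + norm x) ^ N * norm (f x) \<le> K"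
    using assms unfolding schwartz_def by (force dest!: spec[of _ "[]"])
  then show ?thesis by (intro that[of "max K 1"]) (auto simp: le_max_iff_disj)
qed

lemma schwartz_bounded:
  assumes "f \<in> schwartz"
  obtains K where "K > 0" "\<And>x. norm (f x) \<le> K"
  using schwartz_decay[OF assms, of 0] by auto

lemma schwartz_has_derivative:
  assumes "f \<in> schwartz"
  shows "(f has_derivative (\<lambda>h. \<Sum>b\<in>Basis. (h \<bullet> b) *\<^sub>R pd b f x)) (at x)"
proof -
  have D: "(f has_derivative frechet_derivative f (at x)) (at x)"
    using schwartz_differentiable[OF assms] frechet_derivative_works by blast
  then interpret linear "frechet_derivative f (at x)" by (rule has_derivative_linear)
  have "frechet_derivative f (at x) h = (\<Sum>b\<in>Basis. (h \<bullet> b) *\<^sub>R frechet_derivative f (at x) b)" for h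
    using sum[of "\<lambda>b. (h \<bullet> b) *\<^sub>R b" Basis] by (simp add: euclidean_representation scale)
  then show ?thesis unfolding partials.simps by (intro has_derivative_eq_rhs[OF D] ext)
qed

lemma schwartz_continuous: "f \<in> schwartz \<Longrightarrow> continuous_on UNIV f"
  by (rule continuous_at_imp_continuous_on) (blast intro: has_derivative_continuous schwartz_has_derivative)

lemma schwartz_measurable [measurable_dest]: "f \<in> schwartz \<Longrightarrow> f \<in> borel_measurable borel"
  using schwartz_continuous borel_measurable_continuous_onI by blast

lemma schwartz_add:
  assumes "f \<in> schwartz" "g \<in> schwartz"
  shows "(\<lambda>x. f x + g x) \<in> schwartz"
proof (rule schwartz_coinduct[where C = "{\<lambda>x. f x + g x | f g. f \<in> schwartz \<and> g \<in> schwartz}"], goal_cases)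
  case 1 then show ?case using assms by auto
next
  case (2 h x)
  then show ?case using differentiable_add schwartz_differentiable by blast
next
  case (3 h b)
  then obtain f g where fg: "f \<in> schwartz" "g \<in> schwartz" "h = (\<lambda>x. f x + g x)" by auto
  have "pd b h = (\<lambda>x. pd b f x + pd b g x)"
    unfolding fg(3)
    by (subst pd_eqI, rule has_derivative_add, rule schwartz_has_derivative[OF fg(1)],
        rule schwartz_has_derivative[OF fg(2)])
      (use 3 in \<open>simp add: inner_Basis if_distrib[of "\<lambda>c. c *\<^sub>R _"] cong: if_cong\<close>)
  then show ?case using 3 fg schwartz_pd by blast
next
  case (4 h N)
  then obtain f g where fg: "f \<in> schwartz" "g \<in> schwartz" "h = (\<lambda>x. f x + g x)" by auto
  obtain K where K: "\<And>x. (1 + norm x) ^ N * norm (f x) \<le> K" using schwartz_decay[OF fg(1)] by blast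
  obtain L where L: "\<And>x. (1 + norm x) ^ N * norm (g x) \<le> L" using schwartz_decay[OF fg(2)] by blast
  have "(1 + norm x) ^ N * norm (h x) \<le> K + L" for x
  proof -
    have "(1 + norm x) ^ N * norm (h x) \<le> (1 + norm x) ^ N * (norm (f x) + norm (g x))"
      unfolding fg(3) by (intro mult_left_mono norm_triangle_ineq) auto
    with K[of x] L[of x] show ?thesis by (simp add: distrib_left)
  qed
  then show ?case by blast
qed

lemma pd_cmult:
  assumes "f \<in> schwartz" "b \<in> Basis"
  shows "pd b (\<lambda>x. c * f x) = (\<lambda>x. c * pd b f x)"
  by (subst pd_eqI, rule has_derivative_mult_right, rule schwartz_has_derivative[OF assms(1)])
    (use assms(2) in \<open>simp add: inner_Basis if_distrib[of "\<lambda>c. c *\<^sub>R _"] cong: if_cong\<close>)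

lemma pd_add:
  assumes "f \<in> schwartz" "g \<in> schwartz" "b \<in> Basis"
  shows "pd b (\<lambda>x. f x + g x) = (\<lambda>x. pd b f x + pd b g x)"
  by (subst pd_eqI, rule has_derivative_add, rule schwartz_has_derivative[OF assms(1)],
      rule schwartz_has_derivative[OF assms(2)])
    (use assms(3) in \<open>simp add: inner_Basis if_distrib[of "\<lambda>c. c *\<^sub>R _"] cong: if_cong\<close>)

lemma schwartz_cmult:
  assumes "f \<in> schwartz"
  shows "(\<lambda>x. c * f x) \<in> schwartz"
proof (rule schwartz_coinduct[where C = "{\<lambda>x. c * f x | f. f \<in> schwartz}"], goal_cases)
  case 1 then show ?case using assms by auto
next
  case (2 h x)
  then show ?case using differentiable_mult[OF differentiable_const] schwartz_differentiable by blast
next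
  case (3 h b)
  then show ?case using schwartz_pd pd_cmult by blast
next
  case (4 h N)
  then obtain f where f: "f \<in> schwartz" "h = (\<lambda>x. c * f x)" by auto
  obtain K where K: "\<And>x. (1 + norm x) ^ N * norm (f x) \<le> K" using schwartz_decay[OF f(1)] by blast
  have "(1 + norm x) ^ N * norm (h x) \<le> norm c * K" for x
    using mult_left_mono[OF K[of x], of "norm c"] by (simp add: f norm_mult mult_ac)
  then show ?case by blast
qed

lemma partials_add:
  assumes "f \<in> schwartz" "g \<in> schwartz" "set bs \<subseteq> Basis"
  shows "partials bs (\<lambda>x. f x + g x) = (\<lambda>x. partials bs f x + partials bs g x)"
  using assms(3)
proof (induction bs)
  case (Cons b bs)
  then have "partials (b # bs) (\<lambda>x. f x + g x) = pd b (\<lambda>x. partials bs f x + partials bs g x)" by simp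
  also have "\<dots> = (\<lambda>x. pd b (partials bs f) x + pd b (partials bs g) x)"
    using Cons by (intro pd_add schwartz_partials assms) auto
  finally show ?case by simp
qed auto

lemma partials_cmult:
  assumes "f \<in> schwartz" "set bs \<subseteq> Basis"
  shows "partials bs (\<lambda>x. c * f x) = (\<lambda>x. c * partials bs f x)"
  using assms(2)
proof (induction bs)
  case (Cons b bs)
  then have "partials (b # bs) (\<lambda>x. c * f x) = pd b (\<lambda>x. c * partials bs f x)" by simp
  also have "\<dots> = (\<lambda>x. c * pd b (partials bs f) x)"
    using Cons by (intro pd_cmult schwartz_partials assms) auto
  finally show ?case by simp
qed auto

lemma schwartz_uminus: "f \<in> schwartz \<Longrightarrow> (\<lambda>x. - f x) \<in> schwartz"
  using schwartz_cmult[of f "-1"] by simp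

lemma schwartz_diff:
  assumes "f \<in> schwartz" "g \<in> schwartz"
  shows "(\<lambda>x. f x - g x) \<in> schwartz"
  using schwartz_add[OF assms(1) schwartz_uminus[OF assms(2)]] by simp

lemma partials_diff:
  assumes "f \<in> schwartz" "g \<in> schwartz" "set bs \<subseteq> Basis"
  shows "partials bs (\<lambda>x. f x - g x) = (\<lambda>x. partials bs f x - partials bs g x)"
  using partials_add[OF assms(1) schwartz_uminus[OF assms(2)] assms(3)]
    partials_cmult[OF assms(2,3), of "-1"] by simp

lemma schwartz_0: "(\<lambda>x. 0) \<in> schwartz"
proof (rule schwartz_coinduct[where C = "{\<lambda>x. 0}"], goal_cases)
  case (3 g b)
  have "pd b (\<lambda>x::'a. 0) = (\<lambda>x. 0)" by (rule pd_eqI) simp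
  then show ?case using 3 by simp
qed auto

lemma schwartz_sum:
  assumes "\<And>i. i \<in> I \<Longrightarrow> f i \<in> schwartz"
  shows "(\<lambda>x. \<Sum>i\<in>I. f i x) \<in> schwartz"
  using assms by (induction I rule: infinite_finite_induct) (auto intro: schwartz_0 schwartz_add)

lemma schwartz_cnj:
  assumes "f \<in> schwartz"
  shows "(\<lambda>x. cnj (f x)) \<in> schwartz"
proof (rule schwartz_coinduct[where C = "{\<lambda>x. cnj (f x) | f. f \<in> schwartz}"], goal_cases)
  case 1 then show ?case using assms by auto
next
  case (2 h x)
  then obtain f where f: "f \<in> schwartz" "h = (\<lambda>x. cnj (f x))" by auto
  show ?case
    unfolding f(2) differentiable_def
    by (rule exI, rule bounded_linear.has_derivative[OF bounded_linear_cnj schwartz_has_derivative[OF f(1)]])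
next
  case (3 h b)
  then obtain f where f: "f \<in> schwartz" "h = (\<lambda>x. cnj (f x))" by auto
  have "pd b h = (\<lambda>x. cnj (pd b f x))"
    unfolding f(2)
    by (subst pd_eqI, rule bounded_linear.has_derivative[OF bounded_linear_cnj],
        rule schwartz_has_derivative[OF f(1)])
      (use 3 in \<open>simp add: inner_Basis if_distrib[of "\<lambda>c. c *\<^sub>R _"] if_distrib[of cnj] cong: if_cong\<close>)
  then show ?case using 3 f schwartz_pd by blast
next
  case (4 h N)
  then obtain f where f: "f \<in> schwartz" "h = (\<lambda>x. cnj (f x))" by auto
  show ?case using schwartz_decay[OF f(1), of N] unfolding f(2) by (metis complex_mod_cnj)
qed

text \<open>Submultiplicativity of the weight \<open>1 + norm\<close>. It moves polynomial decay
  from a point to its translates, and from a pair to its two components.\<close>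

lemma one_plus_norm_add:
  fixes x y :: "'a::real_normed_vector"
  shows "1 + norm (x + y) \<le> (1 + norm x) * (1 + norm y)"
  using norm_triangle_ineq[of x y] mult_nonneg_nonneg[OF norm_ge_zero[of x] norm_ge_zero[of y]]
  unfolding distrib_left distrib_right by linarith

text \<open>The chain rule turns a partial derivative into a combination, with constant
  coefficients, of partials of f composed with L. Decay survives because the left inverse bounds
  \<open>norm x\<close> by a multiple of \<open>norm (L x)\<close>.\<close>

lemma schwartz_linear:
  fixes L :: "'a::euclidean_space \<Rightarrow> 'b::euclidean_space"
  assumes "f \<in> schwartz" "linear L" "linear L'" "\<And>x. L' (L x) = x"
  shows "(\<lambda>x. f (L x)) \<in> schwartz"
proof (rule schwartz_coinduct[where C = "{\<lambda>x. f (L x) | f. f \<in> schwartz}"], goal_cases)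
  case 1 then show ?case using assms by auto
next
  case (2 h x)
  have "L differentiable at x" using assms(2) by (simp add: linear_imp_differentiable)
  then show ?case using 2 differentiable_compose schwartz_differentiable by blast
next
  case (3 h b)
  then obtain f where f: "f \<in> schwartz" "h = (\<lambda>x. f (L x))" by auto
  have L: "(L has_derivative L) (at x)" for x
    using assms(2) linear_conv_bounded_linear bounded_linear_imp_has_derivative by blast
  have "pd b h = (\<lambda>x. (\<Sum>c\<in>Basis. (L b \<bullet> c) *\<^sub>R pd c f (L x)))"
    unfolding f(2)
    by (subst pd_eqI, rule has_derivative_compose[OF L], rule schwartz_has_derivative[OF f(1)]) auto
  also have "\<dots> = (\<lambda>x. (\<lambda>y. \<Sum>c\<in>Basis. of_real (L b \<bullet> c) * pd c f y) (L x))"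
    by (simp add: scaleR_conv_of_real)
  finally have "pd b h = (\<lambda>x. (\<lambda>y. \<Sum>c\<in>Basis. of_real (L b \<bullet> c) * pd c f y) (L x))" .
  moreover have "(\<lambda>y. \<Sum>c\<in>Basis. of_real (L b \<bullet> c) * pd c f y) \<in> schwartz"
    by (intro schwartz_sum schwartz_cmult schwartz_pd f(1))
  ultimately show ?case by (intro CollectI exI conjI)
next
  case (4 h N)
  then obtain f where f: "f \<in> schwartz" "h = (\<lambda>x. f (L x))" by auto
  obtain K where K: "\<And>x. (1 + norm x) ^ N * norm (f x) \<le> K" using schwartz_decay[OF f(1)] by blast
  obtain B where B: "B > 0" "\<And>x. norm (L' x) \<le> B * norm x"
    using linear_bounded_pos[OF assms(3)] by blast
  have "(1 + norm x) ^ N * norm (h x) \<le> (1 + B)^N * K" for x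
  proof -
    have "1 + norm x \<le> (1 + B) * (1 + norm (L x))"
    proof -
      have "norm x \<le> B * norm (L x)" using B(2)[of "L x"] assms(4) by metis
      with B(1) norm_ge_zero[of "L x"] show ?thesis unfolding distrib_left distrib_right by linarith
    qed
    then have "(1 + norm x) ^ N * norm (h x) \<le> ((1 + B) * (1 + norm (L x)))^N * norm (h x)"
      by (intro mult_right_mono power_mono) auto
    also have "\<dots> \<le> (1 + B)^N * K"
      using mult_left_mono[OF K[of "L x"], of "(1+B)^N"] B(1) by (simp add: power_mult_distrib f mult_ac)
    finally show ?thesis .
  qed
  then show ?case by blast
qed

lemma schwartz_coord_mult:
  assumes "f \<in> schwartz" 
  shows "(\<lambda>x. of_real (x \<bullet> a) * f x) \<in> schwartz"
\<comment> \<open>The extra summand g is what closes the class under partials: differentiating the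
  coordinate factor leaves a multiple of f without that factor.\<close>
proof (rule schwartz_coinduct[where C = "{\<lambda>x. g x + of_real (x \<bullet> a) * f x | f g. f \<in> schwartz \<and> g \<in> schwartz}"], goal_cases)
  case 1 then show ?case using assms schwartz_0 by (intro CollectI exI[of _ f] exI[of _ "\<lambda>x. 0"]) simp
next
  case (2 h x)
  have "(\<lambda>x. complex_of_real (x \<bullet> a)) differentiable at x"
    by (auto simp: differentiable_def intro!: exI derivative_eq_intros)
  moreover obtain f g where fg: "f \<in> schwartz" "g \<in> schwartz" "h = (\<lambda>x. g x + of_real (x \<bullet> a) * f x)" using 2 by auto
  ultimately show ?case
    unfolding fg(3) by (intro differentiable_add differentiable_mult schwartz_differentiable[OF fg(1)]
        schwartz_differentiable[OF fg(2)])
next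
  case (3 h b)
  then obtain f g where fg: "f \<in> schwartz" "g \<in> schwartz" "h = (\<lambda>x. g x + of_real (x \<bullet> a) * f x)" by auto
  have i: "((\<lambda>x. complex_of_real (x \<bullet> a)) has_derivative (\<lambda>h. of_real (h \<bullet> a))) (at x)" for x
    by (auto intro!: derivative_eq_intros)
  have "pd b h = (\<lambda>x. (pd b g x + of_real (b \<bullet> a) * f x) + of_real (x \<bullet> a) * pd b f x)"
    unfolding fg(3)
    by (subst pd_eqI, rule has_derivative_add, rule schwartz_has_derivative[OF fg(2)], 
       rule has_derivative_mult, rule i, rule schwartz_has_derivative[OF fg(1)])
      (use 3 in \<open>simp add: inner_Basis if_distrib[of "\<lambda>c. c *\<^sub>R _"] add_ac cong: if_cong\<close>)
  then show ?case
    using schwartz_pd[OF fg(1) 3(2)] schwartz_add[OF schwartz_pd[OF fg(2) 3(2)] schwartz_cmult[OF fg(1), of "of_real (b \<bullet> a)"]]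
    by (intro CollectI exI conjI)
next
  case (4 h N)
  then obtain f g where fg: "f \<in> schwartz" "g \<in> schwartz" "h = (\<lambda>x. g x + of_real (x \<bullet> a) * f x)" by auto
  \<comment> \<open>One power more than N, to pay for the factor
    \<open>x \<bullet> a\<close>.\<close>
  obtain K where K: "\<And>x. (1 + norm x) ^ (Suc N) * norm (f x) \<le> K" using schwartz_decay[OF fg(1)] by blast
  obtain L where L: "\<And>x. (1 + norm x) ^ N * norm (g x) \<le> L" using schwartz_decay[OF fg(2)] by blast
  have "(1 + norm x) ^ N * norm (h x) \<le> L + norm a * K" for x
  proof -
    have 1: "\<bar>x \<bullet> a\<bar> \<le> norm a * (1 + norm x)"
      using Cauchy_Schwarz_ineq2[of x a] norm_ge_zero[of a] unfolding distrib_left mult.commute[of "norm x"] by linarith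
    have "norm (h x) \<le> norm (g x) + \<bar>x \<bullet> a\<bar> * norm (f x)"
      unfolding fg(3) by (rule norm_triangle_le) (simp add: norm_mult)
    also have "\<dots> \<le> norm (g x) + norm a * (1 + norm x) * norm (f x)"
      by (intro add_left_mono mult_right_mono 1) auto
    finally have "(1 + norm x) ^ N * norm (h x) \<le> (1 + norm x) ^ N * (norm (g x) + norm a * (1 + norm x) * norm (f x))"
      by (intro mult_left_mono) auto
    also have "\<dots> = (1 + norm x) ^ N * norm (g x) + norm a * ((1 + norm x) ^ Suc N * norm (f x))"
      by (simp add: algebra_simps)
    also have "\<dots> \<le> L + norm a * K" by (intro add_mono L mult_left_mono K) auto
    finally show ?thesis .
  qed
  then show ?case by blast
qed

lemma schwartz_tensor:
  fixes f :: "'a::euclidean_space \<Rightarrow> complex" and g :: "'b::euclidean_space \<Rightarrow> complex"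
  assumes "f \<in> schwartz" "g \<in> schwartz"
  shows "tensor f g \<in> schwartz"
proof (rule schwartz_coinduct[where C = "{tensor f g | (f :: 'a \<Rightarrow> complex) (g :: 'b \<Rightarrow> complex). f \<in> schwartz \<and> g \<in> schwartz}"], goal_cases)
  case 1 then show ?case using assms by auto
next
  case (2 h x)
  have "(\<lambda>z::'a\<times>'b. f (fst z)) differentiable at x" if "f \<in> schwartz" for f
    by (intro differentiable_compose[of f fst] schwartz_differentiable that)
      (simp add: linear_imp_differentiable linear_fst)
  moreover have "(\<lambda>z::'a\<times>'b. g (snd z)) differentiable at x" if "g \<in> schwartz" for g
    by (intro differentiable_compose[of g snd] schwartz_differentiable that)
      (simp add: linear_imp_differentiable linear_snd)
  ultimately show ?case using 2 differentiable_mult unfolding tensor_def case_prod_beta by blast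
next
  case (3 h b)
  then obtain f :: "'a \<Rightarrow> complex" and g :: "'b \<Rightarrow> complex"
    where fg: "f \<in> schwartz" "g \<in> schwartz" "h = (\<lambda>z. f (fst z) * g (snd z))"
    unfolding tensor_def case_prod_beta by blast
  have D: "pd b h = (\<lambda>x. f (fst x) * (\<Sum>c\<in>Basis. (snd b \<bullet> c) *\<^sub>R pd c g (snd x))
      + (\<Sum>c\<in>Basis. (fst b \<bullet> c) *\<^sub>R pd c f (fst x)) * g (snd x))"
    unfolding fg(3)
    by (subst pd_eqI, rule has_derivative_mult,
        rule has_derivative_compose[OF has_derivative_fst[OF has_derivative_ident]], rule schwartz_has_derivative[OF fg(1)],
        rule has_derivative_compose[OF has_derivative_snd[OF has_derivative_ident]], rule schwartz_has_derivative[OF fg(2)]) auto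
  from 3(2) consider c where "c \<in> Basis" "b = (c, 0)" | c where "c \<in> Basis" "b = (0, c)"
    unfolding Basis_prod_def by auto
  then show ?case
  proof cases
    case (1 c)
    then have "pd b h = tensor (pd c f) g"
      by (subst D) (simp add: tensor_def fun_eq_iff inner_Basis if_distrib[of "\<lambda>c. c *\<^sub>R _"] cong: if_cong)
    then show ?thesis using schwartz_pd[OF fg(1) 1(1)] fg(2) by blast
  next
    case (2 c)
    then have "pd b h = tensor f (pd c g)"
      by (subst D) (simp add: tensor_def fun_eq_iff inner_Basis if_distrib[of "\<lambda>c. c *\<^sub>R _"] cong: if_cong)
    then show ?thesis using schwartz_pd[OF fg(2) 2(1)] fg(1) by blast
  qed
next
  case (4 h N)
  then obtain f :: "'a \<Rightarrow> complex" and g :: "'b \<Rightarrow> complex"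
    where fg: "f \<in> schwartz" "g \<in> schwartz" "h = (\<lambda>z. f (fst z) * g (snd z))"
    unfolding tensor_def case_prod_beta by blast
  obtain K where K: "K > 0" "\<And>x. (1 + norm x) ^ N * norm (f x) \<le> K" using schwartz_decay[OF fg(1)] by blast
  obtain L where L: "\<And>x. (1 + norm x) ^ N * norm (g x) \<le> L" using schwartz_decay[OF fg(2)] by blast
  have "(1 + norm z) ^ N * norm (h z) \<le> K * L" for z
  proof -
    have "1 + norm z \<le> (1 + norm (fst z)) * (1 + norm (snd z))"
      using one_plus_norm_add[of "(fst z, 0)" "(0, snd z)"] by (simp add: norm_Pair)
    then have "(1 + norm z) ^ N * norm (h z) \<le> ((1 + norm (fst z)) * (1 + norm (snd z)))^N * norm (h z)"
      by (intro mult_right_mono power_mono) auto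
    also have "\<dots> = ((1 + norm (fst z))^N * norm (f (fst z))) * ((1 + norm (snd z))^N * norm (g (snd z)))"
      by (simp add: fg power_mult_distrib norm_mult)
    also have "\<dots> \<le> K * L" using K L by (intro mult_mono) (auto intro: less_imp_le)
    finally show ?thesis .
  qed
  then show ?case by blast
qed

section \<open>Time-frequency shifts\<close>

definition tfs :: "'a::euclidean_space \<times> 'a \<Rightarrow> ('a \<Rightarrow> complex) \<Rightarrow> 'a \<Rightarrow> complex" where
  "tfs z f = modulate (snd z) (translate (fst z) f)"

lemma tfs_apply: "tfs z f t = cis (2 * pi * (t \<bullet> snd z)) * f (t - fst z)"
  by (simp add: tfs_def modulate_def translate_def)

lemma norm_tfs: "norm (tfs z f t) = norm (f (t - fst z))"
  by (simp add: tfs_apply norm_mult)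

lemma has_derivative_cis_inner:
  "((\<lambda>t. cis (2 * pi * (t \<bullet> w))) has_derivative (\<lambda>h. 2 * pi * \<i> * of_real (h \<bullet> w) * cis (2 * pi * (t \<bullet> w)))) (at t)"
proof -
  have "((\<lambda>t. 2 * pi * (t \<bullet> w)) has_derivative (\<lambda>h. 2 * pi * (h \<bullet> w))) (at t)"
    by (auto intro!: derivative_eq_intros)
  from has_derivative_cis[OF this] show ?thesis
    by (rule has_derivative_eq_rhs) (auto simp: scaleR_conv_of_real)
qed

lemma tfs_has_derivative:
  assumes "f \<in> schwartz"
  shows "(tfs z f has_derivative (\<lambda>h. tfs z (\<lambda>s. \<Sum>b\<in>Basis. (h \<bullet> b) *\<^sub>R pd b f s) t + 2 * pi * \<i> * of_real (h \<bullet> snd z) * tfs z f t)) (at t)"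
proof -
  have 1: "((\<lambda>t. f (t - fst z)) has_derivative (\<lambda>h. \<Sum>b\<in>Basis. (h \<bullet> b) *\<^sub>R pd b f (t - fst z))) (at t)"
    by (rule has_derivative_compose[OF _ schwartz_has_derivative[OF assms]]) (auto intro!: derivative_eq_intros)
  show ?thesis
    unfolding tfs_apply[abs_def]
    by (rule has_derivative_eq_rhs, rule has_derivative_mult, rule has_derivative_cis_inner, rule 1)
      (auto simp: fun_eq_iff algebra_simps)
qed

text \<open>Product rule: the derivative falls either on f or on the modulation, which brings down 2
  pi i times a frequency coordinate. That factor makes bounds on derivatives of shifts grow
  polynomially in z.\<close>

lemma pd_tfs:
  assumes "f \<in> schwartz" "b \<in> Basis"
  shows "pd b (tfs z f) = (\<lambda>t. tfs z (pd b f) t + 2 * pi * \<i> * of_real (b \<bullet> snd z) * tfs z f t)"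
  by (subst pd_eqI, rule tfs_has_derivative[OF assms(1)])
    (use assms(2) in \<open>simp add: inner_Basis if_distrib[of "\<lambda>c. c *\<^sub>R _"] cong: if_cong\<close>)

lemma tfs_add: "tfs z (\<lambda>t. f t + g t) = (\<lambda>t. tfs z f t + tfs z g t)"
  and tfs_cmult: "tfs z (\<lambda>t. c * f t) = (\<lambda>t. c * tfs z f t)"
  by (simp_all add: tfs_apply[abs_def] algebra_simps)

lemma schwartz_tfs:
  assumes "f \<in> schwartz"
  shows "tfs z f \<in> schwartz"
proof (rule schwartz_coinduct[where C = "{tfs z f | f. f \<in> schwartz}"], goal_cases)
  case 1 then show ?case using assms by auto
next
  case (2 h x)
  then show ?case using tfs_has_derivative unfolding differentiable_def by blast
next
  case (3 h b)
  then obtain f where f: "f \<in> schwartz" "h = tfs z f" by auto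
  have "pd b h = tfs z (\<lambda>t. pd b f t + (2 * pi * \<i> * of_real (b \<bullet> snd z)) * f t)"
    unfolding f(2) pd_tfs[OF f(1) 3(2)] tfs_add tfs_cmult ..
  then show ?case using schwartz_add[OF schwartz_pd[OF f(1) 3(2)] schwartz_cmult[OF f(1)]] by blast
next
  case (4 h N)
  then obtain f where f: "f \<in> schwartz" "h = tfs z f" by auto
  obtain K where K: "\<And>x. (1 + norm x) ^ N * norm (f x) \<le> K" using schwartz_decay[OF f(1)] by blast
  have "(1 + norm x) ^ N * norm (h x) \<le> (1 + norm (fst z))^N * K" for x
  proof -
    have "1 + norm x \<le> (1 + norm (fst z)) * (1 + norm (x - fst z))"
      using one_plus_norm_add[of "fst z" "x - fst z"] by simp
    then have "(1 + norm x) ^ N * norm (h x) \<le> ((1 + norm (fst z)) * (1 + norm (x - fst z)))^N * norm (h x)"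
      by (intro mult_right_mono power_mono) auto
    also have "\<dots> \<le> (1 + norm (fst z))^N * K"
      using mult_left_mono[OF K[of "x - fst z"], of "(1 + norm (fst z))^N"] 
      by (simp add: power_mult_distrib f norm_tfs mult_ac)
    finally show ?thesis .
  qed
  then show ?case by blast
qed

section \<open>Integration\<close>

text \<open>A non-integrable f has integral 0 by convention, so the pointwise majorant alone gives
  the estimate.\<close>

lemma norm_integral_le:
  fixes f :: "'b \<Rightarrow> complex"
  assumes "integrable M G" "\<And>w. w \<in> space M \<Longrightarrow> norm (f w) \<le> G w"
  shows "norm (LINT w|M. f w) \<le> (LINT w|M. G w)"
proof -
  have "norm (LINT w|M. f w) \<le> (LINT w|M. norm (f w))" by (rule integral_norm_bound)
  also have "\<dots> \<le> (LINT w|M. G w)"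
    by (rule integral_mono') (use assms order_trans[OF norm_ge_zero assms(2)] in auto)
  finally show ?thesis .
qed

lemma integral_translate:
  fixes f :: "'a::euclidean_space \<Rightarrow> 'b::{banach, second_countable_topology}"
  assumes "f \<in> borel_measurable borel"
  shows "(LINT x|lborel. f (x + c)) = (LINT x|lborel. f x)"
proof -
  have "(LINT x|lborel. f x) = (LINT x|distr lborel borel ((+) c). f x)"
    by (simp add: lborel_distr_plus)
  also have "\<dots> = (LINT x|lborel. f (c + x))"
    using assms by (intro integral_distr) auto
  finally show ?thesis by (simp add: add.commute)
qed

lemma integrable_translate:
  fixes f :: "'a::euclidean_space \<Rightarrow> 'b::{banach, second_countable_topology}"
  assumes "integrable lborel f"
  shows "integrable lborel (\<lambda>x. f (x + c))"
proof -
  have "f \<in> borel_measurable borel" using assms by auto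
  moreover have "integrable (distr lborel borel ((+) c)) f" using assms by (simp add: lborel_distr_plus)
  ultimately have "integrable lborel (\<lambda>x. f (c + x))"
    by (subst (asm) integrable_distr_eq) auto
  then show ?thesis by (simp add: add.commute)
qed

section \<open>An integrable weight of polynomial decay\<close>

lemma integrable_one_div_one_plus_square: "integrable lborel (\<lambda>x::real. 1 / (1 + x\<^sup>2))"
proof -
  have "set_integrable lborel (einterval (-\<infinity>) \<infinity>) (\<lambda>x::real. 1 / (1 + x\<^sup>2))"
  proof (rule interval_integral_FTC_nonneg(1)[where F = arctan and A = "-pi/2" and B = "pi/2"])
    show "((arctan \<circ> real_of_ereal) \<longlongrightarrow> - pi / 2) (at_right (- \<infinity>))"
      using tendsto_arctan_at_bot by (simp add: ereal_tendsto_simps1)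
    show "((arctan \<circ> real_of_ereal) \<longlongrightarrow> pi / 2) (at_left \<infinity>)"
      using tendsto_arctan_at_top by (simp add: ereal_tendsto_simps1)
    show "DERIV arctan x :> 1 / (1 + x\<^sup>2)" for x
      using DERIV_arctan[of x] by (simp add: divide_inverse)
    show "isCont (\<lambda>x. 1 / (1 + x\<^sup>2)) x" for x :: real
      by (intro continuous_intros) (metis add_pos_nonneg less_irrefl zero_le_power2 zero_less_one)
  qed auto
  then show ?thesis by (simp add: set_integrable_def einterval_def)
qed

text \<open>Each \<open>1 + (x \<bullet> b)\<close> with the inner product squared is at most the
  square of \<open>1 + norm x\<close>, so the weight is dominated by a product, over the basis, of
  integrable functions of one variable. This explains the exponent: two for each coordinate.\<close>

lemma integrable_inverse_weight:
  "integrable lborel (\<lambda>x::'a::euclidean_space. 1 / (1 + norm x) ^ (2 * DIM('a)))"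
proof (rule Bochner_Integration.integrable_bound)
  let ?f = "\<lambda>x::real. 1 / (1 + x\<^sup>2)"
  show "integrable lborel (\<lambda>x::'a. \<Prod>b\<in>Basis. ?f (x \<bullet> b))"
  proof (rule integrableI_nonneg)
    have "(\<integral>\<^sup>+ x. ennreal (?f x) \<partial>lborel) < \<infinity>"
      using integrable_one_div_one_plus_square
      by (subst nn_integral_eq_integral) auto
    then have "(\<Prod>b\<in>(Basis::'a set). \<integral>\<^sup>+ x. ennreal (?f x) \<partial>lborel) < \<infinity>"
      by (simp add: power_less_top_ennreal)
    moreover have "(\<integral>\<^sup>+ x. ennreal (\<Prod>b\<in>(Basis::'a set). ?f (x \<bullet> b)) \<partial>lborel) =
       (\<integral>\<^sup>+ x. (\<Prod>b\<in>(Basis::'a set). ennreal (?f (x \<bullet> b))) \<partial>lborel)"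
      by (intro nn_integral_cong) (subst prod_ennreal, auto)
    ultimately show "(\<integral>\<^sup>+ x. ennreal (\<Prod>b\<in>(Basis::'a set). ?f (x \<bullet> b)) \<partial>lborel) < \<infinity>"
      by (simp add: nn_integral_lborel_prod[of "\<lambda>_ x. ennreal (?f x)"])
  qed (auto intro!: prod_nonneg)
  show "AE x::'a in lborel. norm (1 / (1 + norm x) ^ (2 * DIM('a))) \<le> norm (\<Prod>b\<in>Basis. ?f (x \<bullet> b))"
  proof (rule AE_I2)
    fix x :: 'a
    have "1 + (x \<bullet> b)\<^sup>2 \<le> (1 + norm x)\<^sup>2" if "b \<in> Basis" for b
    proof -
      have "(x \<bullet> b)\<^sup>2 \<le> (norm x)\<^sup>2" 
        using Basis_le_norm[OF that, of x] by (metis abs_le_square_iff abs_norm_cancel)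
      then show ?thesis by (simp add: power2_sum add_increasing2)
    qed
    then have "(\<Prod>b\<in>(Basis::'a set). 1 + (x \<bullet> b)\<^sup>2) \<le> (\<Prod>b\<in>(Basis::'a set). (1 + norm x)\<^sup>2)"
      by (intro prod_mono) auto
    moreover have "0 < (\<Prod>b\<in>(Basis::'a set). 1 + (x \<bullet> b)\<^sup>2)"
      by (intro prod_pos) (auto intro: add_pos_nonneg)
    ultimately have "1 / (1 + norm x) ^ (2 * DIM('a)) \<le> (\<Prod>b\<in>Basis. ?f (x \<bullet> b))"
      by (simp add: power_mult[symmetric] mult.commute prod_dividef divide_left_mono)
    then show "norm (1 / (1 + norm x) ^ (2 * DIM('a))) \<le> norm (\<Prod>b\<in>Basis. ?f (x \<bullet> b))"
      by (auto simp: abs_prod)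
  qed
qed auto

lemma integrable_decay:
  fixes f :: "'a::euclidean_space \<Rightarrow> complex"
  assumes "f \<in> borel_measurable borel" "\<And>x. (1 + norm x) ^ (2 * DIM('a)) * norm (f x) \<le> K"
  shows "integrable lborel f"
proof (rule Bochner_Integration.integrable_bound)
  show "integrable lborel (\<lambda>x::'a. K * (1 / (1 + norm x) ^ (2 * DIM('a))))"
    by (intro integrable_mult_right integrable_inverse_weight)
  show "AE x in lborel. norm (f x) \<le> norm (K * (1 / (1 + norm x) ^ (2 * DIM('a))))"
  proof (rule AE_I2)
    fix x :: 'a
    have "0 < (1 + norm x) ^ (2 * DIM('a))" by (simp add: add_pos_nonneg)
    with assms(2)[of x] have "norm (f x) \<le> K * (1 / (1 + norm x) ^ (2 * DIM('a)))"
      by (simp add: pos_le_divide_eq mult.commute)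
    then show "norm (f x) \<le> norm (K * (1 / (1 + norm x) ^ (2 * DIM('a))))"
      by (rule order_trans) (simp only: real_norm_def abs_ge_self)
  qed
qed (use assms in simp)

lemma schwartz_integrable:
  assumes "f \<in> schwartz"
  shows "integrable lborel f"
  using schwartz_decay[OF assms] integrable_decay schwartz_measurable[OF assms] by metis

section \<open>Integrals depending on a parameter\<close>

lemma continuous_on_integral:
  fixes f :: "'a::metric_space \<Rightarrow> 'b \<Rightarrow> complex"
  assumes "\<And>w. w \<in> space M \<Longrightarrow> continuous_on UNIV (\<lambda>x. f x w)"
    and "\<And>x. f x \<in> borel_measurable M"
    and "\<And>x w. w \<in> space M \<Longrightarrow> norm (f x w) \<le> G w" "integrable M G"
  shows "continuous_on UNIV (\<lambda>x. LINT w|M. f x w)"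
  unfolding continuous_on_sequentially
proof (safe, goal_cases)
  case (1 X x)
  show ?case unfolding comp_def
  proof (rule integral_dominated_convergence[where w = G])
    show "AE w in M. (\<lambda>n. f (X n) w) \<longlonglongrightarrow> f x w"
    proof (rule AE_I2)
      fix w assume "w \<in> space M"
      from assms(1)[OF this] 1 show "(\<lambda>n. f (X n) w) \<longlonglongrightarrow> f x w"
        unfolding continuous_on_sequentially comp_def by blast
    qed
  qed (use assms in auto)
qed

text \<open>Dominated convergence along sequences tending to 0, applied to the normalised remainder
  of the first-order expansion. The bound on f' controls both parts of this remainder, the increment
  through the mean value inequality and the linear term directly; hence the majorant 2 * G.\<close>

lemma has_derivative_integral:
  fixes f :: "'a::euclidean_space \<Rightarrow> 'b \<Rightarrow> complex"
  assumes D: "\<And>x w. w \<in> space M \<Longrightarrow> ((\<lambda>x. f x w) has_derivative f' x w) (at x)"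
    and f: "\<And>x. integrable M (f x)"
    and f': "\<And>x h. (\<lambda>w. f' x w h) \<in> borel_measurable M"
    and le: "\<And>x w h. w \<in> space M \<Longrightarrow> norm (f' x w h) \<le> G w * norm h"
    and G: "integrable M G"
  shows "((\<lambda>x. LINT w|M. f x w) has_derivative (\<lambda>h. LINT w|M. f' x w h)) (at x)"
proof -
  have G0: "0 \<le> G w" if w: "w \<in> space M" for w
  proof -
    obtain b :: 'a where b: "b \<in> Basis" using nonempty_Basis by blast
    show ?thesis using order_trans[OF norm_ge_zero le[OF w, of x b]] b by simp
  qed
  have f'I: "integrable M (\<lambda>w. f' x w h)" for x h
    by (rule Bochner_Integration.integrable_bound[OF integrable_mult_left[OF G, of "norm h"] f'])
      (auto intro!: AE_I2 order_trans[OF le] simp: G0)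
  have bl: "bounded_linear (f' x w)" if "w \<in> space M" for w x
    using D[OF that] has_derivative_bounded_linear by blast
  have lip: "norm (f y w - f x w) \<le> G w * norm (y - x)" if w: "w \<in> space M" for w x y
    by (rule differentiable_bound[of UNIV "\<lambda>x. f x w" "\<lambda>x. f' x w"])
      (use D[OF w] le[OF w] G0[OF w] in \<open>auto intro!: onorm_le has_derivative_at_withinI\<close>)
  have "bounded_linear (\<lambda>h. LINT w|M. f' x w h)"
  proof (rule bounded_linear_intro)
    show "(LINT w|M. f' x w (h + k)) = (LINT w|M. f' x w h) + (LINT w|M. f' x w k)" for h k
    proof -
      have "(LINT w|M. f' x w (h + k)) = (LINT w|M. f' x w h + f' x w k)"
        by (rule Bochner_Integration.integral_cong[OF refl], rule linear_add, rule bounded_linear.linear, rule bl)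
      then show ?thesis using f'I by simp
    qed
    show "(LINT w|M. f' x w (r *\<^sub>R h)) = r *\<^sub>R (LINT w|M. f' x w h)" for r h
    proof -
      have "(LINT w|M. f' x w (r *\<^sub>R h)) = (LINT w|M. r *\<^sub>R f' x w h)"
        by (rule Bochner_Integration.integral_cong[OF refl], rule linear_scale, rule bounded_linear.linear, rule bl)
      then show ?thesis by simp
    qed
    show "norm (LINT w|M. f' x w h) \<le> norm h * (LINT w|M. G w)" for h
    proof -
      have "norm (LINT w|M. f' x w h) \<le> (LINT w|M. G w * norm h)"
        by (intro norm_integral_le integrable_mult_left G le)
      also have "\<dots> = norm h * (LINT w|M. G w)" by simp
      finally show ?thesis .
    qed
  qed
  moreover have "(\<lambda>h. norm ((LINT w|M. f (x + h) w) - (LINT w|M. f x w) - (LINT w|M. f' x w h)) / norm h) \<midarrow>0\<rightarrow> 0"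
    unfolding tendsto_at_iff_sequentially comp_def
  proof safe
    fix X :: "nat \<Rightarrow> 'a" assume X: "\<forall>i. X i \<in> UNIV - {0}" "X \<longlonglongrightarrow> 0"
    have eq: "norm ((LINT w|M. f (x + h) w) - (LINT w|M. f x w) - (LINT w|M. f' x w h)) / norm h
       = norm (LINT w|M. inverse (norm h) *\<^sub>R (f (x + h) w - f x w - f' x w h))" for h
    proof -
      have "(LINT w|M. f (x + h) w) - (LINT w|M. f x w) - (LINT w|M. f' x w h) = (LINT w|M. f (x + h) w - f x w - f' x w h)"
        by (subst Bochner_Integration.integral_diff[OF _ f'I], intro Bochner_Integration.integrable_diff f)
          (subst Bochner_Integration.integral_diff[OF f f], rule refl)
      then show ?thesis
        unfolding integral_scaleR_right norm_scaleR by (simp add: divide_inverse mult.commute)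
    qed
    have "(\<lambda>n. LINT w|M. inverse (norm (X n)) *\<^sub>R (f (x + X n) w - f x w - f' x w (X n))) \<longlonglongrightarrow> (LINT w|M. 0)"
    proof (rule integral_dominated_convergence[where w = "\<lambda>w. 2 * G w"])
      show "AE w in M. (\<lambda>n. inverse (norm (X n)) *\<^sub>R (f (x + X n) w - f x w - f' x w (X n))) \<longlonglongrightarrow> 0"
      proof (rule AE_I2)
        fix w assume w: "w \<in> space M"
        have "(\<lambda>h. norm (f (x + h) w - f x w - f' x w h) / norm h) \<midarrow>0\<rightarrow> 0"
          using D[OF w, of x] unfolding has_derivative_at by blast
        then have "(\<lambda>n. norm (f (x + X n) w - f x w - f' x w (X n)) / norm (X n)) \<longlonglongrightarrow> 0"
          using X unfolding tendsto_at_iff_sequentially comp_def by blast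
        then have "(\<lambda>n. norm (inverse (norm (X n)) *\<^sub>R (f (x + X n) w - f x w - f' x w (X n)))) \<longlonglongrightarrow> 0"
          by (simp add: divide_inverse mult.commute)
        then show "(\<lambda>n. inverse (norm (X n)) *\<^sub>R (f (x + X n) w - f x w - f' x w (X n))) \<longlonglongrightarrow> 0"
          by (rule tendsto_norm_zero_cancel)
      qed
      show "AE w in M. norm (inverse (norm (X n)) *\<^sub>R (f (x + X n) w - f x w - f' x w (X n))) \<le> 2 * G w" for n
      proof (rule AE_I2)
        fix w assume w: "w \<in> space M"
        have "norm (f (x + X n) w - f x w - f' x w (X n)) \<le> G w * norm (X n) + G w * norm (X n)"
          using lip[OF w, of "x + X n" x] le[OF w, of x "X n"] norm_triangle_ineq4[of "f (x + X n) w - f x w" "f' x w (X n)"] by simp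
        moreover have "X n \<noteq> 0" using X by auto
        ultimately show "norm (inverse (norm (X n)) *\<^sub>R (f (x + X n) w - f x w - f' x w (X n))) \<le> 2 * G w"
          by (simp add: divide_simps mult_ac)
      qed
    qed (use f f'I G in \<open>auto intro!: borel_measurable_integrable\<close>)
    then show "(\<lambda>n. norm ((LINT w|M. f (x + X n) w) - (LINT w|M. f x w) - (LINT w|M. f' x w (X n))) / norm (X n)) \<longlonglongrightarrow> 0"
      unfolding eq by (intro tendsto_norm_zero) (simp only: Bochner_Integration.integral_zero)
  qed
  ultimately show ?thesis unfolding has_derivative_at by blast
qed

text \<open>One step of the induction on the order of the derivative. The hypotheses give a majorant
  for each coordinate direction; the sum of these over the basis dominates the total derivative, as
  \<open>has_derivative_integral\<close> asks.\<close>

lemma has_derivative_integral_partials: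
  fixes g :: "'b \<Rightarrow> 'a::euclidean_space \<Rightarrow> complex" and F :: "'b \<Rightarrow> complex"
  assumes g: "\<And>w. w \<in> space M \<Longrightarrow> g w \<in> schwartz" and F: "F \<in> borel_measurable M"
    and meas: "\<And>cs t. set cs \<subseteq> Basis \<Longrightarrow> (\<lambda>w. partials cs (g w) t) \<in> borel_measurable M"
    and bound: "\<And>cs. set cs \<subseteq> Basis \<Longrightarrow> \<exists>G. integrable M G \<and> (\<forall>w\<in>space M. \<forall>t. norm (F w * partials cs (g w) t) \<le> G w)"
    and bs: "set bs \<subseteq> Basis"
  shows "((\<lambda>t. LINT w|M. F w * partials bs (g w) t) has_derivative
      (\<lambda>h. LINT w|M. F w * (\<Sum>b\<in>Basis. (h \<bullet> b) *\<^sub>R partials (b # bs) (g w) t))) (at t)"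
proof -
  have "\<exists>G. integrable M G \<and> (\<forall>w\<in>space M. \<forall>t. norm (F w * partials (b # bs) (g w) t) \<le> G w)" if "b \<in> Basis" for b
    using bs that by (intro bound) auto
  then obtain G where G: "\<And>b. b \<in> Basis \<Longrightarrow> integrable M (G b)"
     "\<And>b w t. b \<in> Basis \<Longrightarrow> w \<in> space M \<Longrightarrow> norm (F w * partials (b # bs) (g w) t) \<le> G b w"
    by metis
  obtain H where H: "integrable M H" "\<And>w t. w \<in> space M \<Longrightarrow> norm (F w * partials bs (g w) t) \<le> H w"
    using bound[OF bs] by blast
  show ?thesis
  proof (rule has_derivative_integral[where G = "\<lambda>w. \<Sum>b\<in>Basis. G b w"])
    fix x w assume w: "w \<in> space M"
    show "((\<lambda>t. F w * partials bs (g w) t) has_derivative (\<lambda>h. F w * (\<Sum>b\<in>Basis. (h \<bullet> b) *\<^sub>R partials (b # bs) (g w) x))) (at x)"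
      using has_derivative_mult_right[OF schwartz_has_derivative[OF schwartz_partials[OF g[OF w] bs]]] by simp
  next
    show "integrable M (\<lambda>w. F w * partials bs (g w) x)" for x
      by (rule Bochner_Integration.integrable_bound[OF H(1)])
        (use F meas[OF bs] in \<open>auto intro!: AE_I2 order_trans[OF H(2)]\<close>)
  next
    show "(\<lambda>w. F w * (\<Sum>b\<in>Basis. (h \<bullet> b) *\<^sub>R partials (b # bs) (g w) x)) \<in> borel_measurable M" for x h
      using bs by (intro borel_measurable_times F borel_measurable_sum borel_measurable_scaleR meas) auto
  next
    fix x w and h :: 'a assume w: "w \<in> space M"
    have "norm (F w * (\<Sum>b\<in>Basis. (h \<bullet> b) *\<^sub>R partials (b # bs) (g w) x))
       = norm (\<Sum>b\<in>Basis. (h \<bullet> b) *\<^sub>R (F w * partials (b # bs) (g w) x))"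
      by (simp add: sum_distrib_left del: partials.simps)
    also have "\<dots> \<le> (\<Sum>b\<in>Basis. norm h * G b w)"
      by (intro sum_norm_le) (auto simp del: partials.simps intro!: mult_mono Basis_le_norm G(2) w)
    finally show "norm (F w * (\<Sum>b\<in>Basis. (h \<bullet> b) *\<^sub>R partials (b # bs) (g w) x)) \<le> (\<Sum>b\<in>Basis. G b w) * norm h"
      by (simp add: sum_distrib_left[symmetric] mult.commute)
  qed (use G in auto)
qed

lemma partials_integral:
  fixes g :: "'b \<Rightarrow> 'a::euclidean_space \<Rightarrow> complex" and F :: "'b \<Rightarrow> complex"
  assumes "\<And>w. w \<in> space M \<Longrightarrow> g w \<in> schwartz" "F \<in> borel_measurable M"
    and "\<And>cs t. set cs \<subseteq> Basis \<Longrightarrow> (\<lambda>w. partials cs (g w) t) \<in> borel_measurable M"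
    and "\<And>cs. set cs \<subseteq> Basis \<Longrightarrow> \<exists>G. integrable M G \<and> (\<forall>w\<in>space M. \<forall>t. norm (F w * partials cs (g w) t) \<le> G w)"
    and "set bs \<subseteq> Basis"
  shows "partials bs (\<lambda>t. LINT w|M. F w * g w t) = (\<lambda>t. LINT w|M. F w * partials bs (g w) t)"
  using assms(5)
proof (induction bs)
  case (Cons b bs)
  then have "partials (b # bs) (\<lambda>t. LINT w|M. F w * g w t) = pd b (\<lambda>t. LINT w|M. F w * partials bs (g w) t)"
    by simp
  also have "\<dots> = (\<lambda>t. LINT w|M. F w * partials (b # bs) (g w) t)"
    by (subst pd_eqI, rule has_derivative_integral_partials[OF assms(1-4)])
      (use Cons.prems in \<open>simp_all add: inner_Basis if_distrib[of "\<lambda>c. c *\<^sub>R _"] cong: if_cong\<close>)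
  finally show ?case .
qed simp

text \<open>Integration by parts: integrate \<open>h (t + b) - h t\<close>, written as the integral of the derivative
  along the segment, over all \<open>t\<close>.\<close>

lemma integral_derivative_eq_0:
  fixes h :: "'a::euclidean_space \<Rightarrow> complex"
  assumes D: "\<And>x. (h has_derivative h' x) (at x)" and h: "integrable lborel h"
    and h': "integrable lborel (\<lambda>x. h' x b)" "continuous_on UNIV (\<lambda>x. h' x b)"
  shows "(LINT x|lborel. h' x b) = 0"
proof -
  let ?d = "\<lambda>x. h' x b" and ?I = "\<lambda>r::real. indicat_real {0..1} r"
  let ?f = "\<lambda>(r::real, t). ?I r *\<^sub>R ?d (t + r *\<^sub>R b)"
  have m[measurable]: "?d \<in> borel_measurable borel" using h'(1) by auto
  have fm[measurable]: "?f \<in> borel_measurable (lborel \<Otimes>\<^sub>M lborel)" by measurable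
  have tr: "(LINT t|lborel. norm (?d (t + r *\<^sub>R b))) = (LINT t|lborel. norm (?d t))" 
     "(LINT t|lborel. ?d (t + r *\<^sub>R b)) = (LINT t|lborel. ?d t)" for r
    using integral_translate[of "\<lambda>t. norm (?d t)" "r *\<^sub>R b"] integral_translate[of ?d "r *\<^sub>R b"] by auto
  have i: "integrable (lborel \<Otimes>\<^sub>M lborel) ?f"
  proof (rule lborel_pair.Fubini_integrable)
    show "integrable lborel (\<lambda>r. LINT t|lborel. norm (?f (r, t)))"
      by (simp add: tr)
    show "AE r in lborel. integrable lborel (\<lambda>t. ?f (r, t))"
      by (auto intro!: integrable_translate[OF h'(1)])
  qed (rule fm)
  have FTC: "(LINT r|lborel. ?f (r, t)) = h (t + b) - h t" for t
  proof -
    have "(LINT r|lborel. ?I r *\<^sub>R ?d (t + r *\<^sub>R b)) = h (t + 1 *\<^sub>R b) - h (t + 0 *\<^sub>R b)"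
    proof (rule integral_FTC_Icc)
      fix r :: real
      have "((\<lambda>r. h (t + r *\<^sub>R b)) has_derivative (\<lambda>s. h' (t + r *\<^sub>R b) (s *\<^sub>R b))) (at r within {0..1})"
        by (rule has_derivative_compose[OF _ D]) (auto intro!: derivative_eq_intros)
      moreover have "h' (t + r *\<^sub>R b) (s *\<^sub>R b) = s *\<^sub>R ?d (t + r *\<^sub>R b)" for s
        using linear_scale[OF has_derivative_linear[OF D]] .
      ultimately show "((\<lambda>r. h (t + r *\<^sub>R b)) has_vector_derivative ?d (t + r *\<^sub>R b)) (at r within {0..1})"
        by (simp add: has_vector_derivative_def)
    next
      show "continuous_on {0..1} (\<lambda>r. ?d (t + r *\<^sub>R b))"
        by (rule continuous_on_compose2[OF h'(2)]) (auto intro!: continuous_intros)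
    qed simp
    then show ?thesis by simp
  qed
  have "integrable lborel ?I" by (rule integrable_real_indicator) auto
  then have "(LINT t|lborel. ?d t) = (LINT r|lborel. ?I r *\<^sub>R (LINT t|lborel. ?d t))"
    by (simp add: content_real)
  also have "\<dots> = (LINT r|lborel. LINT t|lborel. ?f (r, t))"
    by (simp add: tr)
  also have "\<dots> = (LINT t|lborel. LINT r|lborel. ?f (r, t))"
    using lborel_pair.Fubini_integral[of "\<lambda>r t. ?f (r, t)"] i by (simp add: case_prod_beta)
  also have "\<dots> = (LINT t|lborel. h (t + b) - h t)"
    by (simp only: FTC)
  also have "\<dots> = 0"
    using h integrable_translate[OF h, of b] integral_translate[of h b] by simp
  finally show ?thesis by simp
qed

section \<open>Fourier inversion\<close>

lemma lborel_pair_integrableI: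
  fixes f :: "'a::euclidean_space \<Rightarrow> 'b::euclidean_space \<Rightarrow> complex"
  assumes "(\<lambda>(x, y). f x y) \<in> borel_measurable borel"
    and "\<And>x. integrable lborel (f x)"
    and "integrable lborel (\<lambda>x. LINT y|lborel. norm (f x y))"
  shows "integrable lborel (\<lambda>(x, y). f x y)"
proof -
  have "integrable (lborel \<Otimes>\<^sub>M lborel) (\<lambda>(x, y). f x y)"
    by (rule lborel_pair.Fubini_integrable) (use assms in \<open>auto simp: lborel_prod\<close>)
  then show ?thesis by (simp add: lborel_prod)
qed

lemma lborel_pair_swap:
  fixes f :: "'a::euclidean_space \<Rightarrow> 'b::euclidean_space \<Rightarrow> complex"
  assumes "integrable lborel (\<lambda>(x, y). f x y)"
  shows "(LINT x|lborel. LINT y|lborel. f x y) = (LINT y|lborel. LINT x|lborel. f x y)"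
  using lborel_pair.Fubini_integral[of f] assms by (simp add: lborel_prod)

lemma lborel_pair_integral:
  fixes f :: "'a::euclidean_space \<times> 'b::euclidean_space \<Rightarrow> complex"
  assumes "integrable lborel f"
  shows "(LINT x|lborel. LINT y|lborel. f (x, y)) = (LINT z|lborel. f z)"
  using lborel_pair.integral_fst'[of f] assms by (simp add: lborel_prod)

lemma lborel_pair_integrable_mult:
  fixes f :: "'a::euclidean_space \<Rightarrow> complex" and g :: "'b::euclidean_space \<Rightarrow> complex"
  assumes "integrable lborel f" "integrable lborel g"
  shows "integrable lborel (\<lambda>(x, y). f x * g y)"
proof (rule lborel_pair_integrableI)
  have [measurable]: "f \<in> borel_measurable borel" "g \<in> borel_measurable borel" using assms by auto
  show "(\<lambda>(x, y). f x * g y) \<in> borel_measurable borel" 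
    unfolding borel_prod[symmetric] by measurable
qed (use assms in \<open>simp_all add: norm_mult\<close>)

lemma integral_scale:
  fixes f :: "'a::euclidean_space \<Rightarrow> complex"
  assumes "f \<in> borel_measurable borel" "c \<noteq> 0"
  shows "(LINT x|lborel. f x) = of_real (\<bar>c\<bar> ^ DIM('a)) * (LINT x|lborel. f (t + c *\<^sub>R x))"
proof -
  have "(LINT x|lborel. f x) = (LINT x|density (distr lborel borel (\<lambda>x. t + c *\<^sub>R x)) (\<lambda>_. \<bar>c\<bar>^DIM('a)). f x)"
    using lborel_affine[OF assms(2), of t] by simp
  also have "\<dots> = (LINT x|distr lborel borel (\<lambda>x. t + c *\<^sub>R x). (\<bar>c\<bar>^DIM('a)) *\<^sub>R f x)"
    using assms by (intro integral_density) auto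
  also have "\<dots> = (LINT x|lborel. (\<bar>c\<bar>^DIM('a)) *\<^sub>R f (t + c *\<^sub>R x))"
    using assms by (intro integral_distr) auto
  finally show ?thesis by (simp add: scaleR_conv_of_real)
qed

lemma lborel_integral_prod:
  fixes f :: "'a::euclidean_space \<Rightarrow> real \<Rightarrow> complex"
  assumes "\<And>b. b \<in> Basis \<Longrightarrow> integrable lborel (f b)"
  shows "(LINT x|lborel. (\<Prod>b\<in>Basis. f b (x \<bullet> b))) = (\<Prod>b\<in>Basis. LINT x|lborel. f b x)"
proof -
  interpret product_sigma_finite "\<lambda>_. lborel :: real measure" by standard
  have m: "(\<lambda>x::'a. \<Prod>b\<in>Basis. f b (x \<bullet> b)) \<in> borel_measurable borel"
  proof (rule borel_measurable_prod)
    fix b :: 'a assume "b \<in> Basis"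
    then have [measurable]: "f b \<in> borel_measurable borel" using assms by auto
    show "(\<lambda>x::'a. f b (x \<bullet> b)) \<in> borel_measurable borel" by measurable
  qed
  have "(LINT x|lborel. (\<Prod>b\<in>Basis. f b (x \<bullet> b))) =
     (LINT y|(\<Pi>\<^sub>M b\<in>(Basis::'a set). lborel). (\<Prod>b\<in>Basis. f b ((\<Sum>c\<in>Basis. y c *\<^sub>R c) \<bullet> b)))"
    unfolding lborel_eq[where 'a = 'a] by (rule integral_distr) (use m in auto)
  also have "\<dots> = (LINT y|(\<Pi>\<^sub>M b\<in>(Basis::'a set). lborel). (\<Prod>b\<in>Basis. f b (y b)))"
    by simp
  also have "\<dots> = (\<Prod>b\<in>Basis. LINT x|lborel. f b x)"
    using assms by (intro product_integral_prod) auto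
  finally show ?thesis .
qed

section \<open>The Gaussian and its Fourier transform\<close>

definition gauss :: "'a::euclidean_space \<Rightarrow> real" where
  "gauss x = exp (- (norm x)\<^sup>2 / 2)"

lemma gauss_measurable [measurable]: "gauss \<in> borel_measurable borel"
  unfolding gauss_def[abs_def] by measurable

lemma isCont_gauss: "isCont gauss x"
  unfolding gauss_def[abs_def] by (auto intro!: continuous_intros)

lemma gauss_bounds: "0 < gauss x" "gauss x \<le> 1" "gauss 0 = 1" "gauss (- x) = gauss x"
  by (auto simp: gauss_def)

lemma prod_exp_gauss: "(\<Prod>b\<in>Basis. exp (- (x \<bullet> b)\<^sup>2 / 2)) = gauss x"
proof -
  have "(norm x)\<^sup>2 = (\<Sum>b\<in>Basis. (x \<bullet> b)\<^sup>2)"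
    unfolding power2_norm_eq_inner by (subst euclidean_inner) (simp add: power2_eq_square)
  then show ?thesis by (simp add: gauss_def exp_sum[symmetric] sum_negf flip: sum_divide_distrib)
qed

text \<open>This is the characteristic function of the standard normal distribution; the transform
  of \<open>gauss\<close> is a product of such integrals over the coordinates.\<close>

lemma integral_normal_cis:
  "(LINT x|lborel. of_real (std_normal_density x) * cis (x * t)) = of_real (exp (- t\<^sup>2 / 2))"
proof -
  have "(LINT x|lborel. of_real (std_normal_density x) * cis (x * t)) = char std_normal_distribution t"
    unfolding char_def
    by (subst integral_density) (auto simp: cis_conv_exp scaleR_conv_of_real mult.commute)
  also have "\<dots> = of_real (exp (- t\<^sup>2 / 2))"
    using char_std_normal_distribution by simp
  finally show ?thesis .
qed

lemma integrable_normal_cis: "integrable lborel (\<lambda>x. of_real (std_normal_density x) * cis (x * t))"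
proof (rule Bochner_Integration.integrable_bound[of lborel std_normal_density])
  show "(\<lambda>x. complex_of_real (std_normal_density x) * cis (x * t)) \<in> borel_measurable lborel"
    unfolding cis_conv_exp by measurable
qed (auto simp: norm_mult)

lemma gauss_eq_prod_density:
  "of_real (gauss x) = of_real (sqrt (2 * pi) ^ DIM('a)) * (\<Prod>b\<in>Basis. complex_of_real (std_normal_density ((x::'a::euclidean_space) \<bullet> b)))"
proof -
  have "gauss x = (\<Prod>b\<in>Basis. sqrt (2 * pi) * std_normal_density (x \<bullet> b))"
    by (simp add: std_normal_density_def flip: prod_exp_gauss)
  then show ?thesis by (simp add: prod.distrib flip: of_real_prod)
qed

lemma integrable_gauss: "integrable lborel (gauss :: 'a::euclidean_space \<Rightarrow> real)"
  and integral_gauss_cis: "(LINT x|lborel. of_real (gauss x) * cis (x \<bullet> s)) =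
      of_real (sqrt (2 * pi) ^ DIM('a) * gauss (s::'a))"
proof -
  have cis_prod: "cis (x \<bullet> s) = (\<Prod>b\<in>Basis. cis ((x \<bullet> b) * (s \<bullet> b)))" for x s :: 'a
    by (subst euclidean_inner) (simp add: cis_conv_exp exp_sum sum_distrib_left)
  have e: "of_real (gauss x) * cis (x \<bullet> s) = of_real (sqrt (2 * pi) ^ DIM('a)) *
    (\<Prod>b\<in>Basis. complex_of_real (std_normal_density (x \<bullet> b)) * cis ((x \<bullet> b) * (s \<bullet> b)))" for x s :: 'a
    unfolding gauss_eq_prod_density cis_prod prod.distrib by (simp add: mult_ac)
  show *: "(LINT x|lborel. of_real (gauss x) * cis (x \<bullet> s)) = of_real (sqrt (2 * pi) ^ DIM('a) * gauss (s::'a))" for s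
    unfolding e
    by (subst integral_mult_right_zero, subst lborel_integral_prod)
      (simp_all add: integrable_normal_cis integral_normal_cis flip: prod_exp_gauss)
  \<comment> \<open>Integrability is read off from the value: a non-integrable function would have
    integral 0, whereas the formula at s = 0 gives a positive power of
    \<open>sqrt (2 * pi)\<close>.\<close>
  have "integrable lborel (\<lambda>x::'a. complex_of_real (gauss x) * cis (x \<bullet> 0))"
    by (rule ccontr, drule not_integrable_integral_eq)
      (use *[of 0] in \<open>simp add: gauss_bounds\<close>)
  then have "integrable lborel (\<lambda>x::'a. complex_of_real (gauss x))" by simp
  then show "integrable lborel (gauss :: 'a \<Rightarrow> real)"
    by (simp add: complex_of_real_integrable_eq)
qed

text \<open>The kernels form an approximate identity at t: Gaussians of total mass 1 and width 1 /
  Suc n. They are the Fourier transforms of the regularising factors in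
  \<open>fourier_inversion\<close>.\<close>

lemma fourier_inversion_approx:
  fixes h :: "'a::euclidean_space \<Rightarrow> complex"
  assumes h: "integrable lborel h" "continuous_on UNIV h"
  shows "(\<lambda>n. LINT s|lborel. h s * of_real ((real (Suc n) / sqrt (2 * pi)) ^ DIM('a) * gauss (real (Suc n) *\<^sub>R (t - s)))) \<longlonglongrightarrow> h t"
proof -
  let ?K = "\<lambda>n s. (real (Suc n) / sqrt (2 * pi)) ^ DIM('a) * gauss (real (Suc n) *\<^sub>R (t - s))"
  \<comment> \<open>An integrable continuous h may be unbounded, so it is cut at the unit ball
    around t. The inner part is bounded and can be rescaled; on the outer part the kernel itself
    tends to 0 uniformly.\<close>
  let ?h1 = "\<lambda>s. indicat_real (cball t 1) s *\<^sub>R h s" and ?h2 = "\<lambda>s. indicat_real (- cball t 1) s *\<^sub>R h s"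
  have hm[measurable]: "h \<in> borel_measurable borel" using h by auto
  have Km[measurable]: "?K n \<in> borel_measurable borel" for n by measurable
  obtain B where B: "\<And>s. s \<in> cball t 1 \<Longrightarrow> norm (h s) \<le> B"
    using compact_imp_bounded[OF compact_continuous_image[OF continuous_on_subset[OF h(2)] compact_cball]]
    unfolding bounded_iff by (metis imageI subset_UNIV)
  have h1B: "norm (?h1 s) \<le> \<bar>B\<bar>" for s
    using B[of s] by (auto simp: indicator_def intro: order_trans)
  have hI: "integrable lborel ?h1" "integrable lborel ?h2"
    by (rule Bochner_Integration.integrable_bound[OF h(1)]; auto simp: indicator_def)+
  have KB: "\<bar>?K n s\<bar> \<le> (real (Suc n) / sqrt (2 * pi)) ^ DIM('a)" for n s
    using gauss_bounds(1,2)[of "real (Suc n) *\<^sub>R (t - s)"] by (simp add: abs_mult mult_left_le)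
  have IK: "integrable lborel (\<lambda>s. g s * of_real (?K n s))" if "integrable lborel g" for g :: "'a \<Rightarrow> complex" and n
  proof (rule Bochner_Integration.integrable_bound)
    show "integrable lborel (\<lambda>s. (real (Suc n) / sqrt (2 * pi)) ^ DIM('a) * norm (g s))"
      using that by simp
    show "AE s in lborel. norm (g s * complex_of_real (?K n s)) \<le> norm ((real (Suc n) / sqrt (2 * pi)) ^ DIM('a) * norm (g s))"
      using mult_right_mono[OF KB norm_ge_zero]
      by (intro AE_I2) (simp only: norm_mult norm_of_real mult.commute abs_of_nonneg real_norm_def, 
         simp add: mult.commute abs_mult)
  qed (use that in measurable)
  have "(\<lambda>n. LINT s|lborel. ?h2 s * of_real (?K n s)) \<longlonglongrightarrow> (LINT s|(lborel :: 'a measure). 0 :: complex)"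
  proof -
    have lim: "(\<lambda>n. real (Suc n) ^ DIM('a) / exp (real (Suc n)) * exp 1) \<longlonglongrightarrow> 0"
    proof -
      have "(\<lambda>n. real (Suc n) ^ DIM('a) / exp (real (Suc n))) \<longlonglongrightarrow> 0"
        by (rule filterlim_compose[OF tendsto_power_div_exp_0])
          (rule filterlim_compose[OF filterlim_real_sequentially filterlim_Suc])
      from tendsto_mult_left_zero[OF this] show ?thesis .
    qed
    \<comment> \<open>With m = Suc n, the Gaussian is at most the exponential of minus half the
      square of m outside the ball. As 2 * m is at most that square plus 1, this is at most exp (1 -
      m), which beats the power of m in front.\<close>
    have K2: "\<bar>?K n s\<bar> \<le> real (Suc n) ^ DIM('a) / exp (real (Suc n)) * exp 1" if s: "s \<in> - cball t 1" for n s
    proof -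
      let ?m = "real (Suc n)"
      have "1 \<le> norm (t - s)" using s by (auto simp: dist_norm)
      then have n: "?m \<le> norm (?m *\<^sub>R (t - s))" by (simp add: mult_le_cancel_left1)
      have "?m\<^sup>2 \<le> (norm (?m *\<^sub>R (t - s)))\<^sup>2" using n by (intro power_mono) auto
      moreover have "2 * ?m \<le> ?m\<^sup>2 + 1" using sum_squares_bound[of ?m 1] by simp
      moreover have "- N / 2 \<le> 1 - m" if "M \<le> N" "2 * m \<le> M + 1" for m M N :: real using that by simp
      ultimately have "- (norm (?m *\<^sub>R (t - s)))\<^sup>2 / 2 \<le> 1 - ?m" by blast
      then have "gauss (?m *\<^sub>R (t - s)) \<le> exp (1 - ?m)" unfolding gauss_def by simp
      moreover have "1 \<le> sqrt (2 * pi)" using pi_ge_two by (simp add: real_le_rsqrt)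
      then have "(?m / sqrt (2 * pi)) ^ DIM('a) \<le> ?m ^ DIM('a)"
        by (intro power_mono) (auto simp: divide_le_eq mult_le_cancel_left1)
      ultimately have "?K n s \<le> ?m ^ DIM('a) * exp (1 - ?m)"
        by (intro mult_mono) (auto simp: gauss_bounds less_imp_le)
      then show ?thesis by (simp add: exp_diff gauss_bounds less_imp_le abs_mult del: of_nat_Suc)
    qed
    have bd: "\<exists>C. \<forall>n. real (Suc n) ^ DIM('a) / exp (real (Suc n)) * exp 1 \<le> C"
      using convergent_imp_Bseq[OF convergentI[OF lim]] unfolding Bseq_def by (metis abs_ge_self order_trans real_norm_def)
    then obtain C where C: "\<And>n. real (Suc n) ^ DIM('a) / exp (real (Suc n)) * exp 1 \<le> C" by blast
    show ?thesis
    proof (rule integral_dominated_convergence[where w = "\<lambda>s. C * norm (?h2 s)"])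
      show "AE s in lborel. (\<lambda>n. ?h2 s * of_real (?K n s)) \<longlonglongrightarrow> 0"
      proof (rule AE_I2)
        fix s show "(\<lambda>n. ?h2 s * of_real (?K n s)) \<longlonglongrightarrow> 0"
        proof (cases "s \<in> cball t 1")
          case False
          then have "(\<lambda>n. ?K n s) \<longlonglongrightarrow> 0"
            by (intro Lim_null_comparison[OF _ lim] always_eventually allI) (use K2 in auto)
          from tendsto_of_real[OF this] have "(\<lambda>n. complex_of_real (?K n s)) \<longlonglongrightarrow> 0"
            by (simp only: of_real_0)
          then show ?thesis by (rule tendsto_mult_right_zero)
        qed (simp add: indicator_def)
      qed
      show "AE s in lborel. norm (?h2 s * of_real (?K n s)) \<le> C * norm (?h2 s)" for n
      proof (rule AE_I2)
        fix s show "norm (?h2 s * of_real (?K n s)) \<le> C * norm (?h2 s)"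
        proof (cases "s \<in> cball t 1")
          case False
          then have "\<bar>?K n s\<bar> \<le> C" using K2[of s n] C[of n] by simp
          from mult_left_mono[OF this norm_ge_zero[of "?h2 s"]] show ?thesis
            by (simp only: norm_mult norm_of_real mult.commute)
        qed (simp add: indicator_def)
      qed
    qed (use hI integrable_norm[OF hI(2)] in \<open>auto simp del: norm_scaleR\<close>)
  qed
  moreover have "(\<lambda>n. LINT s|lborel. ?h1 s * of_real (?K n s)) \<longlonglongrightarrow> h t"
  proof -
    let ?c = "1 / sqrt (2 * pi) ^ DIM('a)"
    \<comment> \<open>Substitution s = t - x / Suc n: the kernel becomes a fixed Gaussian, and the
      dependence on n moves into the argument of h.\<close>
    have eq: "(LINT s|lborel. ?h1 s * of_real (?K n s)) =
        (LINT x|lborel. ?h1 (t + (-1 / real (Suc n)) *\<^sub>R x) * of_real (?c * gauss x))" for n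
    proof -
      let ?m = "real (Suc n)"
      have "(LINT s|lborel. ?h1 s * of_real (?K n s)) = of_real (\<bar>-1 / ?m\<bar> ^ DIM('a)) *
         (LINT x|lborel. ?h1 (t + (-1 / ?m) *\<^sub>R x) * of_real (?K n (t + (-1 / ?m) *\<^sub>R x)))"
        by (rule integral_scale, measurable) auto
      also have "\<dots> = (LINT x|lborel. of_real (\<bar>-1 / ?m\<bar> ^ DIM('a)) *
         (?h1 (t + (-1 / ?m) *\<^sub>R x) * of_real (?K n (t + (-1 / ?m) *\<^sub>R x))))"
        by (rule integral_mult_right_zero[symmetric])
      also have "\<dots> = (LINT x|lborel. ?h1 (t + (-1 / ?m) *\<^sub>R x) * of_real (?c * gauss x))"
      proof (intro Bochner_Integration.integral_cong refl)
        fix x :: 'a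
        have *: "\<bar>-1 / ?m\<bar> ^ DIM('a) * ?K n (t + (-1 / ?m) *\<^sub>R x) = ?c * gauss x"
          by (simp add: power_divide del: of_nat_Suc)
        have aux: "a * (H * K) = H * c" if "a * K = c" for a H K c :: complex using that by auto
        from * have "complex_of_real (\<bar>-1 / ?m\<bar> ^ DIM('a)) * of_real (?K n (t + (-1 / ?m) *\<^sub>R x)) = of_real (?c * gauss x)"
          by (simp only: of_real_mult[symmetric])
        then show "of_real (\<bar>-1 / ?m\<bar> ^ DIM('a)) * (?h1 (t + (-1 / ?m) *\<^sub>R x) * of_real (?K n (t + (-1 / ?m) *\<^sub>R x))) =
           ?h1 (t + (-1 / ?m) *\<^sub>R x) * of_real (?c * gauss x)"
          by (rule aux)
      qed
      finally show ?thesis .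
    qed
    have "(\<lambda>n. LINT x|lborel. ?h1 (t + (-1 / real (Suc n)) *\<^sub>R x) * of_real (?c * gauss x)) \<longlonglongrightarrow>
       (LINT x|(lborel :: 'a measure). h t * of_real (?c * gauss x))"
    proof (rule integral_dominated_convergence[where w = "\<lambda>x. \<bar>B\<bar> * (?c * gauss x)"])
      show "AE x in lborel. (\<lambda>n. ?h1 (t + (-1 / real (Suc n)) *\<^sub>R x) * of_real (?c * gauss x)) \<longlonglongrightarrow> h t * of_real (?c * gauss x)"
      proof (rule AE_I2, rule tendsto_mult[OF _ tendsto_const])
        fix x :: 'a
        have "(\<lambda>n. t + (-1 * inverse (real (Suc n))) *\<^sub>R x) \<longlonglongrightarrow> t + (-1 * 0) *\<^sub>R x"
          by (intro tendsto_intros LIMSEQ_inverse_real_of_nat)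
        then have l: "(\<lambda>n. t + (-1 / real (Suc n)) *\<^sub>R x) \<longlonglongrightarrow> t"
          by (simp add: divide_inverse)
        have "\<forall>\<^sub>F s in nhds t. ?h1 s = h s"
          using eventually_nhds_in_open[OF open_ball, of t t 1] 
          by (rule eventually_mono) (auto simp: indicator_def)
        moreover have "(h \<longlongrightarrow> h t) (nhds t)"
          using h(2) unfolding continuous_on_eq_continuous_at[OF open_UNIV] 
          by (auto simp: continuous_at_imp_continuous_at_within tendsto_nhds_iff isCont_def)
        ultimately have "(?h1 \<longlongrightarrow> h t) (nhds t)" using tendsto_cong by fastforce
        from filterlim_compose[OF this l] show "(\<lambda>n. ?h1 (t + (-1 / real (Suc n)) *\<^sub>R x)) \<longlonglongrightarrow> h t" .
      qed
      show "AE x in lborel. norm (?h1 (t + (-1 / real (Suc n)) *\<^sub>R x) * of_real (?c * gauss x)) \<le> \<bar>B\<bar> * (?c * gauss x)" for n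
      proof (rule AE_I2)
        fix x :: 'a
        have "0 \<le> ?c * gauss x" by (simp add: gauss_bounds less_imp_le)
        then show "norm (?h1 (t + (-1 / real (Suc n)) *\<^sub>R x) * of_real (?c * gauss x)) \<le> \<bar>B\<bar> * (?c * gauss x)"
          unfolding norm_mult norm_of_real using h1B by (intro mult_mono) auto
      qed
      show "integrable lborel (\<lambda>x::'a. \<bar>B\<bar> * (?c * gauss x))"
        by (intro integrable_mult_right integrable_gauss)
      have h1m: "?h1 \<in> borel_measurable borel" using borel_measurable_integrable[OF hI(1)] by simp
      have gm: "(\<lambda>x::'a. complex_of_real (?c * gauss x)) \<in> borel_measurable borel" by measurable
      show "(\<lambda>x. ?h1 (t + (-1 / real (Suc n)) *\<^sub>R x) * of_real (?c * gauss x)) \<in> borel_measurable lborel" for n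
        unfolding measurable_lborel1 by (intro borel_measurable_times measurable_compose[OF _ h1m] gm) measurable
      show "(\<lambda>x::'a. h t * of_real (?c * gauss x)) \<in> borel_measurable lborel"
        unfolding measurable_lborel1 by (intro borel_measurable_times gm) measurable
    qed
    also have "(LINT x|(lborel :: 'a measure). h t * of_real (?c * gauss x)) = h t"
    proof -
      have "(LINT x|lborel. complex_of_real (gauss (x::'a))) = of_real (sqrt (2 * pi) ^ DIM('a))"
        using integral_gauss_cis[of "0::'a"] by (simp add: gauss_bounds)
      then show ?thesis by simp
    qed
    finally show ?thesis unfolding eq .
  qed
  ultimately have "(\<lambda>n. (LINT s|lborel. ?h1 s * of_real (?K n s)) + (LINT s|lborel. ?h2 s * of_real (?K n s))) \<longlonglongrightarrow> h t + 0"
    by (intro tendsto_add) simp_all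
  moreover have "(LINT s|lborel. ?h1 s * of_real (?K n s)) + (LINT s|lborel. ?h2 s * of_real (?K n s)) = (LINT s|lborel. h s * of_real (?K n s))" for n
    by (subst Bochner_Integration.integral_add[symmetric, OF IK[OF hI(1)] IK[OF hI(2)]])
      (auto intro!: Bochner_Integration.integral_cong simp: indicator_def)
  ultimately show ?thesis by simp
qed

text \<open>A Gaussian factor is inserted into the inversion integral. Fubini turns the regularised
  integral into the smoothing of h in \<open>fourier_inversion_approx\<close>, and dominated
  convergence, with the integrable transform of h as majorant, removes the factor.\<close>

theorem fourier_inversion:
  fixes h :: "'a::euclidean_space \<Rightarrow> complex"
  assumes h: "integrable lborel h" "continuous_on UNIV h"
    and H: "integrable lborel (\<lambda>w. LINT s|lborel. h s * cis (- (2 * pi * (s \<bullet> w))))"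
  shows "h t = (LINT w|lborel. (LINT s|lborel. h s * cis (- (2 * pi * (s \<bullet> w)))) * cis (2 * pi * (t \<bullet> w)))"
proof -
  let ?H = "\<lambda>w. LINT s|lborel. h s * cis (- (2 * pi * (s \<bullet> w)))"
  have [measurable]: "h \<in> borel_measurable borel" using h by auto
  have [measurable]: "?H \<in> borel_measurable borel" using H by auto
  have [measurable]: "cis \<in> borel_measurable borel"
    by (intro borel_measurable_continuous_onI continuous_intros)
  \<comment> \<open>The scale 2 * pi / Suc n compensates the 2 * pi in the exponent, so that the
    transform of \<open>g n\<close> is exactly the kernel of
    \<open>fourier_inversion_approx\<close>.\<close>
  define g where "g n w = gauss ((2 * pi / real (Suc n)) *\<^sub>R w)" for n and w :: 'a
  have gm[measurable]: "g n \<in> borel_measurable borel" for n unfolding g_def by measurable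
  have g1: "\<bar>g n w\<bar> \<le> 1" for n w unfolding g_def using gauss_bounds(1,2) by (metis abs_of_pos)
  have gI: "integrable lborel (g n)" for n
  proof -
    have "integrable lborel (\<lambda>x::'a. complex_of_real (gauss (0 + (2 * pi / real (Suc n)) *\<^sub>R x)))"
    proof (rule ccontr, drule not_integrable_integral_eq)
      assume "(LINT x|lborel. complex_of_real (gauss (0 + (2 * pi / real (Suc n)) *\<^sub>R (x::'a)))) = 0"
      with integral_scale[of "\<lambda>x::'a. complex_of_real (gauss x)" "2 * pi / real (Suc n)" 0]
      have "(LINT x|lborel. complex_of_real (gauss (x::'a))) = 0" by simp
      with integral_gauss_cis[of "0::'a"] show False by (simp add: gauss_bounds)
    qed
    then show ?thesis unfolding g_def by (simp add: complex_of_real_integrable_eq)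
  qed
  have gF: "(LINT w|lborel. of_real (g n w) * cis (2 * pi * (w \<bullet> u))) =
     of_real ((real (Suc n) / sqrt (2 * pi)) ^ DIM('a) * gauss (real (Suc n) *\<^sub>R u))" for n and u :: 'a
  proof -
    let ?c = "2 * pi / real (Suc n)"
    have "of_real (sqrt (2 * pi) ^ DIM('a) * gauss (real (Suc n) *\<^sub>R u)) =
        (LINT x|lborel. of_real (gauss x) * cis (x \<bullet> (real (Suc n) *\<^sub>R u)))"
      by (rule integral_gauss_cis[symmetric])
    also have "\<dots> = of_real (\<bar>?c\<bar> ^ DIM('a)) * (LINT x|lborel. of_real (gauss (0 + ?c *\<^sub>R x)) * cis ((0 + ?c *\<^sub>R x) \<bullet> (real (Suc n) *\<^sub>R u)))"
      by (rule integral_scale) auto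
    also have "(LINT x|lborel. of_real (gauss (0 + ?c *\<^sub>R x)) * cis ((0 + ?c *\<^sub>R x) \<bullet> (real (Suc n) *\<^sub>R u)))
      = (LINT w|lborel. of_real (g n w) * cis (2 * pi * (w \<bullet> u)))"
    proof -
      have "(0 + ?c *\<^sub>R x) \<bullet> (real (Suc n) *\<^sub>R u) = 2 * pi * (x \<bullet> u)" for x
        by (simp del: of_nat_Suc)
      then show ?thesis unfolding g_def by (simp only: add_0)
    qed
    finally have "(LINT w|lborel. of_real (g n w) * cis (2 * pi * (w \<bullet> u))) =
      of_real (sqrt (2 * pi) ^ DIM('a) * gauss (real (Suc n) *\<^sub>R u)) / of_real (\<bar>?c\<bar> ^ DIM('a))"
      by (simp del: of_nat_Suc)
    also have "\<dots> = of_real (sqrt (2 * pi) ^ DIM('a) / ?c ^ DIM('a) * gauss (real (Suc n) *\<^sub>R u))"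
      by (simp add: abs_of_nonneg del: of_nat_Suc)
    also have "sqrt (2 * pi) ^ DIM('a) / ?c ^ DIM('a) = (real (Suc n) / sqrt (2 * pi)) ^ DIM('a)"
    proof -
      have "sqrt (2 * pi) / ?c = real (Suc n) / sqrt (2 * pi)"
        by (simp add: field_simps)
      then show ?thesis by (metis power_divide)
    qed
    finally show ?thesis .
  qed
  have "(\<lambda>n. LINT w|lborel. ?H w * cis (2 * pi * (t \<bullet> w)) * of_real (g n w)) \<longlonglongrightarrow> (LINT w|lborel. ?H w * cis (2 * pi * (t \<bullet> w)))"
  proof (rule integral_dominated_convergence[where w = "\<lambda>w. norm (?H w)"])
    show "AE w in lborel. (\<lambda>n. ?H w * cis (2 * pi * (t \<bullet> w)) * of_real (g n w)) \<longlonglongrightarrow> ?H w * cis (2 * pi * (t \<bullet> w))"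
    proof (rule AE_I2)
      fix w :: 'a
      have "(\<lambda>n. (2 * pi * inverse (real (Suc n))) *\<^sub>R w) \<longlonglongrightarrow> (2 * pi * 0) *\<^sub>R w"
        by (intro tendsto_intros LIMSEQ_inverse_real_of_nat)
      then have "(\<lambda>n. g n w) \<longlonglongrightarrow> gauss ((2 * pi * 0) *\<^sub>R w)"
        unfolding g_def divide_inverse by (rule isCont_tendsto_compose[OF isCont_gauss])
      from tendsto_of_real[OF this] have "(\<lambda>n. complex_of_real (g n w)) \<longlonglongrightarrow> 1"
        by (simp add: gauss_bounds)
      from tendsto_mult_left[OF this, of "?H w * cis (2 * pi * (t \<bullet> w))"]
      show "(\<lambda>n. ?H w * cis (2 * pi * (t \<bullet> w)) * of_real (g n w)) \<longlonglongrightarrow> ?H w * cis (2 * pi * (t \<bullet> w))" by simp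
    qed
    show "AE w in lborel. norm (?H w * cis (2 * pi * (t \<bullet> w)) * of_real (g n w)) \<le> norm (?H w)" for n
      using g1 by (auto simp: norm_mult intro!: AE_I2 mult_left_le)
  qed (use H in auto)
  moreover have "(LINT w|lborel. ?H w * cis (2 * pi * (t \<bullet> w)) * of_real (g n w)) =
     (LINT s|lborel. h s * of_real ((real (Suc n) / sqrt (2 * pi)) ^ DIM('a) * gauss (real (Suc n) *\<^sub>R (t - s))))" for n
  proof -
    let ?f = "\<lambda>w s. h s * (of_real (g n w) * cis (2 * pi * (w \<bullet> (t - s))))"
    have i: "integrable lborel (\<lambda>(w, s). ?f w s)"
    proof (rule Bochner_Integration.integrable_bound[OF lborel_pair_integrable_mult])
      show "integrable lborel (\<lambda>w. complex_of_real (g n w))" using gI by (simp add: complex_of_real_integrable_eq)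
      have "(\<lambda>(w, s). ?f w s) \<in> borel_measurable (borel \<Otimes>\<^sub>M borel)" by measurable
      then show "(\<lambda>(w, s). ?f w s) \<in> borel_measurable lborel" by (simp add: borel_prod)
    qed (use h in \<open>auto simp: norm_mult\<close>)
    have "(LINT w|lborel. ?H w * cis (2 * pi * (t \<bullet> w)) * of_real (g n w)) = (LINT w|lborel. LINT s|lborel. ?f w s)"
    proof (intro Bochner_Integration.integral_cong refl)
      fix w :: 'a
      have "cis (2 * pi * (w \<bullet> (t - s))) = cis (- (2 * pi * (s \<bullet> w))) * cis (2 * pi * (t \<bullet> w))" for s
        by (simp add: cis_mult inner_diff_right inner_commute algebra_simps)
      then have "(LINT s|lborel. ?f w s) = (LINT s|lborel. (h s * cis (- (2 * pi * (s \<bullet> w)))) * (cis (2 * pi * (t \<bullet> w)) * of_real (g n w)))"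
        by (simp add: mult_ac)
      then show "?H w * cis (2 * pi * (t \<bullet> w)) * of_real (g n w) = (LINT s|lborel. ?f w s)"
        by (simp only: integral_mult_left_zero) (simp only: mult.assoc)
    qed
    also have "\<dots> = (LINT s|lborel. LINT w|lborel. ?f w s)"
      by (rule lborel_pair_swap[OF i])
    finally show ?thesis by (simp add: gF)
  qed
  ultimately show ?thesis using LIMSEQ_unique[OF fourier_inversion_approx[OF h, of t]] by simp
qed

section \<open>Schwartz seminorms\<close>

lemma finite_partial_lists: "finite {bs. set bs \<subseteq> (Basis :: 'a::euclidean_space set) \<and> length bs \<le> N}"
  by (rule finite_lists_length_le) simp

text \<open>The suprema in \<open>schwartz_seminorm\<close> are taken in the reals, where they are
  informative only for bounded families; decay supplies the bound.\<close>

lemma schwartz_sup_bdd: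
  assumes "f \<in> schwartz" "set bs \<subseteq> Basis"
  shows "bdd_above (range (\<lambda>x. (1 + norm x) ^ N * norm (partials bs f x)))"
proof -
  obtain K where "\<And>x. (1 + norm x) ^ N * norm (partials bs f x) \<le> K"
    using schwartz_decay[OF schwartz_partials[OF assms]] by blast
  then show ?thesis by (intro bdd_aboveI2)
qed

lemma schwartz_sup_ge:
  assumes "f \<in> schwartz" "set bs \<subseteq> Basis"
  shows "(1 + norm x) ^ N * norm (partials bs f x) \<le> (SUP x. (1 + norm x) ^ N * norm (partials bs f x))"
  by (rule cSUP_upper[OF UNIV_I schwartz_sup_bdd[OF assms]])

lemma schwartz_sup_nonneg:
  assumes "f \<in> schwartz" "set bs \<subseteq> Basis"
  shows "0 \<le> (SUP x. (1 + norm x) ^ N * norm (partials bs f x))"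
  by (rule order_trans[OF _ schwartz_sup_ge[OF assms, of 0]]) simp

lemma schwartz_seminorm_nonneg: "f \<in> schwartz \<Longrightarrow> 0 \<le> schwartz_seminorm N f"
  unfolding schwartz_seminorm_def by (rule sum_nonneg) (auto intro!: schwartz_sup_nonneg)

lemma schwartz_seminorm_ge:
  assumes f: "f \<in> schwartz" and "set bs \<subseteq> Basis" "length bs \<le> N" "n \<le> N"
  shows "(1 + norm x) ^ n * norm (partials bs f x) \<le> schwartz_seminorm N f"
proof -
  have "(1 + norm x) ^ n * norm (partials bs f x) \<le> (1 + norm x) ^ N * norm (partials bs f x)"
    using assms(4) by (intro mult_right_mono power_increasing) auto
  also have "\<dots> \<le> (SUP x. (1 + norm x) ^ N * norm (partials bs f x))"
    by (rule schwartz_sup_ge[OF assms(1,2)])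
  also have "\<dots> \<le> schwartz_seminorm N f"
    unfolding schwartz_seminorm_def
    by (rule member_le_sum[of bs]) (use assms finite_partial_lists in \<open>auto intro!: schwartz_sup_nonneg\<close>)
  finally show ?thesis .
qed

lemma schwartz_seminorm_le:
  fixes f :: "'a::euclidean_space \<Rightarrow> complex"
  assumes "\<And>bs x. set bs \<subseteq> Basis \<Longrightarrow> length bs \<le> N \<Longrightarrow> (1 + norm x) ^ N * norm (partials bs f x) \<le> K"
  shows "schwartz_seminorm N f \<le> real (card {bs. set bs \<subseteq> (Basis :: 'a set) \<and> length bs \<le> N}) * K"
  unfolding schwartz_seminorm_def
  by (rule sum_bounded_above) (auto intro!: cSUP_least assms)

lemma schwartz_seminorm_mono:
  assumes "f \<in> schwartz" "N \<le> M"
  shows "schwartz_seminorm N f \<le> schwartz_seminorm M f"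
proof -
  have "schwartz_seminorm N f \<le> (\<Sum>bs | set bs \<subseteq> Basis \<and> length bs \<le> N. SUP x. (1 + norm x) ^ M * norm (partials bs f x))"
    unfolding schwartz_seminorm_def
  proof (rule sum_mono)
    fix bs :: "'a list" assume "bs \<in> {bs. set bs \<subseteq> Basis \<and> length bs \<le> N}"
    then have bs: "set bs \<subseteq> Basis" by simp
    show "(SUP x. (1 + norm x) ^ N * norm (partials bs f x)) \<le> (SUP x. (1 + norm x) ^ M * norm (partials bs f x))"
    proof (rule cSUP_least)
      fix x
      have "(1 + norm x) ^ N * norm (partials bs f x) \<le> (1 + norm x) ^ M * norm (partials bs f x)"
        using assms(2) by (intro mult_right_mono power_increasing) auto
      with schwartz_sup_ge[OF assms(1) bs, of x M]
      show "(1 + norm x) ^ N * norm (partials bs f x) \<le> (SUP x. (1 + norm x) ^ M * norm (partials bs f x))" by simp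
    qed simp
  qed
  also have "\<dots> \<le> schwartz_seminorm M f"
    unfolding schwartz_seminorm_def
    by (rule sum_mono2) (use assms finite_partial_lists in \<open>auto intro!: schwartz_sup_nonneg\<close>)
  finally show ?thesis .
qed

lemma schwartz_seminorm_pd:
  assumes b: "(b :: 'a::euclidean_space) \<in> Basis"
  obtains C where "C \<ge> 0" "\<And>f. f \<in> schwartz \<Longrightarrow> schwartz_seminorm N (pd b f) \<le> C * schwartz_seminorm (Suc N) f"
proof (rule that)
  fix f :: "'a \<Rightarrow> complex" assume f: "f \<in> schwartz"
  show "schwartz_seminorm N (pd b f) \<le> real (card {bs. set bs \<subseteq> (Basis :: 'a set) \<and> length bs \<le> N}) * schwartz_seminorm (Suc N) f"
  proof (rule schwartz_seminorm_le)
    fix bs :: "'a list" and x assume "set bs \<subseteq> Basis" "length bs \<le> N"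
    then show "(1 + norm x) ^ N * norm (partials bs (pd b f) x) \<le> schwartz_seminorm (Suc N) f"
      using schwartz_seminorm_ge[OF f, of "bs @ [b]" "Suc N" N x] b by (simp add: partials_append)
  qed
qed simp

section \<open>Dependence of time-frequency shifts on the parameter\<close>

lemma norm_fst_snd_le:
  fixes z :: "'a::real_normed_vector \<times> 'b::real_normed_vector"
  shows "norm (fst z) \<le> norm z" "norm (snd z) \<le> norm z"
  using norm_fst_le[of "fst z" "snd z"] norm_snd_le[of "snd z" "fst z"] by auto

lemma norm_modulation_factor_le:
  fixes z :: "'a::euclidean_space \<times> 'a"
  assumes "b \<in> Basis"
  shows "norm (2 * pi * \<i> * complex_of_real (b \<bullet> snd z)) \<le> 2 * pi * norm z"
proof -
  have "\<bar>b \<bullet> snd z\<bar> \<le> norm z"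
    using Cauchy_Schwarz_ineq2[of b "snd z"] norm_fst_snd_le(2)[of z] assms by simp
  then show ?thesis by (simp add: norm_mult)
qed

lemma norm_cis_diff_le: "norm (cis a - cis b) \<le> \<bar>a - b\<bar>"
proof -
  have "norm (cis a - cis b) \<le> 1 * norm (a - b)"
  proof (rule differentiable_bound[of UNIV cis "\<lambda>x r. r *\<^sub>R (\<i> * cis x)"])
    show "(cis has_derivative (\<lambda>r. r *\<^sub>R (\<i> * cis x))) (at x within UNIV)" for x
      using has_derivative_cis[OF has_derivative_ident, of x UNIV] by simp
    show "onorm (\<lambda>r. r *\<^sub>R (\<i> * cis x)) \<le> 1" for x
      by (rule onorm_le) (simp add: norm_mult)
  qed auto
  then show ?thesis by simp
qed

text \<open>The last entry of the list is the derivative taken first. Peeling it off leaves shifts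
  of Schwartz functions with coefficients constant in t, so the estimates below go by induction from
  the right end of the list with f arbitrary.\<close>

lemma partials_snoc_tfs: 
  assumes "f \<in> schwartz" "b \<in> Basis" "set bs \<subseteq> Basis"
  shows "partials (bs @ [b]) (tfs z f) t = partials bs (tfs z (pd b f)) t + 2 * pi * \<i> * of_real (b \<bullet> snd z) * partials bs (tfs z f) t"
  unfolding partials_append pd_tfs[OF assms(1,2)]
  by (subst partials_add, intro schwartz_tfs schwartz_pd assms, intro schwartz_cmult schwartz_tfs assms, rule assms,
      subst partials_cmult, intro schwartz_tfs assms, rule assms) simp

text \<open>Translation costs a power of \<open>1 + norm z\<close>, and each derivative of the
  modulation raises the exponent further. Any polynomial will do: it is later absorbed by
  coefficients that have all moments.\<close>

lemma tfs_partials_bound: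
  fixes f :: "'a::euclidean_space \<Rightarrow> complex"
  assumes "f \<in> schwartz" "set bs \<subseteq> Basis"
  shows "\<exists>C M. C \<ge> 0 \<and> (\<forall>z t. (1 + norm t) ^ N * norm (partials bs (tfs z f) t) \<le> C * (1 + norm z) ^ M)"
  using assms
proof (induction bs arbitrary: f rule: rev_induct)
  case Nil
  obtain K where K: "K > 0" "\<And>x. (1 + norm x) ^ N * norm (f x) \<le> K" using schwartz_decay[OF Nil(1)] by blast
  have "(1 + norm t) ^ N * norm (tfs z f t) \<le> K * (1 + norm z) ^ N" for z t
  proof -
    have "1 + norm t \<le> (1 + norm (fst z)) * (1 + norm (t - fst z))"
      using one_plus_norm_add[of "fst z" "t - fst z"] by simp
    also have "\<dots> \<le> (1 + norm z) * (1 + norm (t - fst z))"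
      using norm_fst_le[of "fst z" "snd z"] by (intro mult_right_mono) auto
    finally have "(1 + norm t) ^ N * norm (tfs z f t) \<le> ((1 + norm z) * (1 + norm (t - fst z))) ^ N * norm (tfs z f t)"
      by (intro mult_right_mono power_mono) auto
    also have "\<dots> = (1 + norm z) ^ N * ((1 + norm (t - fst z)) ^ N * norm (f (t - fst z)))"
      by (simp add: power_mult_distrib norm_tfs)
    also have "\<dots> \<le> (1 + norm z) ^ N * K" by (intro mult_left_mono K) auto
    finally show ?thesis by (simp add: mult.commute)
  qed
  then show ?case using K(1) by (auto intro!: exI[of _ K] exI[of _ N])
next
  case (snoc b bs)
  then have b: "b \<in> Basis" "set bs \<subseteq> Basis" by auto
  obtain C M where C: "C \<ge> 0" "\<And>z t. (1 + norm t) ^ N * norm (partials bs (tfs z f) t) \<le> C * (1 + norm z) ^ M"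
    using snoc.IH[OF snoc.prems(1) b(2)] by blast
  obtain C' M' where C': "C' \<ge> 0" "\<And>z t. (1 + norm t) ^ N * norm (partials bs (tfs z (pd b f)) t) \<le> C' * (1 + norm z) ^ M'"
    using snoc.IH[OF schwartz_pd[OF snoc.prems(1) b(1)] b(2)] by blast
  have "(1 + norm t) ^ N * norm (partials (bs @ [b]) (tfs z f) t) \<le> (C' + 2 * pi * C) * (1 + norm z) ^ (M' + Suc M)" for z t
  proof -
    have c: "norm (2 * pi * \<i> * complex_of_real (b \<bullet> snd z)) \<le> 2 * pi * (1 + norm z)"
      by (rule order_trans[OF norm_modulation_factor_le[OF b(1)]]) simp
    have "(1 + norm t) ^ N * norm (partials (bs @ [b]) (tfs z f) t) \<le>
      (1 + norm t) ^ N * (norm (partials bs (tfs z (pd b f)) t) + norm (2 * pi * \<i> * complex_of_real (b \<bullet> snd z)) * norm (partials bs (tfs z f) t))"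
      unfolding partials_snoc_tfs[OF snoc.prems(1) b] norm_mult[symmetric]
      by (intro mult_left_mono norm_triangle_ineq) auto
    also have "\<dots> \<le> (1 + norm t) ^ N * norm (partials bs (tfs z (pd b f)) t) + (2 * pi * (1 + norm z)) * ((1 + norm t) ^ N * norm (partials bs (tfs z f) t))"
      by (simp only: distrib_left[of "(1 + norm t) ^ N"] mult.left_commute[of "(1 + norm t) ^ N"])
        (intro add_left_mono mult_right_mono c, auto)
    also have "\<dots> \<le> C' * (1 + norm z) ^ M' + (2 * pi * (1 + norm z)) * (C * (1 + norm z) ^ M)"
      by (intro add_mono mult_left_mono C C') auto
    also have "\<dots> \<le> C' * (1 + norm z) ^ (M' + Suc M) + 2 * pi * C * (1 + norm z) ^ (M' + Suc M)"
    proof (rule add_mono)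
      show "C' * (1 + norm z) ^ M' \<le> C' * (1 + norm z) ^ (M' + Suc M)"
        by (intro mult_left_mono power_increasing C') auto
      have "(2 * pi * (1 + norm z)) * (C * (1 + norm z) ^ M) = 2 * pi * C * (1 + norm z) ^ Suc M" by simp
      also have "\<dots> \<le> 2 * pi * C * (1 + norm z) ^ (M' + Suc M)"
        by (intro mult_left_mono power_increasing) (auto simp: C)
      finally show "(2 * pi * (1 + norm z)) * (C * (1 + norm z) ^ M) \<le> 2 * pi * C * (1 + norm z) ^ (M' + Suc M)" .
    qed
    finally show ?thesis by (simp add: distrib_right)
  qed
  moreover have "0 \<le> C' + 2 * pi * C" using C C' by simp
  ultimately show ?case by blast
qed

text \<open>The difference splits into a change of frequency and a change of position. The first is
  Lipschitz with a constant proportional to \<open>norm t\<close>, paid for by one extra power of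
  decay of f; the second follows from the mean value inequality along the segment between the two
  arguments of f.\<close>

lemma tfs_lipschitz_base:
  fixes f :: "'a::euclidean_space \<Rightarrow> complex"
  assumes f: "f \<in> schwartz"
  shows "\<exists>C M. C \<ge> 0 \<and> (\<forall>z w t. (1 + norm t) ^ N * norm (tfs z f t - tfs w f t) \<le> C * ((1 + norm z) * (1 + norm w)) ^ M * norm (z - w))"
proof -
  obtain K where K: "K > 0" "\<And>x. (1 + norm x) ^ Suc N * norm (f x) \<le> K" using schwartz_decay[OF f] by blast
  have "\<exists>L. \<forall>x. (1 + norm x) ^ N * norm (pd b f x) \<le> L" if "b \<in> Basis" for b
    using schwartz_decay[OF schwartz_pd[OF f that], of N] by blast
  then have "\<exists>L. \<forall>b\<in>Basis. \<forall>x. (1 + norm x) ^ N * norm (pd b f x) \<le> L b"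
    by (intro bchoice) blast
  then obtain L where L: "\<And>b x. b \<in> Basis \<Longrightarrow> (1 + norm x) ^ N * norm (pd b f x) \<le> L b" by blast
  define L' where "L' = (\<Sum>b\<in>Basis. L b)"
  have L0: "0 \<le> L b" if "b \<in> Basis" for b
    by (rule order_trans[OF _ L[OF that, of 0]]) simp
  have L'0: "0 \<le> L'" unfolding L'_def by (intro sum_nonneg L0)
  have "(1 + norm t) ^ N * norm (tfs z f t - tfs w f t) \<le> (2 * pi * K + L') * ((1 + norm z) * (1 + norm w)) ^ Suc N * norm (z - w)" for z w t
  proof -
    let ?Q = "(1 + norm z) * (1 + norm w)"
    have Q1: "1 \<le> ?Q" by (simp add: algebra_simps add_increasing add_increasing2)
    have fz: "norm (fst z) \<le> norm z" "norm (fst w) \<le> norm w" using norm_fst_le[of "fst z" "snd z"] norm_fst_le[of "fst w" "snd w"] by auto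
    have d: "norm (fst z - fst w) \<le> norm (z - w)" "norm (snd z - snd w) \<le> norm (z - w)"
      using norm_fst_snd_le[of "z - w"] by auto
    have zQ: "1 + norm z \<le> ?Q" "1 + norm w \<le> ?Q" by (auto simp: algebra_simps)
    have 1: "(1 + norm t) ^ N * norm ((cis (2 * pi * (t \<bullet> snd z)) - cis (2 * pi * (t \<bullet> snd w))) * f (t - fst z)) \<le> 2 * pi * K * ?Q ^ Suc N * norm (z - w)"
    proof -
      have "norm (cis (2 * pi * (t \<bullet> snd z)) - cis (2 * pi * (t \<bullet> snd w))) \<le> 2 * pi * \<bar>t \<bullet> (snd z - snd w)\<bar>"
        by (rule order_trans[OF norm_cis_diff_le]) (simp add: inner_diff_right abs_mult flip: right_diff_distrib)
      also have "\<dots> \<le> 2 * pi * (norm t * norm (z - w))"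
        using Cauchy_Schwarz_ineq2[of t "snd z - snd w"] d(2)
        by (intro mult_left_mono order_trans[OF Cauchy_Schwarz_ineq2]) auto
      also have "\<dots> \<le> 2 * pi * ((1 + norm t) * norm (z - w))" by (intro mult_left_mono mult_right_mono) auto
      finally have "(1 + norm t) ^ N * norm ((cis (2 * pi * (t \<bullet> snd z)) - cis (2 * pi * (t \<bullet> snd w))) * f (t - fst z))
         \<le> (1 + norm t) ^ N * (2 * pi * ((1 + norm t) * norm (z - w)) * norm (f (t - fst z)))"
        unfolding norm_mult by (intro mult_left_mono mult_right_mono) auto
      also have "\<dots> = 2 * pi * norm (z - w) * ((1 + norm t) ^ Suc N * norm (f (t - fst z)))" by simp
      also have "\<dots> \<le> 2 * pi * norm (z - w) * (?Q ^ Suc N * K)"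
      proof (intro mult_left_mono)
        have "1 + norm t \<le> (1 + norm (fst z)) * (1 + norm (t - fst z))"
          using one_plus_norm_add[of "fst z" "t - fst z"] by simp
        also have "\<dots> \<le> ?Q * (1 + norm (t - fst z))"
          using fz zQ by (intro mult_right_mono) auto
        finally have "(1 + norm t) ^ Suc N * norm (f (t - fst z)) \<le> (?Q * (1 + norm (t - fst z))) ^ Suc N * norm (f (t - fst z))"
          by (intro mult_right_mono power_mono) auto
        also have "\<dots> = ?Q ^ Suc N * ((1 + norm (t - fst z)) ^ Suc N * norm (f (t - fst z)))"
          unfolding power_mult_distrib by (simp only: mult.assoc)
        also have "\<dots> \<le> ?Q ^ Suc N * K"
          by (intro mult_left_mono K zero_le_power) auto
        finally show "(1 + norm t) ^ Suc N * norm (f (t - fst z)) \<le> ?Q ^ Suc N * K" .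
      qed auto
      finally show ?thesis by (simp only: mult_ac)
    qed
    have 2: "(1 + norm t) ^ N * norm (f (t - fst z) - f (t - fst w)) \<le> L' * ?Q ^ Suc N * norm (z - w)"
    proof -
      \<comment> \<open>For s on this segment \<open>norm (t - s)\<close> is at most
        \<open>norm z + norm w\<close>, so the weight at t is at most \<open>?Q\<close> times the
        weight at s, and decay of the partials of f at s becomes decay in t.\<close>
      let ?S = "closed_segment (t - fst z) (t - fst w)"
      let ?B = "L' * ?Q ^ N / (1 + norm t) ^ N"
      have B0: "0 \<le> ?B" using L'0 by simp
      have "norm (f (t - fst z) - f (t - fst w)) \<le> ?B * norm ((t - fst z) - (t - fst w))"
      proof (rule differentiable_bound[of ?S f "\<lambda>x h. \<Sum>b\<in>Basis. (h \<bullet> b) *\<^sub>R pd b f x"])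
        fix s assume s: "s \<in> ?S"
        then obtain u where u: "0 \<le> u" "u \<le> 1" "s = (1 - u) *\<^sub>R (t - fst z) + u *\<^sub>R (t - fst w)"
          unfolding closed_segment_def by blast
        have ts: "t - s = (1 - u) *\<^sub>R fst z + u *\<^sub>R fst w" unfolding u(3) by (simp add: algebra_simps)
        have "norm (t - s) \<le> (1 - u) * norm (fst z) + u * norm (fst w)"
          unfolding ts by (rule norm_triangle_le) (use u in simp)
        also have "\<dots> \<le> 1 * norm z + 1 * norm w"
          using u fz by (intro add_mono mult_mono) auto
        finally have "1 + norm (t - s) \<le> ?Q"
          using mult_nonneg_nonneg[OF norm_ge_zero[of z] norm_ge_zero[of w]] unfolding distrib_left distrib_right by linarith
        moreover have "1 + norm t \<le> (1 + norm (t - s)) * (1 + norm s)"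
          using one_plus_norm_add[of "t - s" s] by simp
        ultimately have "1 + norm t \<le> ?Q * (1 + norm s)"
          using mult_right_mono[of "1 + norm (t - s)" ?Q "1 + norm s"] by simp
        then have tQ: "(1 + norm t) ^ N \<le> ?Q ^ N * (1 + norm s) ^ N"
          unfolding power_mult_distrib[symmetric] by (intro power_mono) auto
        show "onorm (\<lambda>h. \<Sum>b\<in>Basis. (h \<bullet> b) *\<^sub>R pd b f s) \<le> ?B"
        proof (rule onorm_le)
          fix h
          have "norm (\<Sum>b\<in>Basis. (h \<bullet> b) *\<^sub>R pd b f s) \<le> (\<Sum>b\<in>Basis. norm h * norm (pd b f s))"
            by (intro sum_norm_le) (auto simp del: partials.simps intro!: mult_right_mono Basis_le_norm)
          also have "\<dots> = (\<Sum>b\<in>Basis. norm (pd b f s)) * norm h" by (simp add: sum_distrib_left mult.commute)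
          also have "(\<Sum>b\<in>Basis. norm (pd b f s)) \<le> ?B"
          proof -
            have "(1 + norm t) ^ N * (\<Sum>b\<in>Basis. norm (pd b f s)) \<le> (?Q ^ N * (1 + norm s) ^ N) * (\<Sum>b\<in>Basis. norm (pd b f s))"
              by (intro mult_right_mono tQ sum_nonneg) auto
            also have "\<dots> = ?Q ^ N * (\<Sum>b\<in>Basis. (1 + norm s) ^ N * norm (pd b f s))"
              by (simp only: sum_distrib_left mult.assoc)
            also have "\<dots> \<le> ?Q ^ N * L'" unfolding L'_def by (intro mult_left_mono sum_mono L zero_le_power) auto
            finally show ?thesis by (simp add: pos_le_divide_eq add_pos_nonneg mult.commute)
          qed
          finally show "norm (\<Sum>b\<in>Basis. (h \<bullet> b) *\<^sub>R pd b f s) \<le> ?B * norm h" by (simp add: mult_right_mono)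
        qed
      qed (use schwartz_has_derivative[OF f] in \<open>auto intro: has_derivative_at_withinI\<close>)
      also have "\<dots> \<le> ?B * norm (z - w)"
        using d(1) by (intro mult_left_mono B0) (simp add: norm_minus_commute)
      finally have "(1 + norm t) ^ N * norm (f (t - fst z) - f (t - fst w)) \<le> (1 + norm t) ^ N * (?B * norm (z - w))"
        by (intro mult_left_mono) auto
      also have "\<dots> = L' * ?Q ^ N * norm (z - w)"
        using norm_ge_zero[of t] by (simp add: add_nonneg_eq_0_iff)
      also have "\<dots> \<le> L' * ?Q ^ Suc N * norm (z - w)"
        using Q1 by (intro mult_right_mono mult_left_mono power_increasing L'0) auto
      finally show ?thesis .
    qed
    have "tfs z f t - tfs w f t = (cis (2 * pi * (t \<bullet> snd z)) - cis (2 * pi * (t \<bullet> snd w))) * f (t - fst z) +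
      cis (2 * pi * (t \<bullet> snd w)) * (f (t - fst z) - f (t - fst w))"
      by (simp add: tfs_apply algebra_simps)
    then have "norm (tfs z f t - tfs w f t) \<le> norm ((cis (2 * pi * (t \<bullet> snd z)) - cis (2 * pi * (t \<bullet> snd w))) * f (t - fst z)) +
      norm (f (t - fst z) - f (t - fst w))"
      using norm_triangle_ineq by (metis mult_1 norm_cis norm_mult)
    then have "(1 + norm t) ^ N * norm (tfs z f t - tfs w f t) \<le> (1 + norm t) ^ N * (norm ((cis (2 * pi * (t \<bullet> snd z)) - cis (2 * pi * (t \<bullet> snd w))) * f (t - fst z)) +
      norm (f (t - fst z) - f (t - fst w)))"
      by (intro mult_left_mono) auto
    with 1 2 show ?thesis by (simp only: distrib_left distrib_right)
  qed
  moreover have "0 \<le> 2 * pi * K + L'" using K L'0 by simp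
  ultimately show ?thesis by blast
qed

text \<open>Induction as in \<open>tfs_partials_bound\<close>. The new term is the modulation factor
  times a lower derivative; its difference is telescoped, so the growth bound for the lower
  derivative enters beside its Lipschitz bound.\<close>

lemma tfs_partials_lipschitz:
  fixes f :: "'a::euclidean_space \<Rightarrow> complex"
  assumes "f \<in> schwartz" "set bs \<subseteq> Basis"
  shows "\<exists>C M. C \<ge> 0 \<and> (\<forall>z w t. (1 + norm t) ^ N * norm (partials bs (tfs z f) t - partials bs (tfs w f) t) \<le>
      C * ((1 + norm z) * (1 + norm w)) ^ M * norm (z - w))"
  using assms
proof (induction bs arbitrary: f rule: rev_induct)
  case Nil
  then show ?case using tfs_lipschitz_base by simp
next
  case (snoc b bs)
  then have b: "b \<in> Basis" "set bs \<subseteq> Basis" by auto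
  obtain C M where C: "C \<ge> 0" "\<And>z w t. (1 + norm t) ^ N * norm (partials bs (tfs z f) t - partials bs (tfs w f) t) \<le> C * ((1 + norm z) * (1 + norm w)) ^ M * norm (z - w)"
    using snoc.IH[OF snoc.prems(1) b(2)] by blast
  obtain C' M' where C': "C' \<ge> 0" "\<And>z w t. (1 + norm t) ^ N * norm (partials bs (tfs z (pd b f)) t - partials bs (tfs w (pd b f)) t) \<le> C' * ((1 + norm z) * (1 + norm w)) ^ M' * norm (z - w)"
    using snoc.IH[OF schwartz_pd[OF snoc.prems(1) b(1)] b(2)] by blast
  obtain D L where D: "D \<ge> 0" "\<And>z t. (1 + norm t) ^ N * norm (partials bs (tfs z f) t) \<le> D * (1 + norm z) ^ L"
    using tfs_partials_bound[OF snoc.prems(1) b(2)] by blast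
  have "(1 + norm t) ^ N * norm (partials (bs @ [b]) (tfs z f) t - partials (bs @ [b]) (tfs w f) t) \<le>
     (C' + 2 * pi * C + 2 * pi * D) * ((1 + norm z) * (1 + norm w)) ^ (M' + Suc M + L) * norm (z - w)" for z w t
  proof -
    let ?P = "\<lambda>z. partials bs (tfs z f) t" and ?P' = "\<lambda>z. partials bs (tfs z (pd b f)) t"
    let ?c = "\<lambda>z. 2 * pi * \<i> * complex_of_real (b \<bullet> snd z)"
    let ?Q = "(1 + norm z) * (1 + norm w)"
    let ?T = "(1 + norm t) ^ N"
    have Q1: "1 \<le> ?Q" by (simp add: algebra_simps add_increasing add_increasing2)
    have zQ: "1 + norm z \<le> ?Q" "1 + norm w \<le> ?Q" by (auto simp: algebra_simps)
    have cz: "norm (?c z) \<le> 2 * pi * ?Q"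
    proof -
      have "norm (?c z) \<le> 2 * pi * (1 + norm z)"
        by (rule order_trans[OF norm_modulation_factor_le[OF b(1)]]) simp
      also have "\<dots> \<le> 2 * pi * ?Q" by (intro mult_left_mono zQ) auto
      finally show ?thesis .
    qed
    have czw: "norm (?c z - ?c w) \<le> 2 * pi * norm (z - w)"
    proof -
      have "?c z - ?c w = ?c (z - w)" by (simp add: inner_diff_right algebra_simps)
      moreover have "norm (?c (z - w)) \<le> 2 * pi * norm (z - w)"
        by (rule norm_modulation_factor_le[OF b(1)])
      ultimately show ?thesis by simp
    qed
    have "norm (partials (bs @ [b]) (tfs z f) t - partials (bs @ [b]) (tfs w f) t) =
       norm ((?P' z - ?P' w) + ?c z * (?P z - ?P w) + (?c z - ?c w) * ?P w)"
      unfolding partials_snoc_tfs[OF snoc.prems(1) b] by (simp add: algebra_simps)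
    also have "\<dots> \<le> norm (?P' z - ?P' w) + norm (?c z) * norm (?P z - ?P w) + norm (?c z - ?c w) * norm (?P w)"
      unfolding norm_mult[symmetric] by (intro order_trans[OF norm_triangle_ineq] add_right_mono norm_triangle_ineq)
    finally have "?T * norm (partials (bs @ [b]) (tfs z f) t - partials (bs @ [b]) (tfs w f) t) \<le>
       ?T * (norm (?P' z - ?P' w) + norm (?c z) * norm (?P z - ?P w) + norm (?c z - ?c w) * norm (?P w))"
      by (intro mult_left_mono) auto
    also have "\<dots> = ?T * norm (?P' z - ?P' w) + norm (?c z) * (?T * norm (?P z - ?P w)) + norm (?c z - ?c w) * (?T * norm (?P w))"
      by (simp only: distrib_left mult.left_commute)
    also have "\<dots> \<le> C' * ?Q ^ M' * norm (z - w) + (2 * pi * ?Q) * (C * ?Q ^ M * norm (z - w)) + (2 * pi * norm (z - w)) * (D * (1 + norm w) ^ L)"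
      by (intro add_mono mult_mono C' C D cz czw) auto
    also have "\<dots> \<le> C' * ?Q ^ (M' + Suc M + L) * norm (z - w) + (2 * pi * C) * ?Q ^ (M' + Suc M + L) * norm (z - w) + (2 * pi * D) * ?Q ^ (M' + Suc M + L) * norm (z - w)"
    proof (intro add_mono)
      show "C' * ?Q ^ M' * norm (z - w) \<le> C' * ?Q ^ (M' + Suc M + L) * norm (z - w)"
        by (intro mult_right_mono mult_left_mono power_increasing C' Q1) auto
      have "(2 * pi * ?Q) * (C * ?Q ^ M * norm (z - w)) = (2 * pi * C) * ?Q ^ Suc M * norm (z - w)" by (simp only: power_Suc mult_ac)
      also have "\<dots> \<le> (2 * pi * C) * ?Q ^ (M' + Suc M + L) * norm (z - w)"
        by (intro mult_right_mono mult_left_mono power_increasing Q1) (auto simp: C)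
      finally show "(2 * pi * ?Q) * (C * ?Q ^ M * norm (z - w)) \<le> (2 * pi * C) * ?Q ^ (M' + Suc M + L) * norm (z - w)" .
      have "(1 + norm w) ^ L \<le> ?Q ^ L" by (intro power_mono zQ) auto
      also have "\<dots> \<le> ?Q ^ (M' + Suc M + L)" by (intro power_increasing Q1) auto
      finally have "(2 * pi * D * norm (z - w)) * (1 + norm w) ^ L \<le> (2 * pi * D * norm (z - w)) * ?Q ^ (M' + Suc M + L)"
        by (intro mult_left_mono) (auto simp: D)
      then show "(2 * pi * norm (z - w)) * (D * (1 + norm w) ^ L) \<le> (2 * pi * D) * ?Q ^ (M' + Suc M + L) * norm (z - w)"
        by (simp only: mult_ac)
    qed
    finally show ?thesis by (simp only: distrib_right)
  qed
  moreover have "0 \<le> C' + 2 * pi * C + 2 * pi * D" using C C' D by simp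
  ultimately show ?case by blast
qed

lemma isCont_of_weighted_lipschitz:
  fixes F :: "'a::real_normed_vector \<Rightarrow> complex"
  assumes "\<And>z w. norm (F z - F w) \<le> C * ((1 + norm z) * (1 + norm w)) ^ M * norm (z - w)"
  shows "isCont F w"
proof -
  have "((\<lambda>z. C * ((1 + norm z) * (1 + norm w)) ^ M * norm (z - w)) \<longlongrightarrow> C * ((1 + norm w) * (1 + norm w)) ^ M * norm (w - w)) (at w)"
    by (intro tendsto_intros)
  then have "((\<lambda>z. C * ((1 + norm z) * (1 + norm w)) ^ M * norm (z - w)) \<longlongrightarrow> 0) (at w)" by simp
  then have "((\<lambda>z. F z - F w) \<longlongrightarrow> 0) (at w)"
    by (rule Lim_null_comparison[rotated]) (use assms in auto)
  then show ?thesis unfolding isCont_def by (simp add: LIM_zero_iff)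
qed

lemma isCont_tfs_partials:
  assumes "f \<in> schwartz" "set bs \<subseteq> Basis"
  shows "isCont (\<lambda>z. partials bs (tfs z f) t) z"
proof -
  obtain C M where "\<And>z w t. (1 + norm t) ^ 0 * norm (partials bs (tfs z f) t - partials bs (tfs w f) t) \<le>
      C * ((1 + norm z) * (1 + norm w)) ^ M * norm (z - w)"
    using tfs_partials_lipschitz[OF assms, of 0] by blast
  then show ?thesis by (intro isCont_of_weighted_lipschitz) simp
qed

lemma tfs_partials_measurable:
  assumes "f \<in> schwartz" "set bs \<subseteq> Basis"
  shows "(\<lambda>z. partials bs (tfs z f) t) \<in> borel_measurable borel"
  by (intro borel_measurable_continuous_onI continuous_at_imp_continuous_on ballI isCont_tfs_partials assms)

lemma schwartz_seminorm_tfs_lipschitz: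
  fixes f :: "'a::euclidean_space \<Rightarrow> complex"
  assumes f: "f \<in> schwartz"
  obtains C M where "C \<ge> 0" "\<And>z w. schwartz_seminorm N (\<lambda>t. tfs z f t - tfs w f t) \<le> C * ((1 + norm z) * (1 + norm w)) ^ M * norm (z - w)"
proof -
  let ?L = "{bs. set bs \<subseteq> (Basis :: 'a set) \<and> length bs \<le> N}"
  obtain C M where CM: "\<And>bs. bs \<in> ?L \<Longrightarrow> C bs \<ge> 0" "\<And>bs z w t. bs \<in> ?L \<Longrightarrow> (1 + norm t) ^ N * norm (partials bs (tfs z f) t - partials bs (tfs w f) t) \<le>
      C bs * ((1 + norm z) * (1 + norm w)) ^ M bs * norm (z - w)"
  proof -
    have "\<forall>bs\<in>?L. \<exists>CM. fst CM \<ge> 0 \<and> (\<forall>z w t. (1 + norm t) ^ N * norm (partials bs (tfs z f) t - partials bs (tfs w f) t) \<le>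
      fst CM * ((1 + norm z) * (1 + norm w)) ^ snd CM * norm (z - w))"
      using tfs_partials_lipschitz[OF f, of _ N] by fastforce
    from bchoice[OF this] obtain CM where "\<forall>bs\<in>?L. fst (CM bs) \<ge> 0 \<and> (\<forall>z w t. (1 + norm t) ^ N * norm (partials bs (tfs z f) t - partials bs (tfs w f) t) \<le>
      fst (CM bs) * ((1 + norm z) * (1 + norm w)) ^ snd (CM bs) * norm (z - w))" ..
    then show ?thesis using that[of "\<lambda>bs. fst (CM bs)" "\<lambda>bs. snd (CM bs)"] by blast
  qed
  \<comment> \<open>Sums serve as common upper bounds for the finitely many constants and
    exponents.\<close>
  define C' M' where "C' = (\<Sum>bs\<in>?L. C bs)" and "M' = (\<Sum>bs\<in>?L. M bs)"
  have C'0: "0 \<le> C'" unfolding C'_def using CM(1) by (intro sum_nonneg) auto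
  have "schwartz_seminorm N (\<lambda>t. tfs z f t - tfs w f t) \<le> (real (card ?L) * C') * ((1 + norm z) * (1 + norm w)) ^ M' * norm (z - w)" for z w
  proof -
    let ?Q = "(1 + norm z) * (1 + norm w)"
    have Q1: "1 \<le> ?Q" by (simp add: algebra_simps add_increasing add_increasing2)
    have "schwartz_seminorm N (\<lambda>t. tfs z f t - tfs w f t) \<le> real (card ?L) * (C' * ?Q ^ M' * norm (z - w))"
    proof (rule schwartz_seminorm_le)
      fix bs :: "'a list" and t assume bs: "set bs \<subseteq> Basis" "length bs \<le> N"
      have "(1 + norm t) ^ N * norm (partials bs (\<lambda>t. tfs z f t - tfs w f t) t) \<le> C bs * ?Q ^ M bs * norm (z - w)"
        using CM(2)[of bs t z w] bs by (simp add: partials_diff schwartz_tfs f)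
      also have "C bs \<le> C'" unfolding C'_def using bs CM(1) finite_partial_lists by (intro member_le_sum) auto
      also have "?Q ^ M bs \<le> ?Q ^ M'" unfolding M'_def using bs finite_partial_lists Q1
        by (intro power_increasing member_le_sum) auto
      finally show "(1 + norm t) ^ N * norm (partials bs (\<lambda>t. tfs z f t - tfs w f t) t) \<le> C' * ?Q ^ M' * norm (z - w)"
        using C'0 by (simp add: mult_right_mono mult_left_mono)
    qed
    then show ?thesis by (simp only: mult.assoc)
  qed
  moreover have "0 \<le> real (card ?L) * C'" unfolding C'_def using CM(1) by (intro mult_nonneg_nonneg sum_nonneg) auto
  ultimately show ?thesis using that by blast
qed

lemma schwartz_seminorm_tfs_bound:
  fixes f :: "'a::euclidean_space \<Rightarrow> complex"
  assumes f: "f \<in> schwartz"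
  obtains C M where "C \<ge> 0" "\<And>z. schwartz_seminorm N (tfs z f) \<le> C * (1 + norm z) ^ M"
proof -
  let ?L = "{bs. set bs \<subseteq> (Basis :: 'a set) \<and> length bs \<le> N}"
  obtain C M where CM: "\<And>bs. bs \<in> ?L \<Longrightarrow> C bs \<ge> 0" "\<And>bs z t. bs \<in> ?L \<Longrightarrow> (1 + norm t) ^ N * norm (partials bs (tfs z f) t) \<le>
      C bs * (1 + norm z) ^ M bs"
  proof -
    have "\<forall>bs\<in>?L. \<exists>CM. fst CM \<ge> 0 \<and> (\<forall>z t. (1 + norm t) ^ N * norm (partials bs (tfs z f) t) \<le>
      fst CM * (1 + norm z) ^ snd CM)"
      using tfs_partials_bound[OF f, of _ N] by fastforce
    from bchoice[OF this] obtain CM where "\<forall>bs\<in>?L. fst (CM bs) \<ge> 0 \<and> (\<forall>z t. (1 + norm t) ^ N * norm (partials bs (tfs z f) t) \<le> fst (CM bs) * (1 + norm z) ^ snd (CM bs))" ..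
    then show ?thesis using that[of "\<lambda>bs. fst (CM bs)" "\<lambda>bs. snd (CM bs)"] by blast
  qed
  define C' M' where "C' = (\<Sum>bs\<in>?L. C bs)" and "M' = (\<Sum>bs\<in>?L. M bs)"
  have C'0: "0 \<le> C'" unfolding C'_def using CM(1) by (intro sum_nonneg) auto
  have "schwartz_seminorm N (tfs z f) \<le> (real (card ?L) * C') * (1 + norm z) ^ M'" for z
  proof -
    have "schwartz_seminorm N (tfs z f) \<le> real (card ?L) * (C' * (1 + norm z) ^ M')"
    proof (rule schwartz_seminorm_le)
      fix bs :: "'a list" and t assume bs: "set bs \<subseteq> Basis" "length bs \<le> N"
      have "(1 + norm t) ^ N * norm (partials bs (tfs z f) t) \<le> C bs * (1 + norm z) ^ M bs"
        using CM(2)[of bs t z] bs by simp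
      also have "C bs \<le> C'" unfolding C'_def using bs CM(1) finite_partial_lists by (intro member_le_sum) auto
      also have "(1 + norm z) ^ M bs \<le> (1 + norm z) ^ M'" unfolding M'_def using bs finite_partial_lists
        by (intro power_increasing member_le_sum) auto
      finally show "(1 + norm t) ^ N * norm (partials bs (tfs z f) t) \<le> C' * (1 + norm z) ^ M'"
        using C'0 by (simp add: mult_right_mono mult_left_mono)
    qed
    then show ?thesis by (simp only: mult.assoc)
  qed
  moreover have "0 \<le> real (card ?L) * C'" using C'0 by simp
  ultimately show ?thesis using that by blast
qed

section \<open>The short-time Fourier transform\<close>

lemma stft_eq: "stft \<phi> f z = (LINT t|lborel. f t * cnj (tfs z \<phi> t))"
  by (cases z) (simp add: stft_def L2_inner_def tfs_def)

lemma stft_distr_eq: "stft_distr \<phi> u z = u (tfs z \<phi>)"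
  by (cases z) (simp add: stft_distr_def tfs_def)

lemma stft_distr_distr_of: "\<phi> \<in> schwartz \<Longrightarrow> stft_distr \<phi> (distr_of f) = stft \<phi> f"
  by (auto simp: fun_eq_iff stft_distr_eq distr_of_def schwartz_tfs stft_eq L2_inner_def)

lemma M1_norm_eq: "\<phi> \<in> schwartz \<Longrightarrow> M1_norm \<phi> f = (LINT z|lborel. norm (stft \<phi> f z))"
  by (simp add: M1_norm_def stft_distr_distr_of)

lemma M1_norm_nonneg: "0 \<le> M1_norm \<phi> f"
  by (simp add: M1_norm_def)

lemma measurable_cnj [measurable]: "cnj \<in> borel_measurable borel"
  by (intro borel_measurable_continuous_onI continuous_intros)

text \<open>Covariance of the short-time Fourier transform, from substituting
  \<open>t + fst w\<close> for t. The main consequence is that the modulus is merely translated, so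
  all shifts of a function have the same \<open>M1\<close> norm.\<close>

lemma stft_tfs:
  assumes "\<eta> \<in> schwartz" "\<phi> \<in> schwartz"
  shows "stft \<phi> (tfs w \<eta>) z = cis (2 * pi * (fst w \<bullet> (snd w - snd z))) * stft \<phi> \<eta> (z - w)"
proof -
  have [measurable]: "tfs w \<eta> \<in> borel_measurable borel" "tfs z \<phi> \<in> borel_measurable borel"
    using assms schwartz_tfs schwartz_measurable by blast+
  have "stft \<phi> (tfs w \<eta>) z = (LINT t|lborel. tfs w \<eta> (t + fst w) * cnj (tfs z \<phi> (t + fst w)))"
    unfolding stft_eq by (subst integral_translate[symmetric, of _ "fst w"]) auto
  also have "\<dots> = (LINT t|lborel. cis (2 * pi * (fst w \<bullet> (snd w - snd z))) * (\<eta> t * cnj (tfs (z - w) \<phi> t)))"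
  proof (intro Bochner_Integration.integral_cong refl)
    fix t
    have c: "cis (2 * pi * ((t + fst w) \<bullet> snd w)) * cnj (cis (2 * pi * ((t + fst w) \<bullet> snd z))) =
       cis (2 * pi * (fst w \<bullet> (snd w - snd z))) * cnj (cis (2 * pi * (t \<bullet> snd (z - w))))"
      by (simp add: cis_cnj cis_mult inner_simps algebra_simps)
    have d: "t + fst w - fst z = t - fst (z - w)" by simp
    have "tfs w \<eta> (t + fst w) * cnj (tfs z \<phi> (t + fst w)) =
        (cis (2 * pi * ((t + fst w) \<bullet> snd w)) * cnj (cis (2 * pi * ((t + fst w) \<bullet> snd z)))) * (\<eta> t * cnj (\<phi> (t - fst (z - w))))"
      unfolding tfs_apply complex_cnj_mult d by (simp only: add_diff_cancel_right' mult_ac)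
    also have "\<dots> = cis (2 * pi * (fst w \<bullet> (snd w - snd z))) * (\<eta> t * cnj (tfs (z - w) \<phi> t))"
      unfolding c tfs_apply complex_cnj_mult by (simp only: mult_ac)
    finally show "tfs w \<eta> (t + fst w) * cnj (tfs z \<phi> (t + fst w)) =
        cis (2 * pi * (fst w \<bullet> (snd w - snd z))) * (\<eta> t * cnj (tfs (z - w) \<phi> t))" .
  qed
  finally show ?thesis by (simp add: stft_eq)
qed

lemma norm_stft_tfs:
  assumes "\<eta> \<in> schwartz" "\<phi> \<in> schwartz"
  shows "norm (stft \<phi> (tfs w \<eta>) z) = norm (stft \<phi> \<eta> (z - w))"
  by (simp add: stft_tfs[OF assms] norm_mult)

lemma measurable_fst_borel [measurable]: "fst \<in> borel_measurable (borel :: ('a::euclidean_space \<times> 'b::euclidean_space) measure)"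
  and measurable_snd_borel [measurable]: "snd \<in> borel_measurable (borel :: ('a::euclidean_space \<times> 'b::euclidean_space) measure)"
  by (intro borel_measurable_continuous_onI continuous_intros)+

lemma measurable_cis [measurable]: "cis \<in> borel_measurable borel"
  by (intro borel_measurable_continuous_onI continuous_intros)

lemma measurable_tfs_comp:
  fixes \<phi> :: "'a::euclidean_space \<Rightarrow> complex"
  assumes "\<phi> \<in> borel_measurable borel" "f \<in> borel_measurable M" "g \<in> borel_measurable M"
  shows "(\<lambda>x. tfs (f x) \<phi> (g x)) \<in> borel_measurable M"
proof -
  note [measurable] = assms
  show ?thesis unfolding tfs_apply by measurable
qed

lemma stft_measurable:
  assumes "f \<in> borel_measurable borel" "\<phi> \<in> borel_measurable borel"
  shows "stft \<phi> f \<in> borel_measurable borel"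
proof -
  note [measurable] = assms measurable_tfs_comp[OF assms(2)]
  have "(\<lambda>(z, t). f t * cnj (tfs z \<phi> t)) \<in> borel_measurable (borel \<Otimes>\<^sub>M lborel)"
    by measurable
  then have "(\<lambda>z. LINT t|lborel. f t * cnj (tfs z \<phi> t)) \<in> borel_measurable borel"
    by (rule lborel.borel_measurable_lebesgue_integral)
  then show ?thesis by (simp add: stft_eq[abs_def])
qed

lemma integrable_bounded_mult:
  fixes f g :: "'a::euclidean_space \<Rightarrow> complex"
  assumes "f \<in> borel_measurable borel" "\<And>t. norm (f t) \<le> B" "integrable lborel g"
  shows "integrable lborel (\<lambda>t. f t * g t)"
proof (rule Bochner_Integration.integrable_bound)
  show "integrable lborel (\<lambda>t. B * norm (g t))" using assms(3) by auto
  have [measurable]: "g \<in> borel_measurable borel" using assms(3) by auto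
  note [measurable] = assms(1)
  show "(\<lambda>t. f t * g t) \<in> borel_measurable lborel" by measurable
  have "0 \<le> B" using order_trans[OF norm_ge_zero assms(2)] .
  then show "AE t in lborel. norm (f t * g t) \<le> norm (B * norm (g t))"
    using assms(2) by (auto simp: norm_mult abs_mult intro!: AE_I2 mult_right_mono)
qed

lemma schwartz_integrable_mult_tfs:
  assumes "f \<in> schwartz" "\<phi> \<in> schwartz"
  shows "integrable lborel (\<lambda>t. f t * cnj (tfs z \<phi> t))"
proof -
  obtain B where "\<And>x. norm (f x) \<le> B" using schwartz_bounded[OF assms(1)] by blast
  then show ?thesis
    using integrable_bounded_mult[of f B] schwartz_integrable[OF schwartz_cnj[OF schwartz_tfs[OF assms(2)]]]
      schwartz_measurable[OF assms(1)] by blast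
qed

section \<open>Decay of the transform of Schwartz functions\<close>

lemma sum_Basis_pd:
  assumes "b \<in> Basis"
  shows "(\<Sum>c\<in>Basis. (b \<bullet> c) *\<^sub>R pd c f x) = pd b f x"
  using assms by (simp add: inner_Basis if_distrib[of "\<lambda>c. c *\<^sub>R _"] cong: if_cong)

text \<open>Integration by parts for f times the conjugated shift of \<phi>: a frequency coordinate
  is traded for one derivative on f or on the window.\<close>

lemma stft_pd:
  assumes f: "f \<in> schwartz" and \<phi>: "\<phi> \<in> schwartz" and b: "b \<in> Basis"
  shows "stft \<phi> (pd b f) z + stft (pd b \<phi>) f z = 2 * pi * \<i> * of_real (b \<bullet> snd z) * stft \<phi> f z"
proof -
  let ?c = "2 * pi * \<i> * of_real (b \<bullet> snd z)"
  define h' where "h' t h = f t * cnj (\<Sum>c\<in>Basis. (h \<bullet> c) *\<^sub>R pd c (tfs z \<phi>) t) + (\<Sum>c\<in>Basis. (h \<bullet> c) *\<^sub>R pd c f t) * cnj (tfs z \<phi> t)" for t h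
  have h': "h' t b = (pd b f t * cnj (tfs z \<phi> t) + f t * cnj (tfs z (pd b \<phi>) t)) - ?c * (f t * cnj (tfs z \<phi> t))" for t
    unfolding h'_def sum_Basis_pd[OF b] pd_tfs[OF \<phi> b]
    by (simp add: algebra_simps)
  note i = schwartz_integrable_mult_tfs[OF schwartz_pd[OF f b] \<phi>] schwartz_integrable_mult_tfs[OF f schwartz_pd[OF \<phi> b]]
    schwartz_integrable_mult_tfs[OF f \<phi>]
  have "(LINT t|lborel. h' t b) = 0"
  proof (rule integral_derivative_eq_0[where h = "\<lambda>t. f t * cnj (tfs z \<phi> t)"])
    show "((\<lambda>t. f t * cnj (tfs z \<phi> t)) has_derivative h' t) (at t)" for t
      unfolding h'_def[abs_def]
      by (intro has_derivative_mult schwartz_has_derivative f bounded_linear.has_derivative[OF bounded_linear_cnj] schwartz_tfs \<phi>)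
    show "integrable lborel (\<lambda>t. h' t b)"
      unfolding h' using i by (intro Bochner_Integration.integrable_diff Bochner_Integration.integrable_add integrable_mult_right)
    show "continuous_on UNIV (\<lambda>t. h' t b)"
      unfolding h' by (intro continuous_intros schwartz_continuous schwartz_tfs schwartz_pd f \<phi> b)
  qed (rule i(3))
  moreover have "(LINT t|lborel. h' t b) = stft \<phi> (pd b f) z + stft (pd b \<phi>) f z - ?c * stft \<phi> f z"
    unfolding h' stft_eq
    by (subst Bochner_Integration.integral_diff, intro Bochner_Integration.integrable_add i, intro integrable_mult_right i,
        subst Bochner_Integration.integral_add, rule i, rule i) simp
  ultimately show ?thesis by simp
qed

lemma schwartz_L1_seminorm:
  "\<exists>N C. C \<ge> 0 \<and> (\<forall>f\<in>schwartz. (LINT t|lborel. norm (f t)) \<le> C * schwartz_seminorm N (f :: 'a::euclidean_space \<Rightarrow> complex))"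
proof -
  let ?D = "2 * DIM('a)"
  let ?W = "LINT x|lborel. 1 / (1 + norm (x::'a)) ^ ?D"
  have "(LINT t|lborel. norm (f t)) \<le> ?W * schwartz_seminorm ?D f" if f: "f \<in> schwartz" for f :: "'a \<Rightarrow> complex"
  proof -
    have "(LINT t|lborel. norm (f t)) \<le> (LINT t|lborel. 1 / (1 + norm (t::'a)) ^ ?D * schwartz_seminorm ?D f)"
    proof (rule integral_mono')
      show "integrable lborel (\<lambda>t::'a. 1 / (1 + norm t) ^ ?D * schwartz_seminorm ?D f)"
        by (intro integrable_mult_left integrable_inverse_weight)
      fix t :: 'a
      have "0 < (1 + norm t) ^ ?D" by (simp add: add_pos_nonneg)
      with schwartz_seminorm_ge[OF f, of "[]" ?D ?D t]
      show "norm (f t) \<le> 1 / (1 + norm t) ^ ?D * schwartz_seminorm ?D f"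
        by (simp add: pos_le_divide_eq mult.commute)
    qed (use schwartz_seminorm_nonneg[OF f] in auto)
    also have "\<dots> = ?W * schwartz_seminorm ?D f" by (rule integral_mult_left_zero)
    finally show ?thesis .
  qed
  moreover have "0 \<le> ?W" by (intro Bochner_Integration.integral_nonneg) auto
  ultimately show ?thesis by blast
qed

text \<open>Decay in position: submultiplicativity splits the weight at \<open>fst z\<close> between
  f at t and \<phi> at \<open>t - fst z\<close>, and the further \<open>?D\<close> powers of decay
  of f make the integral over t converge.\<close>

lemma stft_decay_base:
  fixes \<phi> :: "'a::euclidean_space \<Rightarrow> complex"
  assumes \<phi>: "\<phi> \<in> schwartz"
  shows "\<exists>N C. C \<ge> 0 \<and> (\<forall>f\<in>schwartz. \<forall>z. (1 + norm (fst z)) ^ n * norm (stft \<phi> f z) \<le> C * schwartz_seminorm N f)"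
proof -
  obtain K where K: "K > 0" "\<And>x. (1 + norm x) ^ n * norm (\<phi> x) \<le> K" using schwartz_decay[OF \<phi>] by blast
  let ?D = "2 * DIM('a)"
  let ?W = "LINT x|lborel. 1 / (1 + norm (x::'a)) ^ ?D"
  have "(1 + norm (fst z)) ^ n * norm (stft \<phi> f z) \<le> (K * ?W) * schwartz_seminorm (n + ?D) f"
    if f: "f \<in> schwartz" for f and z :: "'a \<times> 'a"
  proof -
    let ?p = "schwartz_seminorm (n + ?D) f"
    have n1: "norm (complex_of_real ((1 + norm (fst z)) ^ n)) = (1 + norm (fst z)) ^ n"
      by (simp only: norm_of_real) simp
    have "norm (LINT t|lborel. of_real ((1 + norm (fst z)) ^ n) * (f t * cnj (tfs z \<phi> t))) \<le>
       (LINT t|lborel. K * ?p * (1 / (1 + norm (t::'a)) ^ ?D))"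
    proof (rule norm_integral_le)
      show "integrable lborel (\<lambda>t::'a. K * ?p * (1 / (1 + norm t) ^ ?D))"
        by (intro integrable_mult_right integrable_inverse_weight)
      fix t :: 'a
      have "1 + norm (fst z) \<le> (1 + norm t) * (1 + norm (t - fst z))"
        using one_plus_norm_add[of t "fst z - t"] by (simp add: norm_minus_commute)
      then have "(1 + norm (fst z)) ^ n * (norm (f t) * norm (\<phi> (t - fst z))) \<le>
          ((1 + norm t) * (1 + norm (t - fst z))) ^ n * (norm (f t) * norm (\<phi> (t - fst z)))"
        by (intro mult_right_mono power_mono) auto
      also have "\<dots> = ((1 + norm t) ^ n * norm (f t)) * ((1 + norm (t - fst z)) ^ n * norm (\<phi> (t - fst z)))"
        by (simp only: power_mult_distrib mult_ac)
      also have "\<dots> \<le> (?p / (1 + norm t) ^ ?D) * K"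
      proof (intro mult_mono K)
        have "0 < (1 + norm t) ^ ?D" by (simp add: add_pos_nonneg)
        moreover have "(1 + norm t) ^ n * norm (f t) * (1 + norm t) ^ ?D \<le> ?p"
          using schwartz_seminorm_ge[OF f, of "[]" "n + ?D" "n + ?D" t] by (simp add: power_add mult_ac)
        ultimately show "(1 + norm t) ^ n * norm (f t) \<le> ?p / (1 + norm t) ^ ?D"
          by (simp add: pos_le_divide_eq)
      qed (auto simp: schwartz_seminorm_nonneg f)
      finally show "norm (of_real ((1 + norm (fst z)) ^ n) * (f t * cnj (tfs z \<phi> t))) \<le> K * ?p * (1 / (1 + norm t) ^ ?D)"
        by (simp only: norm_mult n1 complex_mod_cnj norm_tfs) (simp add: mult_ac)
    qed
    also have "(LINT t|lborel. of_real ((1 + norm (fst z)) ^ n) * (f t * cnj (tfs z \<phi> t))) = of_real ((1 + norm (fst z)) ^ n) * stft \<phi> f z"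
      unfolding stft_eq by simp
    also have "(LINT t|lborel. K * ?p * (1 / (1 + norm (t::'a)) ^ ?D)) = (K * ?W) * ?p" 
      by (subst integral_mult_right_zero) simp
    finally show ?thesis by (simp only: norm_mult n1)
  qed
  moreover have "0 \<le> K * ?W" using K(1) by (intro mult_nonneg_nonneg Bochner_Integration.integral_nonneg) auto
  ultimately show ?thesis by blast
qed

text \<open>Decay in frequency, by induction on m with the window arbitrary, since
  \<open>stft_pd\<close> differentiates the window as well. Each step bounds the frequency by the
  sum of its coordinates and applies the previous case to f, to its partials and to the partials of
  the window.\<close>

lemma stft_decay2:
  fixes \<phi> :: "'a::euclidean_space \<Rightarrow> complex"
  assumes "\<phi> \<in> schwartz"
  shows "\<exists>N C. C \<ge> 0 \<and> (\<forall>f\<in>schwartz. \<forall>z. (1 + norm (snd z)) ^ m * ((1 + norm (fst z)) ^ n * norm (stft \<phi> f z)) \<le> C * schwartz_seminorm N f)"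
  using assms
proof (induction m arbitrary: \<phi>)
  case 0
  then show ?case using stft_decay_base by simp
next
  case (Suc m)
  let ?w = "\<lambda>z :: 'a \<times> 'a. (1 + norm (snd z)) ^ m * (1 + norm (fst z)) ^ n"
  obtain N0 C0 where N0: "C0 \<ge> 0" "\<And>f z. f \<in> schwartz \<Longrightarrow> ?w z * norm (stft \<phi> f z) \<le> C0 * schwartz_seminorm N0 f"
    using Suc.IH[OF Suc.prems] unfolding mult.assoc by blast
  have "\<forall>b\<in>Basis. \<exists>NC. snd NC \<ge> 0 \<and> (\<forall>f\<in>schwartz. \<forall>z. ?w z * norm (stft (pd b \<phi>) f z) \<le> snd NC * schwartz_seminorm (fst NC) f)"
    using Suc.IH[OF schwartz_pd[OF Suc.prems]] unfolding mult.assoc by fastforce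
  from bchoice[OF this] obtain NC where NC: "\<And>b. b \<in> Basis \<Longrightarrow> snd (NC b) \<ge> 0"
    "\<And>b f z. b \<in> Basis \<Longrightarrow> f \<in> schwartz \<Longrightarrow> ?w z * norm (stft (pd b \<phi>) f z) \<le> snd (NC b) * schwartz_seminorm (fst (NC b)) f"
    by blast
  have "\<forall>b\<in>(Basis::'a set). \<exists>D. D \<ge> 0 \<and> (\<forall>f\<in>schwartz. schwartz_seminorm N0 (pd b f) \<le> D * schwartz_seminorm (Suc N0) f)"
    using schwartz_seminorm_pd by metis
  from bchoice[OF this] obtain D where D: "\<And>b. b \<in> (Basis::'a set) \<Longrightarrow> D b \<ge> 0"
    "\<And>b f. b \<in> (Basis::'a set) \<Longrightarrow> f \<in> schwartz \<Longrightarrow> schwartz_seminorm N0 (pd b f) \<le> D b * schwartz_seminorm (Suc N0) f"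
    by blast
  define N where "N = Suc N0 + (\<Sum>b\<in>(Basis::'a set). fst (NC b))"
  define C where "C = C0 + (\<Sum>b\<in>(Basis::'a set). C0 * D b + snd (NC b))"
  have "(1 + norm (snd z)) ^ Suc m * ((1 + norm (fst z)) ^ n * norm (stft \<phi> f z)) \<le> C * schwartz_seminorm N f"
    if f: "f \<in> schwartz" for f and z :: "'a \<times> 'a"
  proof -
    have pN: "schwartz_seminorm k f \<le> schwartz_seminorm N f" if "k \<le> N" for k
      by (rule schwartz_seminorm_mono[OF f that])
    have w0: "0 \<le> ?w z" by simp
    have b: "?w z * (\<bar>snd z \<bullet> b\<bar> * norm (stft \<phi> f z)) \<le> (C0 * D b + snd (NC b)) * schwartz_seminorm N f" if b: "b \<in> Basis" for b
    proof -
      have "2 * pi * (\<bar>snd z \<bullet> b\<bar> * norm (stft \<phi> f z)) = norm (stft \<phi> (pd b f) z + stft (pd b \<phi>) f z)"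
        unfolding stft_pd[OF f Suc.prems b] by (simp add: norm_mult inner_commute)
      also have "\<dots> \<le> norm (stft \<phi> (pd b f) z) + norm (stft (pd b \<phi>) f z)" by (rule norm_triangle_ineq)
      finally have "2 * pi * (\<bar>snd z \<bullet> b\<bar> * norm (stft \<phi> f z)) \<le> norm (stft \<phi> (pd b f) z) + norm (stft (pd b \<phi>) f z)" .
      moreover have "1 * (\<bar>snd z \<bullet> b\<bar> * norm (stft \<phi> f z)) \<le> 2 * pi * (\<bar>snd z \<bullet> b\<bar> * norm (stft \<phi> f z))"
        using pi_ge_two by (intro mult_right_mono) auto
      ultimately have "\<bar>snd z \<bullet> b\<bar> * norm (stft \<phi> f z) \<le> norm (stft \<phi> (pd b f) z) + norm (stft (pd b \<phi>) f z)"
        by linarith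
      then have "?w z * (\<bar>snd z \<bullet> b\<bar> * norm (stft \<phi> f z)) \<le> ?w z * norm (stft \<phi> (pd b f) z) + ?w z * norm (stft (pd b \<phi>) f z)"
        using mult_left_mono[OF _ w0] by (simp only: distrib_left[symmetric])
      also have "\<dots> \<le> C0 * (D b * schwartz_seminorm N f) + snd (NC b) * schwartz_seminorm N f"
      proof (intro add_mono)
        have "?w z * norm (stft \<phi> (pd b f) z) \<le> C0 * schwartz_seminorm N0 (pd b f)"
          by (rule N0(2)[OF schwartz_pd[OF f b]])
        also have "\<dots> \<le> C0 * (D b * schwartz_seminorm N f)"
          by (intro mult_left_mono N0 order_trans[OF D(2)[OF b f]] pN D b) (simp add: N_def)
        finally show "?w z * norm (stft \<phi> (pd b f) z) \<le> C0 * (D b * schwartz_seminorm N f)" .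
        have "fst (NC b) \<le> N" unfolding N_def by (rule trans_le_add2, rule member_le_sum) (use b in auto)
        then show "?w z * norm (stft (pd b \<phi>) f z) \<le> snd (NC b) * schwartz_seminorm N f"
          by (intro order_trans[OF NC(2)[OF b f]] mult_left_mono NC(1)[OF b] pN)
      qed
      finally show ?thesis by (simp add: distrib_right)
    qed
    have "norm (snd z) \<le> (\<Sum>b\<in>Basis. \<bar>snd z \<bullet> b\<bar>)" by (rule norm_le_l1)
    then have "(1 + norm (snd z)) * (?w z * norm (stft \<phi> f z)) \<le> (1 + (\<Sum>b\<in>Basis. \<bar>snd z \<bullet> b\<bar>)) * (?w z * norm (stft \<phi> f z))"
      by (intro mult_right_mono) auto
    also have "\<dots> = ?w z * norm (stft \<phi> f z) + (\<Sum>b\<in>Basis. ?w z * (\<bar>snd z \<bullet> b\<bar> * norm (stft \<phi> f z)))"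
      by (simp only: distrib_right mult_1 sum_distrib_right) (simp only: mult_ac)
    also have "\<dots> \<le> C0 * schwartz_seminorm N f + (\<Sum>b\<in>Basis. (C0 * D b + snd (NC b)) * schwartz_seminorm N f)"
      by (intro add_mono sum_mono b order_trans[OF N0(2)[OF f]] mult_left_mono N0 pN) (auto simp: N_def)
    also have "\<dots> = C * schwartz_seminorm N f"
      by (simp add: C_def distrib_right sum_distrib_right)
    finally show ?thesis by (simp add: mult_ac)
  qed
  moreover have "0 \<le> C" unfolding C_def using N0(1) NC(1) D(1) by (intro add_nonneg_nonneg sum_nonneg mult_nonneg_nonneg) auto
  ultimately show ?case by blast
qed

lemma stft_decay:
  fixes \<phi> :: "'a::euclidean_space \<Rightarrow> complex"
  assumes "\<phi> \<in> schwartz"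
  shows "\<exists>N C. C \<ge> 0 \<and> (\<forall>f\<in>schwartz. \<forall>z. (1 + norm z) ^ k * norm (stft \<phi> f z) \<le> C * schwartz_seminorm N f)"
proof -
  obtain N C where C: "C \<ge> 0" "\<And>f z. f \<in> schwartz \<Longrightarrow> (1 + norm (snd z)) ^ k * ((1 + norm (fst z)) ^ k * norm (stft \<phi> f z)) \<le> C * schwartz_seminorm N f"
    using stft_decay2[OF assms] by blast
  have "(1 + norm z) ^ k * norm (stft \<phi> f z) \<le> C * schwartz_seminorm N f" if f: "f \<in> schwartz" for f and z :: "'a \<times> 'a"
  proof -
    have "1 + norm z \<le> (1 + norm (fst z)) * (1 + norm (snd z))"
      using one_plus_norm_add[of "(fst z, 0)" "(0, snd z)"] by (simp add: norm_Pair)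
    then have "(1 + norm z) ^ k * norm (stft \<phi> f z) \<le> ((1 + norm (fst z)) * (1 + norm (snd z))) ^ k * norm (stft \<phi> f z)"
      by (intro mult_right_mono power_mono) auto
    also have "\<dots> \<le> C * schwartz_seminorm N f"
      using C(2)[OF f, of z] by (simp add: power_mult_distrib mult_ac)
    finally show ?thesis .
  qed
  then show ?thesis using C(1) by blast
qed

lemma stft_schwartz_weighted_integrable:
  fixes \<phi> :: "'a::euclidean_space \<Rightarrow> complex"
  assumes "\<phi> \<in> schwartz" "f \<in> schwartz"
  shows "integrable lborel (\<lambda>z. (1 + norm z) ^ k * norm (stft \<phi> f z))"
proof -
  have [measurable]: "stft \<phi> f \<in> borel_measurable borel"
    using assms by (intro stft_measurable schwartz_measurable)
  let ?D = "2 * DIM('a \<times> 'a)"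
  obtain N C where C: "\<And>f z. f \<in> schwartz \<Longrightarrow> (1 + norm z) ^ (?D + k) * norm (stft \<phi> f z) \<le> C * schwartz_seminorm N f"
    using stft_decay[OF assms(1), of "?D + k"] by blast
  have "integrable lborel (\<lambda>z. complex_of_real ((1 + norm z) ^ k * norm (stft \<phi> f z)))"
  proof (rule integrable_decay)
    show "(1 + norm z) ^ ?D * norm (complex_of_real ((1 + norm z) ^ k * norm (stft \<phi> f z))) \<le> C * schwartz_seminorm N f" for z :: "'a \<times> 'a"
      using C[OF assms(2), of z] by (simp only: norm_of_real) (simp add: power_add mult_ac)
  qed measurable
  then show ?thesis by (simp only: complex_of_real_integrable_eq)
qed

lemma stft_schwartz_integrable:
  assumes "\<phi> \<in> schwartz" "f \<in> schwartz"
  shows "integrable lborel (stft \<phi> f)"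
proof -
  have "stft \<phi> f \<in> borel_measurable lborel"
    using stft_measurable[OF schwartz_measurable[OF assms(2)] schwartz_measurable[OF assms(1)]] by simp
  moreover have "integrable lborel (\<lambda>z. norm (stft \<phi> f z))"
    using stft_schwartz_weighted_integrable[OF assms, of 0] by (simp only: power_0 mult_1)
  ultimately show ?thesis by (rule integrable_norm_cancel[rotated])
qed

text \<open>The inclusion of the Schwartz space in \<open>M1\<close> is continuous. This makes
  bounded functionals on \<open>M1\<close> tempered, and turns Lipschitz estimates for shifts in
  Schwartz seminorms into estimates in \<open>M1\<close>.\<close>

lemma M1_norm_seminorm:
  fixes \<phi> :: "'a::euclidean_space \<Rightarrow> complex"
  assumes "\<phi> \<in> schwartz"
  obtains N C where "C \<ge> 0" "\<And>f. f \<in> schwartz \<Longrightarrow> M1_norm \<phi> f \<le> C * schwartz_seminorm N f"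
proof -
  let ?D = "2 * DIM('a \<times> 'a)"
  let ?W = "LINT x|lborel. 1 / (1 + norm (x::'a \<times> 'a)) ^ ?D"
  obtain N C where C: "C \<ge> 0" "\<And>f z. f \<in> schwartz \<Longrightarrow> (1 + norm z) ^ ?D * norm (stft \<phi> f z) \<le> C * schwartz_seminorm N f"
    using stft_decay[OF assms, of ?D] by blast
  have "M1_norm \<phi> f \<le> (C * ?W) * schwartz_seminorm N f" if f: "f \<in> schwartz" for f
  proof -
    have "M1_norm \<phi> f \<le> (LINT z|lborel. C * schwartz_seminorm N f * (1 / (1 + norm (z::'a \<times> 'a)) ^ ?D))"
      unfolding M1_norm_eq[OF assms]
    proof (rule integral_mono')
      show "integrable lborel (\<lambda>z::'a \<times> 'a. C * schwartz_seminorm N f * (1 / (1 + norm z) ^ ?D))"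
        by (intro integrable_mult_right integrable_inverse_weight)
      fix z :: "'a \<times> 'a"
      have "0 < (1 + norm z) ^ ?D" by (simp add: add_pos_nonneg)
      with C(2)[OF f, of z]
      show "norm (stft \<phi> f z) \<le> C * schwartz_seminorm N f * (1 / (1 + norm z) ^ ?D)"
        by (simp add: pos_le_divide_eq mult.commute)
    qed (use schwartz_seminorm_nonneg[OF f] C(1) in auto)
    also have "\<dots> = (C * ?W) * schwartz_seminorm N f" by (subst integral_mult_right_zero) simp
    finally show ?thesis .
  qed
  moreover have "0 \<le> C * ?W" using C(1) by (intro mult_nonneg_nonneg Bochner_Integration.integral_nonneg) auto
  ultimately show ?thesis using that by blast
qed

section \<open>The space \<open>M1\<close>\<close>

lemma M1D:
  assumes "f \<in> M1 \<phi>" "\<phi> \<in> schwartz"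
  shows "continuous_on UNIV f" "f \<in> borel_measurable borel" "integrable lborel (stft \<phi> f)"
    and "\<And>\<psi>. \<psi> \<in> schwartz \<Longrightarrow> integrable lborel (\<lambda>t. f t * cnj (\<psi> t))"
  using assms unfolding M1_def M1_distr_def
  by (auto simp: stft_distr_distr_of borel_measurable_continuous_onI)

text \<open>A bounded function pairs with every Schwartz function and is tempered by the L1
  estimate, so only continuity and integrability of the transform remain to be checked.\<close>

lemma M1I:
  fixes f :: "'a::euclidean_space \<Rightarrow> complex"
  assumes \<phi>: "\<phi> \<in> schwartz" and cont: "continuous_on UNIV f" and B: "\<And>t. norm (f t) \<le> B"
    and int: "integrable lborel (stft \<phi> f)"
  shows "f \<in> M1 \<phi>"
proof -
  have m: "f \<in> borel_measurable borel" using cont by (rule borel_measurable_continuous_onI)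
  have i: "integrable lborel (\<lambda>t. f t * cnj (\<psi> t))" if "\<psi> \<in> schwartz" for \<psi>
    by (rule integrable_bounded_mult[OF m B]) (rule schwartz_integrable[OF schwartz_cnj[OF that]])
  have B0: "0 \<le> B" using order_trans[OF norm_ge_zero B] .
  obtain N C where C: "C \<ge> 0" "\<And>\<psi>::'a \<Rightarrow> complex. \<psi> \<in> schwartz \<Longrightarrow> (LINT t|lborel. norm (\<psi> t)) \<le> C * schwartz_seminorm N \<psi>"
    using schwartz_L1_seminorm by blast
  have "norm (L2_inner f \<psi>) \<le> (B * C) * schwartz_seminorm N \<psi>" if \<psi>: "\<psi> \<in> schwartz" for \<psi>
  proof -
    have "norm (L2_inner f \<psi>) \<le> (LINT t|lborel. B * norm (\<psi> t))"
      unfolding L2_inner_def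
      by (rule norm_integral_le) (use B schwartz_integrable[OF \<psi>] in \<open>auto simp: norm_mult intro!: mult_right_mono\<close>)
    also have "\<dots> \<le> B * (C * schwartz_seminorm N \<psi>)"
      by (simp add: mult_left_mono[OF C(2)[OF \<psi>] B0])
    finally show ?thesis by simp
  qed
  then have "distr_of f \<in> tempered"
    unfolding tempered_def distr_of_def
    by (auto simp: schwartz_add schwartz_cmult L2_inner_def distrib_left i mult.left_commute[of "f _"])
  with cont i int show ?thesis
    unfolding M1_def M1_distr_def by (auto simp: stft_distr_distr_of \<phi>)
qed

lemma schwartz_M1:
  assumes "\<phi> \<in> schwartz" "f \<in> schwartz"
  shows "f \<in> M1 \<phi>"
proof -
  obtain B where "\<And>t. norm (f t) \<le> B" using schwartz_bounded[OF assms(2)] by blast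
  with assms show ?thesis
    by (intro M1I stft_schwartz_integrable schwartz_continuous)
qed

section \<open>The reconstruction formula and its converse\<close>

definition window_sq :: "('a::euclidean_space \<Rightarrow> complex) \<Rightarrow> real" where
  "window_sq \<phi> = (LINT t|lborel. (norm (\<phi> t))\<^sup>2)"

lemma schwartz_sq_integrable:
  assumes "\<phi> \<in> schwartz"
  shows "integrable lborel (\<lambda>t. (norm (\<phi> t))\<^sup>2)"
proof -
  obtain B where "\<And>x. norm (\<phi> x) \<le> B" using schwartz_bounded[OF assms] by blast
  then have "integrable lborel (\<lambda>t. norm (\<phi> t * cnj (\<phi> t)))"
    by (intro integrable_norm integrable_bounded_mult[of \<phi> B] schwartz_integrable schwartz_cnj assms schwartz_measurable)
  then show ?thesis by (simp add: norm_mult power2_eq_square)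
qed

text \<open>A nonzero continuous window is nonzero on a nonempty open set, which is not negligible.
  Reconstruction divides by this constant.\<close>

lemma window_sq_pos:
  fixes \<phi> :: "'a::euclidean_space \<Rightarrow> complex"
  assumes "\<phi> \<in> schwartz" "\<phi> \<noteq> (\<lambda>_. 0)"
  shows "window_sq \<phi> > 0"
proof (rule ccontr)
  assume "\<not> window_sq \<phi> > 0"
  moreover have "window_sq \<phi> \<ge> 0" unfolding window_sq_def by simp
  ultimately have "AE t in lborel. (norm (\<phi> t))\<^sup>2 = 0"
    using integral_nonneg_eq_0_iff_AE[OF schwartz_sq_integrable[OF assms(1)]] unfolding window_sq_def by auto
  then have ae: "AE t in lborel. \<phi> t = 0" by simp
  have op: "open {t. \<phi> t \<noteq> 0}"
    using schwartz_continuous[OF assms(1)] by (intro open_Collect_neq) (auto intro: continuous_intros)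
  then have "{t \<in> space lborel. \<not> \<phi> t = 0} \<in> null_sets lborel"
    using ae by (subst AE_iff_null[symmetric]) auto
  then have "{t. \<phi> t \<noteq> 0} \<in> null_sets lborel" by simp
  moreover note op
  moreover have "{t. \<phi> t \<noteq> 0} \<noteq> {}" using assms(2) by (auto simp: fun_eq_iff)
  ultimately show False
    using open_not_negligible negligible_iff_null_sets null_sets_completionI by blast
qed

lemma integrable_stft_tfs:
  assumes "\<phi> \<in> schwartz" "\<eta> \<in> schwartz" "f \<in> M1 \<phi>"
  shows "integrable lborel (\<lambda>w. stft \<phi> f w * tfs w \<eta> t)"
proof -
  obtain B where B: "\<And>x. norm (\<eta> x) \<le> B" using schwartz_bounded[OF assms(2)] by blast
  have "integrable lborel (\<lambda>w. tfs w \<eta> t * stft \<phi> f w)"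
    by (rule integrable_bounded_mult[of _ B])
      (use B M1D(3)[OF assms(3,1)] schwartz_measurable[OF assms(2)] in \<open>auto simp: norm_tfs intro!: measurable_tfs_comp\<close>)
  then show ?thesis by (simp add: mult.commute)
qed

text \<open>For almost every \<open>x\<close> the slice \<open>stft \<phi> f (x, _)\<close> is an integrable Fourier transform of
  \<open>t \<mapsto> f t * cnj (\<phi> (t - x))\<close>; invert it, multiply by \<open>\<phi> (t - x)\<close> and integrate over \<open>x\<close>.\<close>

lemma M1_reconstruction:
  fixes \<phi> :: "'a::euclidean_space \<Rightarrow> complex"
  assumes \<phi>: "\<phi> \<in> schwartz" and f: "f \<in> M1 \<phi>"
  shows "(LINT w|lborel. stft \<phi> f w * tfs w \<phi> t) = of_real (window_sq \<phi>) * f t"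
proof -
  note i = integrable_stft_tfs[OF \<phi> \<phi> f, of t]
  have [measurable]: "\<phi> \<in> borel_measurable borel" by (rule schwartz_measurable[OF \<phi>])
  have "(LINT w|lborel. stft \<phi> f w * tfs w \<phi> t) = (LINT x|lborel. LINT \<omega>|lborel. stft \<phi> f (x, \<omega>) * tfs (x, \<omega>) \<phi> t)"
    by (rule lborel_pair_integral[OF i, symmetric])
  also have "\<dots> = (LINT x|lborel. f t * of_real ((norm (\<phi> (t - x)))\<^sup>2))"
  proof (rule integral_cong_AE)
    have "AE x in lborel. integrable lborel (\<lambda>\<omega>. stft \<phi> f (x, \<omega>))"
      using lborel_pair.AE_integrable_fst'[of "stft \<phi> f"] M1D(3)[OF f \<phi>] by (simp add: lborel_prod)
    then show "AE x in lborel. (LINT \<omega>|lborel. stft \<phi> f (x, \<omega>) * tfs (x, \<omega>) \<phi> t) = f t * of_real ((norm (\<phi> (t - x)))\<^sup>2)"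
    proof eventually_elim
      case (elim x)
      let ?h = "\<lambda>s. f s * cnj (\<phi> (s - x))"
      have h: "tfs (x, 0) \<phi> s = \<phi> (s - x)" for s by (simp add: tfs_apply)
      have H: "(LINT s|lborel. ?h s * cis (- (2 * pi * (s \<bullet> \<omega>)))) = stft \<phi> f (x, \<omega>)" for \<omega>
        unfolding stft_eq tfs_apply by (simp add: cis_cnj mult_ac)
      have "?h t = (LINT \<omega>|lborel. (LINT s|lborel. ?h s * cis (- (2 * pi * (s \<bullet> \<omega>)))) * cis (2 * pi * (t \<bullet> \<omega>)))"
      proof (rule fourier_inversion)
        show "integrable lborel ?h" using M1D(4)[OF f \<phi> schwartz_tfs[OF \<phi>, of "(x, 0)"]] by (simp add: h)
        show "continuous_on UNIV ?h"
          using M1D(1)[OF f \<phi>] schwartz_continuous[OF schwartz_tfs[OF \<phi>, of "(x, 0)"]]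
          by (intro continuous_intros) (simp_all add: h[abs_def])
        show "integrable lborel (\<lambda>\<omega>. LINT s|lborel. ?h s * cis (- (2 * pi * (s \<bullet> \<omega>))))"
          using elim by (simp add: H)
      qed
      then have "(LINT \<omega>|lborel. stft \<phi> f (x, \<omega>) * cis (2 * pi * (t \<bullet> \<omega>))) * \<phi> (t - x) = ?h t * \<phi> (t - x)"
        unfolding H by simp
      moreover have "(LINT \<omega>|lborel. stft \<phi> f (x, \<omega>) * tfs (x, \<omega>) \<phi> t) = (LINT \<omega>|lborel. (stft \<phi> f (x, \<omega>) * cis (2 * pi * (t \<bullet> \<omega>))) * \<phi> (t - x))"
        by (simp add: tfs_apply mult.assoc)
      ultimately have "(LINT \<omega>|lborel. stft \<phi> f (x, \<omega>) * tfs (x, \<omega>) \<phi> t) = ?h t * \<phi> (t - x)"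
        by (simp only: integral_mult_left_zero)
      moreover have "complex_of_real ((norm (\<phi> (t - x)))\<^sup>2) = cnj (\<phi> (t - x)) * \<phi> (t - x)"
        unfolding complex_norm_square by (rule mult.commute)
      ultimately show ?case by (simp only: mult.assoc)
    qed
    show "(\<lambda>x. LINT \<omega>|lborel. stft \<phi> f (x, \<omega>) * tfs (x, \<omega>) \<phi> t) \<in> borel_measurable lborel"
      using lborel_pair.integrable_fst'[of "\<lambda>w. stft \<phi> f w * tfs w \<phi> t"] i by (auto simp: lborel_prod)
  qed measurable
  also have "\<dots> = f t * (LINT x|lborel. of_real ((norm (\<phi> (t - x)))\<^sup>2))" by simp
  also have "(LINT x|lborel. complex_of_real ((norm (\<phi> (t - x)))\<^sup>2)) = of_real (window_sq \<phi>)"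
  proof -
    have "(LINT s|lborel. complex_of_real ((norm (\<phi> s))\<^sup>2)) = of_real (\<bar>-1\<bar> ^ DIM('a)) * (LINT x|lborel. complex_of_real ((norm (\<phi> (t + (-1) *\<^sub>R x)))\<^sup>2))"
      by (rule integral_scale) auto
    then show ?thesis unfolding window_sq_def by (simp del: of_real_power)
  qed
  finally show ?thesis by simp
qed

text \<open>Fubini computes the transform of the superposition, and translation invariance gives
  every shift of \<eta> the same norm, so the L1 norm of F controls the result. The map h is free
  because operators on \<open>M1\<close> relabel the shifts; \<eta> may differ from \<phi> because
  they also change the function being shifted.\<close>

lemma synthesis:
  fixes F :: "'b::euclidean_space \<Rightarrow> complex" and h :: "'b \<Rightarrow> 'a::euclidean_space \<times> 'a"
  assumes \<phi>: "\<phi> \<in> schwartz" and \<eta>: "\<eta> \<in> schwartz" and F: "integrable lborel F" and h: "h \<in> borel_measurable borel"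
  defines "f \<equiv> \<lambda>t. LINT w|lborel. F w * tfs (h w) \<eta> t"
  shows "f \<in> M1 \<phi>" and "M1_norm \<phi> f \<le> (LINT w|lborel. norm (F w)) * M1_norm \<phi> \<eta>"
    and "stft \<phi> f z = (LINT w|lborel. F w * stft \<phi> (tfs (h w) \<eta>) z)"
proof -
  have Fm[measurable]: "F \<in> borel_measurable borel" using F by auto
  note [measurable] = h
  have \<eta>m[measurable]: "\<eta> \<in> borel_measurable borel" by (rule schwartz_measurable[OF \<eta>])
  have \<phi>m[measurable]: "\<phi> \<in> borel_measurable borel" by (rule schwartz_measurable[OF \<phi>])
  have Vm[measurable]: "stft \<phi> \<eta> \<in> borel_measurable borel" by (intro stft_measurable \<eta>m \<phi>m)
  obtain B where B: "\<And>x. norm (\<eta> x) \<le> B" using schwartz_bounded[OF \<eta>] by blast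
  have le: "norm (F w * tfs (h w) \<eta> t) \<le> norm (F w) * B" for w t
    unfolding norm_mult by (intro mult_left_mono) (auto simp: norm_tfs B)
  have m1[measurable]: "(\<lambda>w. F w * tfs (h w) \<eta> t) \<in> borel_measurable borel" for t
    by (intro borel_measurable_times Fm measurable_tfs_comp \<eta>m h) auto
  have cont: "continuous_on UNIV f"
    unfolding f_def
    by (rule continuous_on_integral[where G = "\<lambda>w. norm (F w) * B"])
      (intro continuous_intros schwartz_continuous[OF schwartz_tfs[OF \<eta>]], use F m1 le in auto)
  have bdd: "norm (f t) \<le> (LINT w|lborel. norm (F w) * B)" for t
    unfolding f_def by (rule norm_integral_le) (use F le in auto)
  show stft: "stft \<phi> f z = (LINT w|lborel. F w * stft \<phi> (tfs (h w) \<eta>) z)" for z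
  proof -
    let ?g = "\<lambda>w t. (F w * tfs (h w) \<eta> t) * cnj (tfs z \<phi> t)"
    have gi: "integrable lborel (\<lambda>(w, t). ?g w t)"
    proof (rule Bochner_Integration.integrable_bound)
      show "integrable lborel (\<lambda>(w, t). (of_real B * F w) * cnj (tfs z \<phi> t))"
        by (intro lborel_pair_integrable_mult integrable_mult_right F schwartz_integrable schwartz_cnj schwartz_tfs \<phi>)
      show "(\<lambda>(w, t). ?g w t) \<in> borel_measurable lborel"
        unfolding case_prod_beta measurable_lborel1
        by (intro borel_measurable_times measurable_compose[OF _ measurable_cnj] measurable_tfs_comp) measurable
      have B0: "0 \<le> B" using order_trans[OF norm_ge_zero B] .
      have "norm (?g w t) \<le> norm ((of_real B * F w) * cnj (tfs z \<phi> t))" for w t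
      proof -
        have "norm (?g w t) \<le> (norm (F w) * B) * norm (cnj (tfs z \<phi> t))"
          unfolding norm_mult[of "F w * tfs (h w) \<eta> t"] by (intro mult_right_mono le) auto
        also have "\<dots> = norm ((of_real B * F w) * cnj (tfs z \<phi> t))"
          using B0 by (simp add: norm_mult)
        finally show ?thesis .
      qed
      then show "AE x in lborel. norm (case x of (w, t) \<Rightarrow> ?g w t) \<le> norm (case x of (w, t) \<Rightarrow> (of_real B * F w) * cnj (tfs z \<phi> t))"
        by (auto intro!: AE_I2)
    qed
    have "stft \<phi> f z = (LINT t|lborel. LINT w|lborel. ?g w t)"
      unfolding stft_eq f_def by simp
    also have "\<dots> = (LINT w|lborel. LINT t|lborel. ?g w t)"
      by (rule lborel_pair_swap[OF gi, symmetric])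
    also have "\<dots> = (LINT w|lborel. F w * stft \<phi> (tfs (h w) \<eta>) z)"
      unfolding stft_eq by (simp add: mult.assoc)
    finally show ?thesis .
  qed
  let ?k = "\<lambda>w z. F w * stft \<phi> (tfs (h w) \<eta>) z"
  have Vtr: "(LINT z|lborel. norm (stft \<phi> \<eta> (z - w))) = M1_norm \<phi> \<eta>" for w
    using integral_translate[of "\<lambda>z. norm (stft \<phi> \<eta> z)" "- w"] by (simp add: M1_norm_eq[OF \<phi>])
  have ki: "integrable lborel (\<lambda>(w, z). ?k w z)"
  proof (rule lborel_pair_integrableI)
    show "(\<lambda>(w, z). ?k w z) \<in> borel_measurable borel"
      unfolding stft_tfs[OF \<eta> \<phi>] case_prod_beta by measurable
    show "integrable lborel (?k w)" for w
      by (intro integrable_mult_right stft_schwartz_integrable schwartz_tfs \<eta> \<phi>)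
    show "integrable lborel (\<lambda>w. LINT z|lborel. norm (?k w z))"
      using F by (simp add: norm_mult norm_stft_tfs \<eta> \<phi> Vtr)
  qed
  have ki': "integrable lborel (\<lambda>(z, w). ?k w z)"
    using lborel_pair.integrable_product_swap[of "\<lambda>(w, z). ?k w z"] ki by (simp add: lborel_prod)
  then have "integrable lborel (\<lambda>z. LINT w|lborel. ?k w z)"
    using lborel_pair.integrable_fst'[of "\<lambda>(z, w). ?k w z"] by (simp add: lborel_prod)
  then have i: "integrable lborel (stft \<phi> f)" by (simp add: stft[abs_def])
  show "f \<in> M1 \<phi>" by (rule M1I[OF \<phi> cont bdd i])
  \<comment> \<open>\<open>lborel_pair_swap\<close> concerns complex integrands, so the real norm is
    embedded in the complex numbers for the last computation.\<close>
  have kn: "integrable lborel (\<lambda>(w, z). complex_of_real (norm (?k w z)))"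
    using integrable_norm[OF ki] unfolding case_prod_beta complex_of_real_integrable_eq .
  have kn': "integrable lborel (\<lambda>(z, w). norm (?k w z))"
    using integrable_norm[OF ki'] unfolding case_prod_beta .
  have "M1_norm \<phi> f \<le> (LINT z|lborel. LINT w|lborel. norm (?k w z))"
    unfolding M1_norm_eq[OF \<phi>]
  proof (rule integral_mono)
    show "integrable lborel (\<lambda>z. norm (stft \<phi> f z))" using i by simp
    show "integrable lborel (\<lambda>z. LINT w|lborel. norm (?k w z))"
      using lborel_pair.integrable_fst'[of "\<lambda>(z, w). norm (?k w z)"] kn' by (simp add: lborel_prod)
    show "norm (stft \<phi> f z) \<le> (LINT w|lborel. norm (?k w z))" for z
      unfolding stft by (rule integral_norm_bound)
  qed
  also have "(LINT z|lborel. LINT w|lborel. norm (?k w z)) = (LINT w|lborel. LINT z|lborel. norm (?k w z))"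
    using lborel_pair_swap[OF kn] unfolding integral_complex_of_real of_real_eq_iff by simp
  also have "\<dots> = (LINT w|lborel. norm (F w)) * M1_norm \<phi> \<eta>"
    by (simp add: norm_mult norm_stft_tfs \<eta> \<phi> Vtr)
  finally show "M1_norm \<phi> f \<le> (LINT w|lborel. norm (F w)) * M1_norm \<phi> \<eta>" .
qed

section \<open>Tempered distributions and superpositions\<close>

lemma partials_sum:
  assumes "\<And>i. i \<in> I \<Longrightarrow> g i \<in> schwartz" "set bs \<subseteq> Basis"
  shows "partials bs (\<lambda>t. \<Sum>i\<in>I. c i * g i t) = (\<lambda>t. \<Sum>i\<in>I. c i * partials bs (g i) t)"
  using assms(1)
proof (induction I rule: infinite_finite_induct)
  case (insert i I)
  then show ?case
    using assms(2) by (simp add: partials_add partials_cmult schwartz_cmult schwartz_sum)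
next
  case (infinite I)
  then show ?case using partials_cmult[OF schwartz_0 assms(2), of 0] by simp
next
  case empty
  then show ?case using partials_cmult[OF schwartz_0 assms(2), of 0] by simp
qed

lemma temperedD:
  assumes "u \<in> tempered"
  shows "f \<notin> schwartz \<Longrightarrow> u f = 0"
    and "f \<in> schwartz \<Longrightarrow> g \<in> schwartz \<Longrightarrow> u (\<lambda>x. f x + g x) = u f + u g"
    and "f \<in> schwartz \<Longrightarrow> u (\<lambda>x. c * f x) = cnj c * u f"
  using assms unfolding tempered_def by auto

lemma tempered_bound:
  assumes "u \<in> tempered"
  shows "\<exists>N C. C \<ge> 0 \<and> (\<forall>f\<in>schwartz. norm (u f) \<le> C * schwartz_seminorm N f)"
proof -
  obtain N C where C: "\<forall>f\<in>schwartz. norm (u f) \<le> C * schwartz_seminorm N f"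
    using assms unfolding tempered_def by auto
  have "norm (u f) \<le> \<bar>C\<bar> * schwartz_seminorm N f" if "f \<in> schwartz" for f
    using C that mult_right_mono[OF abs_ge_self schwartz_seminorm_nonneg[OF that], of C N] by fastforce
  then show ?thesis by (intro exI[of _ N] exI[of _ "\<bar>C\<bar>"]) auto
qed

lemma tempered_0: "u \<in> tempered \<Longrightarrow> u (\<lambda>x. 0) = 0"
  using temperedD(3)[OF _ schwartz_0, of u 0] by simp

lemma tempered_diff:
  assumes "u \<in> tempered" "f \<in> schwartz" "g \<in> schwartz"
  shows "u (\<lambda>x. f x - g x) = u f - u g"
  using temperedD(2)[OF assms(1,2) schwartz_uminus[OF assms(3)]] temperedD(3)[OF assms(1,3), of "-1"] by simp

lemma tempered_sum:
  assumes "u \<in> tempered" "\<And>i. i \<in> I \<Longrightarrow> g i \<in> schwartz"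
  shows "u (\<lambda>t. \<Sum>i\<in>I. c i * g i t) = (\<Sum>i\<in>I. cnj (c i) * u (g i))"
  using assms(2)
proof (induction I rule: infinite_finite_induct)
  case (insert i I)
  have "u (\<lambda>t. \<Sum>i\<in>insert i I. c i * g i t) = u (\<lambda>t. c i * g i t + (\<Sum>i\<in>I. c i * g i t))"
    using insert by simp
  also have "\<dots> = u (\<lambda>t. c i * g i t) + u (\<lambda>t. \<Sum>i\<in>I. c i * g i t)"
    using insert by (intro temperedD(2)[OF assms(1)] schwartz_cmult schwartz_sum) auto
  finally show ?case
    using insert by (simp add: temperedD(3)[OF assms(1)])
qed (simp_all add: tempered_0 assms(1))

text \<open>A simple parameter takes finitely many values, so the integral becomes a finite sum over
  its level sets, to which an antilinear functional can be applied term by term.\<close>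

lemma integral_mult_simple:
  fixes F :: "'b::euclidean_space \<Rightarrow> complex"
  assumes s: "simple_function lborel s" and F: "integrable lborel F"
  shows "(LINT w|lborel. F w * g (s w)) = (\<Sum>v\<in>range s. (LINT w|lborel. indicat_real (s -` {v}) w *\<^sub>R F w) * g v)"
proof -
  have fin: "finite (range s)" using simple_functionD(1)[OF s] by simp
  have eq: "F w * g (s w) = (\<Sum>v\<in>range s. (indicat_real (s -` {v}) w *\<^sub>R F w) * g v)" for w
  proof -
    have "(\<Sum>v\<in>range s. (indicat_real (s -` {v}) w *\<^sub>R F w) * g v) = (\<Sum>v\<in>range s. if v = s w then F w * g v else 0)"
      by (intro sum.cong) (auto simp: indicator_def)
    then show ?thesis using fin by simp
  qed
  have i: "integrable lborel (\<lambda>w. indicat_real (s -` {v}) w *\<^sub>R F w)" for v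
    using simple_functionD(2)[OF s, of "{v}"] by (intro integrable_mult_indicator F) simp
  have "(LINT w|lborel. F w * g (s w)) = (\<Sum>v\<in>range s. LINT w|lborel. (indicat_real (s -` {v}) w *\<^sub>R F w) * g v)"
    unfolding eq by (rule Bochner_Integration.integral_sum) (intro integrable_mult_left i)
  then show ?thesis by (simp only: integral_mult_left_zero)
qed

lemma moment_integrable:
  fixes F :: "'a::euclidean_space \<Rightarrow> complex"
  assumes "F \<in> borel_measurable borel" "integrable lborel (\<lambda>w. (1 + norm w) ^ 0 * norm (F w))"
  shows "integrable lborel F"
proof (rule integrable_norm_cancel)
  show "integrable lborel (\<lambda>w. norm (F w))" using assms(2) by (simp only: power_0 mult_1)
qed (use assms(1) in simp)

section \<open>Superpositions whose coefficients have all moments\<close>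

context
  fixes \<eta> :: "'a::euclidean_space \<Rightarrow> complex" and F :: "'a \<times> 'a \<Rightarrow> complex"
  assumes \<eta>: "\<eta> \<in> schwartz" and F: "F \<in> borel_measurable borel"
    and moments: "\<And>k. integrable lborel (\<lambda>w. (1 + norm w) ^ k * norm (F w))"
begin

text \<open>Derivatives of shifts grow polynomially in w, so one moment of F supplies the majorant.
  Having all moments covers every derivative.\<close>

lemma superposition_bound:
  assumes "set cs \<subseteq> Basis"
  shows "\<exists>G. integrable lborel G \<and> (\<forall>w\<in>space lborel. \<forall>t. norm (F w * partials cs (tfs w \<eta>) t) \<le> G w)"
proof -
  obtain C M where CM: "\<And>z t. (1 + norm t) ^ 0 * norm (partials cs (tfs z \<eta>) t) \<le> C * (1 + norm z) ^ M"
    using tfs_partials_bound[OF \<eta> assms, of 0] by blast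
  have "norm (F w * partials cs (tfs w \<eta>) t) \<le> C * ((1 + norm w) ^ M * norm (F w))" for w t
    using mult_left_mono[OF CM[of t w] norm_ge_zero[of "F w"]] by (simp add: norm_mult mult_ac)
  then show ?thesis
    by (intro exI[of _ "\<lambda>w. C * ((1 + norm w) ^ M * norm (F w))"] conjI integrable_mult_right moments) auto
qed

lemma partials_superposition:
  assumes "set bs \<subseteq> Basis"
  shows "partials bs (\<lambda>t. LINT w|lborel. F w * tfs w \<eta> t) = (\<lambda>t. LINT w|lborel. F w * partials bs (tfs w \<eta>) t)"
  by (rule partials_integral) (use F \<eta> assms superposition_bound in \<open>auto intro!: schwartz_tfs tfs_partials_measurable\<close>)

lemma superposition_partials_integrable:
  assumes "set bs \<subseteq> Basis"
  shows "integrable lborel (\<lambda>w. F w * partials bs (tfs w \<eta>) t)"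
proof -
  obtain G where G: "integrable lborel G" "\<And>w t. norm (F w * partials bs (tfs w \<eta>) t) \<le> G w"
    using superposition_bound[OF assms] by auto
  note [measurable] = F tfs_partials_measurable[OF \<eta> assms]
  show ?thesis
    by (rule Bochner_Integration.integrable_bound[OF G(1)])
      (auto intro!: AE_I2 order_trans[OF G(2)] abs_ge_self)
qed

lemma superposition_schwartz: "(\<lambda>t. LINT w|lborel. F w * tfs w \<eta> t) \<in> schwartz"
  unfolding schwartz_def smooth_def mem_Collect_eq
proof (intro conjI allI impI)
  fix bs :: "'a list" and x assume bs: "set bs \<subseteq> Basis"
  have "((\<lambda>t. LINT w|lborel. F w * partials bs (tfs w \<eta>) t) has_derivative
      (\<lambda>h. LINT w|lborel. F w * (\<Sum>b\<in>Basis. (h \<bullet> b) *\<^sub>R partials (b # bs) (tfs w \<eta>) x))) (at x)"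
    by (rule has_derivative_integral_partials)
      (use F \<eta> bs superposition_bound in \<open>auto intro!: schwartz_tfs tfs_partials_measurable simp del: partials.simps\<close>)
  then show "partials bs (\<lambda>t. LINT w|lborel. F w * tfs w \<eta> t) differentiable at x"
    unfolding partials_superposition[OF bs] differentiable_def by blast
next
  fix bs :: "'a list" and N assume bs: "set bs \<subseteq> Basis"
  obtain C M where CM: "\<And>z t. (1 + norm t) ^ N * norm (partials bs (tfs z \<eta>) t) \<le> C * (1 + norm z) ^ M"
    using tfs_partials_bound[OF \<eta> bs, of N] by blast
  have "(1 + norm t) ^ N * norm (LINT w|lborel. F w * partials bs (tfs w \<eta>) t) \<le> (LINT w|lborel. C * ((1 + norm w) ^ M * norm (F w)))" for t
  proof -
    have n: "norm (complex_of_real ((1 + norm t) ^ N)) = (1 + norm t) ^ N" by (simp only: norm_of_real) simp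
    have "norm (LINT w|lborel. of_real ((1 + norm t) ^ N) * (F w * partials bs (tfs w \<eta>) t)) \<le> (LINT w|lborel. C * ((1 + norm w) ^ M * norm (F w)))"
    proof (rule norm_integral_le)
      show "integrable lborel (\<lambda>w. C * ((1 + norm w) ^ M * norm (F w)))" by (intro integrable_mult_right moments)
      show "norm (of_real ((1 + norm t) ^ N) * (F w * partials bs (tfs w \<eta>) t)) \<le> C * ((1 + norm w) ^ M * norm (F w))" for w
        using mult_left_mono[OF CM[of t w] norm_ge_zero[of "F w"]] by (simp only: norm_mult n mult_ac)
    qed
    then show ?thesis by (simp only: integral_mult_right_zero norm_mult n)
  qed
  then show "\<exists>C. \<forall>x. (1 + norm x) ^ N * norm (partials bs (\<lambda>t. LINT w|lborel. F w * tfs w \<eta> t) x) \<le> C"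
    unfolding partials_superposition[OF bs] by blast
qed

end

text \<open>A tempered u is bounded by one Schwartz seminorm, so the growth and Lipschitz estimates
  for shifts in that seminorm pass to \<open>u (tfs z \<eta>)\<close>.\<close>

lemma
  fixes \<eta> :: "'a::euclidean_space \<Rightarrow> complex"
  assumes u: "u \<in> tempered" and \<eta>: "\<eta> \<in> schwartz"
  shows isCont_tempered_tfs: "isCont (\<lambda>z. u (tfs z \<eta>)) z"
    and tempered_tfs_measurable: "(\<lambda>z. u (tfs z \<eta>)) \<in> borel_measurable borel"
    and tempered_tfs_bound: "\<exists>C M. C \<ge> 0 \<and> (\<forall>z. norm (u (tfs z \<eta>)) \<le> C * (1 + norm z) ^ M)"
proof -
  obtain N K where K: "K \<ge> 0" "\<And>f. f \<in> schwartz \<Longrightarrow> norm (u f) \<le> K * schwartz_seminorm N f"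
    using tempered_bound[OF u] by blast
  obtain C M where CM: "C \<ge> 0" "\<And>z w. schwartz_seminorm N (\<lambda>t. tfs z \<eta> t - tfs w \<eta> t) \<le> C * ((1 + norm z) * (1 + norm w)) ^ M * norm (z - w)"
    using schwartz_seminorm_tfs_lipschitz[OF \<eta>, of N] by blast
  have "norm (u (tfs z \<eta>) - u (tfs w \<eta>)) \<le> (K * C) * ((1 + norm z) * (1 + norm w)) ^ M * norm (z - w)" for z w
  proof -
    have "norm (u (tfs z \<eta>) - u (tfs w \<eta>)) \<le> K * schwartz_seminorm N (\<lambda>t. tfs z \<eta> t - tfs w \<eta> t)"
      unfolding tempered_diff[OF u schwartz_tfs[OF \<eta>] schwartz_tfs[OF \<eta>], symmetric]
      by (intro K(2) schwartz_diff schwartz_tfs \<eta>)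
    also have "\<dots> \<le> K * (C * ((1 + norm z) * (1 + norm w)) ^ M * norm (z - w))"
      by (intro mult_left_mono K CM)
    finally show ?thesis by (simp only: mult.assoc)
  qed
  then show c: "isCont (\<lambda>z. u (tfs z \<eta>)) z" for z by (rule isCont_of_weighted_lipschitz)
  show "(\<lambda>z. u (tfs z \<eta>)) \<in> borel_measurable borel"
    by (intro borel_measurable_continuous_onI continuous_at_imp_continuous_on ballI c)
  obtain D L where D: "D \<ge> 0" "\<And>z. schwartz_seminorm N (tfs z \<eta>) \<le> D * (1 + norm z) ^ L"
    using schwartz_seminorm_tfs_bound[OF \<eta>, of N] by blast
  have "norm (u (tfs z \<eta>)) \<le> (K * D) * (1 + norm z) ^ L" for z
    using order_trans[OF K(2)[OF schwartz_tfs[OF \<eta>]] mult_left_mono[OF D(2) K(1)], of z] by (simp only: mult.assoc)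
  then show "\<exists>C M. C \<ge> 0 \<and> (\<forall>z. norm (u (tfs z \<eta>)) \<le> C * (1 + norm z) ^ M)"
    using K(1) D(1) by (intro exI[of _ "K * D"] exI[of _ L]) auto
qed

text \<open>The superposition is approximated by finite sums of time-frequency shifts along simple functions
  converging to the identity; the Lipschitz estimate makes this converge in every Schwartz seminorm.\<close>

lemma tempered_superposition:
  fixes \<eta> :: "'a::euclidean_space \<Rightarrow> complex" and F :: "'a \<times> 'a \<Rightarrow> complex"
  assumes u: "u \<in> tempered" and \<eta>: "\<eta> \<in> schwartz" and F: "F \<in> borel_measurable borel"
    and moments: "\<And>k. integrable lborel (\<lambda>w. (1 + norm w) ^ k * norm (F w))"
  shows "u (\<lambda>t. LINT w|lborel. F w * tfs w \<eta> t) = (LINT w|lborel. cnj (F w) * u (tfs w \<eta>))"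
proof -
  define f where "f = (\<lambda>t. LINT w|lborel. F w * tfs w \<eta> t)"
  note [measurable] = F
  have FI: "integrable lborel F" by (rule moment_integrable[OF F moments])
  have fS: "f \<in> schwartz" unfolding f_def by (rule superposition_schwartz[OF \<eta> F moments])
  \<comment> \<open>The bound by twice the distance from 0 keeps \<open>s i w\<close> comparable to
    w, so that polynomial bounds at \<open>s i w\<close> are dominated by moments of F uniformly in
    i.\<close>
  obtain s :: "nat \<Rightarrow> 'a \<times> 'a \<Rightarrow> 'a \<times> 'a" where s: "\<And>i. simple_function lborel (s i)"
      "\<And>w. (\<lambda>i. s i w) \<longlonglongrightarrow> w" "\<And>i w. dist (s i w) 0 \<le> 2 * dist w 0"
    using borel_measurable_implies_sequence_metric[of "\<lambda>w::'a\<times>'a. w" lborel 0] by auto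
  have sm[measurable]: "s i \<in> borel_measurable borel" for i
    using borel_measurable_simple_function[OF s(1)[of i]] by simp
  have sn: "1 + norm (s i w) \<le> 2 * (1 + norm w)" for i w
    using s(3)[of i w] by simp
  define f' where "f' i t = (LINT w|lborel. F w * tfs (s i w) \<eta> t)" for i t
  let ?c = "\<lambda>i v. LINT w|lborel. indicat_real (s i -` {v}) w *\<^sub>R F w"
  have f'_sum: "f' i = (\<lambda>t. \<Sum>v\<in>range (s i). ?c i v * tfs v \<eta> t)" for i
    unfolding f'_def[abs_def] using integral_mult_simple[OF s(1) FI, of "\<lambda>v. tfs v \<eta> _"] by simp
  have f'S: "f' i \<in> schwartz" for i
    unfolding f'_sum by (intro schwartz_sum schwartz_cmult schwartz_tfs \<eta>)
  have u_f': "u (f' i) = (LINT w|lborel. cnj (F w) * u (tfs (s i w) \<eta>))" for i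
  proof -
    have "u (f' i) = (\<Sum>v\<in>range (s i). cnj (?c i v) * u (tfs v \<eta>))"
      unfolding f'_sum by (rule tempered_sum[OF u]) (rule schwartz_tfs[OF \<eta>])
    \<comment> \<open>u is antilinear while \<open>integral_mult_simple\<close> is a linear formula;
      conjugating twice reconciles them.\<close>
    also have "\<dots> = cnj (\<Sum>v\<in>range (s i). ?c i v * cnj (u (tfs v \<eta>)))" by simp
    also have "\<dots> = cnj (LINT w|lborel. F w * cnj (u (tfs (s i w) \<eta>)))"
      using integral_mult_simple[OF s(1) FI, of "\<lambda>v. cnj (u (tfs v \<eta>))"] by simp
    also have "\<dots> = (LINT w|lborel. cnj (F w * cnj (u (tfs (s i w) \<eta>))))"
      by (rule Bochner_Integration.integral_cnj[symmetric])
    finally show ?thesis by simp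
  qed
  obtain N K where K: "K \<ge> 0" "\<And>f. f \<in> schwartz \<Longrightarrow> norm (u f) \<le> K * schwartz_seminorm N f"
    using tempered_bound[OF u] by blast
  obtain C M where CM: "C \<ge> 0" "\<And>z w. schwartz_seminorm N (\<lambda>t. tfs z \<eta> t - tfs w \<eta> t) \<le> C * ((1 + norm z) * (1 + norm w)) ^ M * norm (z - w)"
    using schwartz_seminorm_tfs_lipschitz[OF \<eta>, of N] by blast
  \<comment> \<open>\<open>?e i w\<close> bounds the error made at w, measured in the seminorm that
    controls u. In its majorant \<open>?G\<close> the exponent 2 * M + 1 counts the two weights and
    the factor \<open>norm (w - s i w)\<close>, which is at most 3 * norm w.\<close>
  let ?e = "\<lambda>i w. norm (F w) * (C * ((1 + norm w) * (1 + norm (s i w))) ^ M * norm (w - s i w))"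
  let ?G = "\<lambda>w. (3 * C * 2 ^ M) * ((1 + norm w) ^ (2 * M + 1) * norm (F w))"
  have eG: "norm (?e i w) \<le> ?G w" for i w
  proof -
    have "?e i w \<le> norm (F w) * (C * ((1 + norm w) * (2 * (1 + norm w))) ^ M * (3 * (1 + norm w)))"
    proof (intro mult_left_mono mult_mono power_mono sn CM)
      show "norm (w - s i w) \<le> 3 * (1 + norm w)"
        using norm_triangle_ineq4[of w "s i w"] s(3)[of i w] by simp
    qed (auto simp: CM)
    also have "\<dots> = ?G w"
    proof -
      have "x * (C * (a * (2 * a)) ^ M * (3 * a)) = (3 * C * 2 ^ M) * (a ^ (2 * M + 1) * x)" for a x :: real
        by (simp add: power_mult_distrib power_add power_mult power2_eq_square mult_ac)
      then show ?thesis .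
    qed
    finally show ?thesis using CM(1) by simp
  qed
  have GI: "integrable lborel ?G" by (intro integrable_mult_right moments)
  have em: "?e i \<in> borel_measurable lborel" for i by measurable
  have eI: "integrable lborel (?e i)" for i
    by (rule Bochner_Integration.integrable_bound[OF GI em]) (intro AE_I2 order_trans[OF eG], simp add: CM)
  let ?card = "real (card {bs. set bs \<subseteq> (Basis :: 'a set) \<and> length bs \<le> N})"
  have pN: "schwartz_seminorm N (\<lambda>t. f t - f' i t) \<le> ?card * (LINT w|lborel. ?e i w)" for i
  proof (rule schwartz_seminorm_le)
    fix bs :: "'a list" and t assume bs: "set bs \<subseteq> Basis" "length bs \<le> N"
    let ?P = "\<lambda>w. partials bs (tfs w \<eta>) t"
    have Pi: "integrable lborel (\<lambda>w. F w * ?P w)" by (rule superposition_partials_integrable[OF \<eta> F moments bs(1)])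
    have P'i: "integrable lborel (\<lambda>w. F w * ?P (s i w))"
    proof -
      obtain C' M' where C': "\<And>z t. (1 + norm t) ^ 0 * norm (partials bs (tfs z \<eta>) t) \<le> C' * (1 + norm z) ^ M'" "C' \<ge> 0"
        using tfs_partials_bound[OF \<eta> bs(1), of 0] by blast
      show ?thesis
      proof (rule Bochner_Integration.integrable_bound)
        show "integrable lborel (\<lambda>w. C' * 2 ^ M' * ((1 + norm w) ^ M' * norm (F w)))" by (intro integrable_mult_right moments)
        show "(\<lambda>w. F w * ?P (s i w)) \<in> borel_measurable lborel"
          unfolding measurable_lborel2
          by (intro borel_measurable_times F measurable_compose[OF sm tfs_partials_measurable[OF \<eta> bs(1)]])
        show "AE w in lborel. norm (F w * ?P (s i w)) \<le> norm (C' * 2 ^ M' * ((1 + norm w) ^ M' * norm (F w)))"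
        proof (rule AE_I2)
          fix w
          have "norm (?P (s i w)) \<le> C' * (1 + norm (s i w)) ^ M'" using C'(1)[of t "s i w"] by simp
          also have "\<dots> \<le> C' * (2 * (1 + norm w)) ^ M'" by (intro mult_left_mono power_mono sn C') auto
          finally have "norm (F w) * norm (?P (s i w)) \<le> norm (F w) * (C' * (2 * (1 + norm w)) ^ M')"
            by (intro mult_left_mono) auto
          also have "\<dots> = C' * 2 ^ M' * ((1 + norm w) ^ M' * norm (F w))" by (simp only: power_mult_distrib mult_ac)
          finally show "norm (F w * ?P (s i w)) \<le> norm (C' * 2 ^ M' * ((1 + norm w) ^ M' * norm (F w)))"
            unfolding norm_mult[of "F w"] by (rule order_trans) (simp only: real_norm_def abs_ge_self)
        qed
      qed
    qed
    have "partials bs (f' i) t = (LINT w|lborel. F w * ?P (s i w))"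
      unfolding f'_sum using partials_sum[of "range (s i)" "\<lambda>v. tfs v \<eta>" bs "?c i"] schwartz_tfs[OF \<eta>] bs(1)
        integral_mult_simple[OF s(1) FI, of ?P i] by simp
    moreover have "partials bs f t = (LINT w|lborel. F w * ?P w)"
      unfolding f_def using partials_superposition[OF \<eta> F moments bs(1)] by simp
    ultimately have eq: "partials bs (\<lambda>t. f t - f' i t) t = (LINT w|lborel. F w * (?P w - ?P (s i w)))"
      using Pi P'i by (simp add: partials_diff fS f'S bs right_diff_distrib)
    have n: "norm (complex_of_real ((1 + norm t) ^ N)) = (1 + norm t) ^ N" by (simp only: norm_of_real) simp
    have "norm (LINT w|lborel. of_real ((1 + norm t) ^ N) * (F w * (?P w - ?P (s i w)))) \<le> (LINT w|lborel. ?e i w)"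
    proof (rule norm_integral_le[OF eI])
      fix w
      have "(1 + norm t) ^ N * norm (?P w - ?P (s i w)) \<le> schwartz_seminorm N (\<lambda>t. tfs w \<eta> t - tfs (s i w) \<eta> t)"
        using schwartz_seminorm_ge[OF schwartz_diff[OF schwartz_tfs[OF \<eta>] schwartz_tfs[OF \<eta>]] bs(1,2) order_refl, of t w "s i w"]
        by (simp add: partials_diff schwartz_tfs \<eta> bs)
      also have "\<dots> \<le> C * ((1 + norm w) * (1 + norm (s i w))) ^ M * norm (w - s i w)" by (rule CM)
      finally have "norm (F w) * ((1 + norm t) ^ N * norm (?P w - ?P (s i w))) \<le> ?e i w"
        by (intro mult_left_mono) auto
      then show "norm (of_real ((1 + norm t) ^ N) * (F w * (?P w - ?P (s i w)))) \<le> ?e i w"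
        by (simp only: norm_mult n mult.left_commute)
    qed
    then show "(1 + norm t) ^ N * norm (partials bs (\<lambda>t. f t - f' i t) t) \<le> (LINT w|lborel. ?e i w)"
      unfolding eq by (simp only: integral_mult_right_zero norm_mult n)
  qed
  have e0: "(\<lambda>i. LINT w|lborel. ?e i w) \<longlonglongrightarrow> (LINT w|(lborel :: ('a \<times> 'a) measure). 0)"
  proof (rule integral_dominated_convergence[where w = ?G])
    show "AE w in lborel. (\<lambda>i. ?e i w) \<longlonglongrightarrow> 0"
    proof (rule AE_I2)
      fix w
      have "(\<lambda>i. ?e i w) \<longlonglongrightarrow> norm (F w) * (C * ((1 + norm w) * (1 + norm w)) ^ M * norm (w - w))"
        by (intro tendsto_intros s)
      then show "(\<lambda>i. ?e i w) \<longlonglongrightarrow> 0" by simp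
    qed
  qed (use em GI eG in auto)
  have "(\<lambda>i. u (f' i)) \<longlonglongrightarrow> u f"
  proof -
    have "(\<lambda>i. u f - u (f' i)) \<longlonglongrightarrow> 0"
    proof (rule Lim_null_comparison)
      show "\<forall>\<^sub>F i in sequentially. norm (u f - u (f' i)) \<le> K * (?card * (LINT w|lborel. ?e i w))"
      proof (rule always_eventually, rule allI)
        fix i
        show "norm (u f - u (f' i)) \<le> K * (?card * (LINT w|lborel. ?e i w))"
          unfolding tempered_diff[OF u fS f'S, symmetric]
          by (rule order_trans[OF K(2)[OF schwartz_diff[OF fS f'S]] mult_left_mono[OF pN K(1)]])
      qed
      have "(\<lambda>i. K * (?card * (LINT w|lborel. ?e i w))) \<longlonglongrightarrow> K * (?card * (LINT w|(lborel :: ('a \<times> 'a) measure). 0))"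
        by (intro tendsto_mult tendsto_const e0)
      then show "(\<lambda>i. K * (?card * (LINT w|lborel. ?e i w))) \<longlonglongrightarrow> 0" by simp
    qed
    from tendsto_diff[OF tendsto_const this, of "u f"] show ?thesis by simp
  qed
  moreover have "(\<lambda>i. LINT w|lborel. cnj (F w) * u (tfs (s i w) \<eta>)) \<longlonglongrightarrow> (LINT w|lborel. cnj (F w) * u (tfs w \<eta>))"
  proof -
    obtain C' M' where C': "C' \<ge> 0" "\<And>z. norm (u (tfs z \<eta>)) \<le> C' * (1 + norm z) ^ M'"
      using tempered_tfs_bound[OF u \<eta>] by blast
    note um = tempered_tfs_measurable[OF u \<eta>]
    show ?thesis
    proof (rule integral_dominated_convergence[where w = "\<lambda>w. C' * 2 ^ M' * ((1 + norm w) ^ M' * norm (F w))"])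
      show "(\<lambda>w. cnj (F w) * u (tfs w \<eta>)) \<in> borel_measurable lborel"
        unfolding measurable_lborel2 by (intro borel_measurable_times measurable_compose[OF F measurable_cnj] um)
      show "(\<lambda>w. cnj (F w) * u (tfs (s i w) \<eta>)) \<in> borel_measurable lborel" for i
        unfolding measurable_lborel2 by (intro borel_measurable_times measurable_compose[OF F measurable_cnj] measurable_compose[OF sm um])
      show "integrable lborel (\<lambda>w. C' * 2 ^ M' * ((1 + norm w) ^ M' * norm (F w)))" by (intro integrable_mult_right moments)
      show "AE w in lborel. (\<lambda>i. cnj (F w) * u (tfs (s i w) \<eta>)) \<longlonglongrightarrow> cnj (F w) * u (tfs w \<eta>)"
        by (intro AE_I2 tendsto_mult tendsto_const isCont_tendsto_compose[OF isCont_tempered_tfs[OF u \<eta>]] s)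
      show "AE w in lborel. norm (cnj (F w) * u (tfs (s i w) \<eta>)) \<le> C' * 2 ^ M' * ((1 + norm w) ^ M' * norm (F w))" for i
      proof (rule AE_I2)
        fix w
        have "norm (u (tfs (s i w) \<eta>)) \<le> C' * (1 + norm (s i w)) ^ M'" by (rule C')
        also have "\<dots> \<le> C' * (2 * (1 + norm w)) ^ M'" by (intro mult_left_mono power_mono sn C') auto
        finally have "norm (F w) * norm (u (tfs (s i w) \<eta>)) \<le> norm (F w) * (C' * (2 * (1 + norm w)) ^ M')"
          by (intro mult_left_mono) auto
        then show "norm (cnj (F w) * u (tfs (s i w) \<eta>)) \<le> C' * 2 ^ M' * ((1 + norm w) ^ M' * norm (F w))"
          by (simp only: norm_mult complex_mod_cnj power_mult_distrib mult_ac)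
      qed
    qed
  qed
  ultimately show ?thesis
    using LIMSEQ_unique unfolding u_f' f_def by blast
qed

section \<open>The duality between \<open>M1\<close> and \<open>Minf\<close>\<close>

locale window =
  fixes \<phi> :: "'a::euclidean_space \<Rightarrow> complex"
  assumes \<phi>: "\<phi> \<in> schwartz" and \<phi>_nz: "\<phi> \<noteq> (\<lambda>_. 0)"
begin

lemma window_sq_nz: "complex_of_real (window_sq \<phi>) \<noteq> 0"
  using window_sq_pos[OF \<phi> \<phi>_nz] by simp

lemma M1_stft_integrable: "f \<in> M1 \<phi> \<Longrightarrow> integrable lborel (stft \<phi> f)"
  using M1D(3) \<phi> by blast

lemma M1_synthesis:
  assumes "f \<in> M1 \<phi>"
  shows "f = (\<lambda>t. LINT w|lborel. (stft \<phi> f w / of_real (window_sq \<phi>)) * tfs w \<phi> t)"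
proof
  fix t
  have "(LINT w|lborel. (stft \<phi> f w / of_real (window_sq \<phi>)) * tfs w \<phi> t) = (LINT w|lborel. inverse (of_real (window_sq \<phi>)) * (stft \<phi> f w * tfs w \<phi> t))"
    by (simp add: divide_inverse mult_ac)
  also have "\<dots> = f t"
    using M1_reconstruction[OF \<phi> assms, of t] window_sq_nz by simp
  finally show "f t = (LINT w|lborel. (stft \<phi> f w / of_real (window_sq \<phi>)) * tfs w \<phi> t)" by simp
qed

text \<open>Converse of \<open>synthesis\<close>, with control of the coefficient norm. Together
  they reduce boundedness of an operator on \<open>M1\<close> to knowing its effect on shifts of
  \<phi>.\<close>

lemma M1_synthesis_obtain:
  assumes "f \<in> M1 \<phi>"
  obtains F where "integrable lborel F" "F \<in> borel_measurable borel" "f = (\<lambda>t. LINT w|lborel. F w * tfs w \<phi> t)"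
    "(LINT w|lborel. norm (F w)) = M1_norm \<phi> f / window_sq \<phi>"
proof
  let ?F = "\<lambda>w. stft \<phi> f w / of_real (window_sq \<phi>)"
  show i: "integrable lborel ?F" using M1_stft_integrable[OF assms] by simp
  then show "?F \<in> borel_measurable borel" by auto
  show "f = (\<lambda>t. LINT w|lborel. ?F w * tfs w \<phi> t)" by (rule M1_synthesis[OF assms])
  show "(LINT w|lborel. norm (?F w)) = M1_norm \<phi> f / window_sq \<phi>"
    using window_sq_pos[OF \<phi> \<phi>_nz] by (simp add: M1_norm_eq[OF \<phi>] norm_divide)
qed

lemma M1_bounded:
  assumes "f \<in> M1 \<phi>"
  shows "\<exists>B. \<forall>t. norm (f t) \<le> B"
proof -
  obtain F where F: "integrable lborel F" "f = (\<lambda>t. LINT w|lborel. F w * tfs w \<phi> t)"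
    using M1_synthesis_obtain[OF assms] by blast
  obtain B where B: "\<And>x. norm (\<phi> x) \<le> B" using schwartz_bounded[OF \<phi>] by blast
  have "norm (f t) \<le> (LINT w|lborel. norm (F w) * B)" for t
    unfolding F(2)
    by (rule norm_integral_le) (use F(1) B in \<open>auto simp: norm_mult norm_tfs intro!: mult_left_mono\<close>)
  then show ?thesis by blast
qed

lemma stft_integrand:
  assumes "f \<in> M1 \<phi>"
  shows "integrable lborel (\<lambda>t. f t * cnj (tfs z \<phi> t))"
  using M1D(4)[OF assms \<phi> schwartz_tfs[OF \<phi>]] .

lemma stft_add:
  assumes "f \<in> M1 \<phi>" "g \<in> M1 \<phi>"
  shows "stft \<phi> (\<lambda>t. f t + g t) = (\<lambda>z. stft \<phi> f z + stft \<phi> g z)"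
  using stft_integrand[OF assms(1)] stft_integrand[OF assms(2)] by (simp add: fun_eq_iff stft_eq distrib_right)

lemma stft_cmult: "stft \<phi> (\<lambda>t. c * f t) = (\<lambda>z. c * stft \<phi> f z)"
  by (simp add: fun_eq_iff stft_eq mult.assoc)

lemma M1_add:
  assumes "f \<in> M1 \<phi>" "g \<in> M1 \<phi>"
  shows "(\<lambda>t. f t + g t) \<in> M1 \<phi>"
proof -
  obtain B B' where B: "\<And>t. norm (f t) \<le> B" "\<And>t. norm (g t) \<le> B'" using M1_bounded assms by metis
  show ?thesis
  proof (rule M1I[OF \<phi>])
    show "norm (f t + g t) \<le> B + B'" for t using B[of t] norm_triangle_ineq[of "f t" "g t"] by linarith
    show "integrable lborel (stft \<phi> (\<lambda>t. f t + g t))"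
      unfolding stft_add[OF assms] using assms M1_stft_integrable by simp
  qed (intro continuous_intros M1D(1)[OF _ \<phi>] assms)
qed

lemma M1_cmult:
  assumes "f \<in> M1 \<phi>"
  shows "(\<lambda>t. c * f t) \<in> M1 \<phi>"
proof -
  obtain B where B: "\<And>t. norm (f t) \<le> B" using M1_bounded assms by metis
  show ?thesis
  proof (rule M1I[OF \<phi>])
    show "norm (c * f t) \<le> norm c * B" for t by (simp add: norm_mult mult_left_mono B)
    show "integrable lborel (stft \<phi> (\<lambda>t. c * f t))"
      unfolding stft_cmult using assms M1_stft_integrable by simp
  qed (intro continuous_intros M1D(1)[OF _ \<phi>] assms)
qed

lemma M1_diff:
  assumes "f \<in> M1 \<phi>" "g \<in> M1 \<phi>"
  shows "(\<lambda>t. f t - g t) \<in> M1 \<phi>"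
  using M1_add[OF assms(1) M1_cmult[OF assms(2), of "-1"]] by simp

lemma stft_diff:
  assumes "f \<in> M1 \<phi>" "g \<in> M1 \<phi>"
  shows "stft \<phi> (\<lambda>t. f t - g t) = (\<lambda>z. stft \<phi> f z - stft \<phi> g z)"
  using stft_add[OF assms(1) M1_cmult[OF assms(2), of "-1"]] stft_cmult[of "-1" g] by simp

lemma M1_norm_cmult: "M1_norm \<phi> (\<lambda>t. c * f t) = norm c * M1_norm \<phi> f"
  by (simp add: M1_norm_eq[OF \<phi>] stft_cmult norm_mult)

lemma M1_norm_tfs: "\<eta> \<in> schwartz \<Longrightarrow> M1_norm \<phi> (tfs w \<eta>) = M1_norm \<phi> \<eta>"
  using integral_translate[of "\<lambda>z. norm (stft \<phi> \<eta> z)" "- w"] stft_measurable[of \<eta> \<phi>]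
  by (simp add: M1_norm_eq[OF \<phi>] norm_stft_tfs \<phi> schwartz_measurable)

text \<open>Cutting off the coefficients of the reconstruction formula gives Schwartz functions.\<close>

lemma schwartz_dense_M1:
  assumes g: "g \<in> M1 \<phi>" and e: "e > 0"
  shows "\<exists>\<psi>\<in>schwartz. M1_norm \<phi> (\<lambda>t. \<psi> t - g t) < e"
proof -
  obtain F where F: "integrable lborel F" "F \<in> borel_measurable borel" "g = (\<lambda>t. LINT w|lborel. F w * tfs w \<phi> t)"
    using M1_synthesis_obtain[OF g] by blast
  note [measurable] = F(2)
  define I :: "nat \<Rightarrow> 'a \<times> 'a \<Rightarrow> real" where "I n = indicat_real (cball 0 (real n))" for n
  have Im[measurable]: "I n \<in> borel_measurable borel" for n
    unfolding I_def by (rule borel_measurable_indicator) (rule borel_closed, rule closed_cball)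
  have I01: "0 \<le> I n w" "I n w \<le> 1" for n w by (auto simp: I_def)
  have d: "(\<lambda>n. LINT w|lborel. norm ((of_real (I n w) - 1) * F w)) \<longlonglongrightarrow> (LINT w|(lborel :: ('a \<times> 'a) measure). 0)"
  proof (rule integral_dominated_convergence[where w = "\<lambda>w. norm (F w)"])
    show "AE w in lborel. (\<lambda>n. norm ((of_real (I n w) - 1) * F w)) \<longlonglongrightarrow> 0"
    proof (rule AE_I2)
      fix w :: "'a \<times> 'a"
      obtain n0 :: nat where "norm w \<le> real n0" using real_arch_simple by blast
      then have "\<forall>\<^sub>F n in sequentially. norm ((of_real (I n w) - 1) * F w) = 0"
        by (intro eventually_sequentiallyI[of n0]) (auto simp: I_def indicator_def)
      then show "(\<lambda>n. norm ((of_real (I n w) - 1) * F w)) \<longlonglongrightarrow> 0" by (rule tendsto_eventually)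
    qed
    show "AE w in lborel. norm (norm ((of_real (I n w) - 1) * F w)) \<le> norm (F w)" for n
      by (rule AE_I2) (auto simp: I_def indicator_def)
  qed (use F(1) in auto)
  then have "(\<lambda>n. (LINT w|lborel. norm ((of_real (I n w) - 1) * F w)) * M1_norm \<phi> \<phi>) \<longlonglongrightarrow> 0"
    by (intro tendsto_mult_left_zero) simp
  from order_tendstoD(2)[OF this e] obtain n where n: "(LINT w|lborel. norm ((of_real (I n w) - 1) * F w)) * M1_norm \<phi> \<phi> < e"
    by (meson eventually_happens' sequentially_bot)
  let ?\<psi> = "\<lambda>t. LINT w|lborel. (of_real (I n w) * F w) * tfs w \<phi> t"
  have "?\<psi> \<in> schwartz"
  proof (rule superposition_schwartz[OF \<phi>])
    show "(\<lambda>w. of_real (I n w) * F w) \<in> borel_measurable borel" by measurable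
    fix k
    show "integrable lborel (\<lambda>w. (1 + norm w) ^ k * norm (of_real (I n w) * F w))"
    proof (rule Bochner_Integration.integrable_bound)
      show "integrable lborel (\<lambda>w. (1 + real n) ^ k * norm (F w))" using F(1) by simp
      show "AE w in lborel. norm ((1 + norm w) ^ k * norm (of_real (I n w) * F w)) \<le> norm ((1 + real n) ^ k * norm (F w))"
        by (rule AE_I2) (auto simp: I_def indicator_def abs_mult intro!: mult_right_mono power_mono)
    qed measurable
  qed
  moreover have "(\<lambda>t. ?\<psi> t - g t) = (\<lambda>t. LINT w|lborel. ((of_real (I n w) - 1) * F w) * tfs w \<phi> t)"
  proof
    fix t
    obtain B where B: "\<And>x. norm (\<phi> x) \<le> B" using schwartz_bounded[OF \<phi>] by blast
    have tm: "(\<lambda>w. tfs w \<phi> t) \<in> borel_measurable borel" by (intro measurable_tfs_comp schwartz_measurable \<phi>) auto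
    have 1: "integrable lborel (\<lambda>w. F w * tfs w \<phi> t)"
      using integrable_bounded_mult[OF tm _ F(1), of B] B by (simp add: norm_tfs mult.commute)
    have "integrable lborel (\<lambda>w. of_real (I n w) * (F w * tfs w \<phi> t))"
      by (rule integrable_bounded_mult[of _ 1]) (use 1 I01 in auto)
    with 1 show "?\<psi> t - g t = (LINT w|lborel. ((of_real (I n w) - 1) * F w) * tfs w \<phi> t)"
      unfolding F(3) by (simp add: left_diff_distrib mult.assoc)
  qed
  moreover have "M1_norm \<phi> (\<lambda>t. LINT w|lborel. ((of_real (I n w) - 1) * F w) * tfs w \<phi> t) \<le> (LINT w|lborel. norm ((of_real (I n w) - 1) * F w)) * M1_norm \<phi> \<phi>"
  proof (rule synthesis(2)[OF \<phi> \<phi>])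
    show "integrable lborel (\<lambda>w. (of_real (I n w) - 1) * F w)"
      by (rule integrable_bounded_mult[of _ 1, OF _ _ F(1)]) (auto simp: I_def indicator_def)
  qed simp
  ultimately show ?thesis using n by (intro bexI[of _ ?\<psi>]) auto
qed

text \<open>u is applied under the integral in the reconstruction of \<psi>, which is legitimate
  because the transform of a Schwartz function has all moments.\<close>

lemma tempered_stft_expansion:
  assumes u: "u \<in> tempered" and \<psi>: "\<psi> \<in> schwartz"
  shows "of_real (window_sq \<phi>) * u \<psi> = (LINT w|lborel. stft_distr \<phi> u w * cnj (stft \<phi> \<psi> w))"
proof -
  have "of_real (window_sq \<phi>) * u \<psi> = u (\<lambda>t. of_real (window_sq \<phi>) * \<psi> t)"
    by (simp add: temperedD(3)[OF u \<psi>])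
  also have "(\<lambda>t. of_real (window_sq \<phi>) * \<psi> t) = (\<lambda>t. LINT w|lborel. stft \<phi> \<psi> w * tfs w \<phi> t)"
    by (simp add: M1_reconstruction[OF \<phi> schwartz_M1[OF \<phi> \<psi>]])
  also have "u \<dots> = (LINT w|lborel. cnj (stft \<phi> \<psi> w) * u (tfs w \<phi>))"
    by (rule tempered_superposition[OF u \<phi> stft_measurable[OF schwartz_measurable[OF \<psi>] schwartz_measurable[OF \<phi>]]
          stft_schwartz_weighted_integrable[OF \<phi> \<psi>]])
  finally show ?thesis by (simp add: stft_distr_eq mult.commute)
qed

lemma stft_distr_measurable: "u \<in> tempered \<Longrightarrow> stft_distr \<phi> u \<in> borel_measurable borel"
  using tempered_tfs_measurable[OF _ \<phi>] by (simp add: stft_distr_eq[abs_def])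

lemma MinfD:
  assumes "u \<in> Minf \<phi>"
  shows "u \<in> tempered" "AE z in lborel. norm (stft_distr \<phi> u z) \<le> Minf_norm \<phi> u" "0 \<le> Minf_norm \<phi> u"
proof -
  let ?e = "esssup lborel (\<lambda>z. ereal (norm (stft_distr \<phi> u z)))"
  show "u \<in> tempered" using assms unfolding Minf_def by auto
  have e: "?e < \<infinity>" using assms unfolding Minf_def by auto
  have ae: "AE z in lborel. ereal (norm (stft_distr \<phi> u z)) \<le> ?e" by (rule esssup_AE)
  \<comment> \<open>\<open>Minf_norm\<close> passes through \<open>real_of_ereal\<close>, which is
    faithful only for finite values. Minus infinity is excluded because Lebesgue measure is not the
    zero measure.\<close>
  have "0 \<le> ?e"
  proof (rule ccontr)
    assume "\<not> 0 \<le> ?e"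
    with ae have "AE z in (lborel :: ('a \<times> 'a) measure). False"
      by (elim eventually_mono) (metis ereal_less_eq(5) norm_ge_zero order_trans)
    then show False using AE_iff_null_sets[of "UNIV :: ('a \<times> 'a) set" lborel] emeasure_lborel_UNIV by auto
  qed
  with e have eq: "?e = ereal (Minf_norm \<phi> u)" unfolding Minf_norm_def by (cases ?e) auto
  show "AE z in lborel. norm (stft_distr \<phi> u z) \<le> Minf_norm \<phi> u" using ae unfolding eq by simp
  show "0 \<le> Minf_norm \<phi> u" using \<open>0 \<le> ?e\<close> unfolding eq by simp
qed

lemma MinfI:
  assumes "u \<in> tempered" "\<And>z. norm (stft_distr \<phi> u z) \<le> C"
  shows "u \<in> Minf \<phi>"
proof -
  have m: "stft_distr \<phi> u \<in> borel_measurable borel" by (rule stft_distr_measurable[OF assms(1)])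
  have "esssup lborel (\<lambda>z. ereal (norm (stft_distr \<phi> u z))) \<le> ereal C"
    using m assms(2) by (intro esssup_I) auto
  with assms(1) m show ?thesis unfolding Minf_def by (auto intro: le_less_trans)
qed

section \<open>The bracket as an integral over phase space\<close>

lemma bracket_integrable:
  assumes "u \<in> Minf \<phi>" "g \<in> M1 \<phi>"
  shows "integrable lborel (\<lambda>z. stft_distr \<phi> u z * cnj (stft \<phi> g z))"
    and "norm (LINT z|lborel. stft_distr \<phi> u z * cnj (stft \<phi> g z)) \<le> Minf_norm \<phi> u * M1_norm \<phi> g"
proof -
  note [measurable] = stft_distr_measurable[OF MinfD(1)[OF assms(1)]]
  have gi: "integrable lborel (stft \<phi> g)" by (rule M1_stft_integrable[OF assms(2)])
  then have [measurable]: "stft \<phi> g \<in> borel_measurable borel" by auto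
  have ae: "AE z in lborel. norm (stft_distr \<phi> u z * cnj (stft \<phi> g z)) \<le> Minf_norm \<phi> u * norm (stft \<phi> g z)"
    using MinfD(2)[OF assms(1)] by eventually_elim (simp add: norm_mult mult_right_mono)
  have Gi: "integrable lborel (\<lambda>z. Minf_norm \<phi> u * norm (stft \<phi> g z))" using gi by simp
  show i: "integrable lborel (\<lambda>z. stft_distr \<phi> u z * cnj (stft \<phi> g z))"
    by (rule Bochner_Integration.integrable_bound[OF Gi])
      (measurable, use ae MinfD(3)[OF assms(1)] in \<open>simp add: abs_mult\<close>)
  have "norm (LINT z|lborel. stft_distr \<phi> u z * cnj (stft \<phi> g z)) \<le> (LINT z|lborel. norm (stft_distr \<phi> u z * cnj (stft \<phi> g z)))"
    by (rule integral_norm_bound)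
  also have "\<dots> \<le> (LINT z|lborel. Minf_norm \<phi> u * norm (stft \<phi> g z))"
    by (rule integral_mono_AE[OF integrable_norm[OF i] Gi ae])
  finally show "norm (LINT z|lborel. stft_distr \<phi> u z * cnj (stft \<phi> g z)) \<le> Minf_norm \<phi> u * M1_norm \<phi> g"
    by (simp add: M1_norm_eq[OF \<phi>])
qed

text \<open>Density of Schwartz functions makes the filter in \<open>bracket\<close> proper, so its
  limit is unique, and the Lipschitz bound at g identifies the limit as \<open>L g\<close>.\<close>

lemma bracket_eqI:
  assumes g: "g \<in> M1 \<phi>" and uL: "\<And>\<psi>. \<psi> \<in> schwartz \<Longrightarrow> u \<psi> = L \<psi>"
    and C: "\<And>\<psi>. \<psi> \<in> schwartz \<Longrightarrow> norm (L \<psi> - L g) \<le> C * M1_norm \<phi> (\<lambda>t. \<psi> t - g t)"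
  shows "bracket \<phi> u g = L g"
  unfolding bracket_def
proof (rule tendsto_Lim)
  let ?m = "\<lambda>\<psi>. M1_norm \<phi> (\<lambda>x. \<psi> x - g x)"
  let ?F = "inf (principal schwartz) (filtercomap ?m (nhds 0))"
  have ev: "eventually P ?F \<longleftrightarrow> (\<exists>Q. eventually Q (nhds 0) \<and> (\<forall>\<psi>\<in>schwartz. Q (?m \<psi>) \<longrightarrow> P \<psi>))" for P
    unfolding inf_commute[of "principal schwartz"] eventually_inf_principal eventually_filtercomap by blast
  show "\<not> trivial_limit ?F"
    unfolding trivial_limit_def ev
  proof safe
    fix Q assume "eventually Q (nhds (0::real))" and Q: "\<forall>\<psi>\<in>schwartz. Q (?m \<psi>) \<longrightarrow> False"
    then obtain d where d: "d > 0" "\<And>r. dist r 0 < d \<Longrightarrow> Q r" unfolding eventually_nhds_metric by blast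
    obtain \<psi> where "\<psi> \<in> schwartz" "?m \<psi> < d" using schwartz_dense_M1[OF g d(1)] by blast
    with d(2)[of "?m \<psi>"] Q M1_norm_nonneg[of \<phi> "\<lambda>x. \<psi> x - g x"] show False by (auto simp: dist_real_def)
  qed
  show "(u \<longlongrightarrow> L g) ?F"
  proof (rule tendstoI)
    fix e :: real assume e: "e > 0"
    \<comment> \<open>C may be zero or negative; \<open>\<bar>C\<bar> + 1\<close> is a positive
      substitute.\<close>
    let ?d = "e / (\<bar>C\<bar> + 1)"
    have "eventually (\<lambda>r. \<bar>r\<bar> < ?d) (nhds (0::real))"
      unfolding eventually_nhds_metric using e by (intro exI[of _ ?d]) auto
    moreover have "dist (u \<psi>) (L g) < e" if \<psi>: "\<psi> \<in> schwartz" and m: "\<bar>?m \<psi>\<bar> < ?d" for \<psi>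
    proof -
      have "dist (u \<psi>) (L g) \<le> C * ?m \<psi>" using C[OF \<psi>] by (simp add: dist_norm uL[OF \<psi>])
      also have "\<dots> \<le> (\<bar>C\<bar> + 1) * \<bar>?m \<psi>\<bar>" 
        using abs_ge_self[of "C * ?m \<psi>"] abs_ge_zero[of "?m \<psi>"] unfolding distrib_right abs_mult by linarith
      also have "\<dots> < (\<bar>C\<bar> + 1) * ?d" using m by (intro mult_strict_left_mono) auto
      also have "\<dots> = e" by (simp add: add_nonneg_eq_0_iff)
      finally show ?thesis .
    qed
    ultimately show "eventually (\<lambda>\<psi>. dist (u \<psi>) (L g) < e) ?F" unfolding ev by blast
  qed
qed

text \<open>The right-hand side agrees with u on Schwartz functions by
  \<open>tempered_stft_expansion\<close> and is Lipschitz in the \<open>M1\<close> norm by the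
  estimate of \<open>bracket_integrable\<close>, so it is the continuous extension.\<close>

lemma bracket_eq:
  assumes u: "u \<in> Minf \<phi>" and g: "g \<in> M1 \<phi>"
  shows "bracket \<phi> u g = (LINT z|lborel. stft_distr \<phi> u z * cnj (stft \<phi> g z)) / of_real (window_sq \<phi>)"
proof (rule bracket_eqI[OF g, where L = "\<lambda>g. (LINT z|lborel. stft_distr \<phi> u z * cnj (stft \<phi> g z)) / of_real (window_sq \<phi>)"])
  fix \<psi> :: "'a \<Rightarrow> complex" assume \<psi>: "\<psi> \<in> schwartz"
  show "u \<psi> = (LINT z|lborel. stft_distr \<phi> u z * cnj (stft \<phi> \<psi> z)) / of_real (window_sq \<phi>)"
    using tempered_stft_expansion[OF MinfD(1)[OF u] \<psi>] window_sq_nz by (simp add: field_simps)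
  have \<psi>M: "\<psi> \<in> M1 \<phi>" by (rule schwartz_M1[OF \<phi> \<psi>])
  have "(LINT z|lborel. stft_distr \<phi> u z * cnj (stft \<phi> \<psi> z)) - (LINT z|lborel. stft_distr \<phi> u z * cnj (stft \<phi> g z)) =
     (LINT z|lborel. stft_distr \<phi> u z * cnj (stft \<phi> (\<lambda>t. \<psi> t - g t) z))"
    using bracket_integrable(1)[OF u \<psi>M] bracket_integrable(1)[OF u g] by (simp add: stft_diff \<psi>M g right_diff_distrib)
  then show "norm ((LINT z|lborel. stft_distr \<phi> u z * cnj (stft \<phi> \<psi> z)) / of_real (window_sq \<phi>) - (LINT z|lborel. stft_distr \<phi> u z * cnj (stft \<phi> g z)) / of_real (window_sq \<phi>))
     \<le> (Minf_norm \<phi> u / window_sq \<phi>) * M1_norm \<phi> (\<lambda>t. \<psi> t - g t)"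
    using bracket_integrable(2)[OF u M1_diff[OF \<psi>M g]] window_sq_pos[OF \<phi> \<phi>_nz]
    by (simp add: diff_divide_distrib[symmetric] norm_divide divide_right_mono)
qed

lemma bracket_schwartz:
  assumes "u \<in> Minf \<phi>" "\<psi> \<in> schwartz"
  shows "bracket \<phi> u \<psi> = u \<psi>"
  using tempered_stft_expansion[OF MinfD(1)[OF assms(1)] assms(2)] window_sq_nz
  by (simp add: bracket_eq[OF assms(1) schwartz_M1[OF \<phi> assms(2)]] field_simps)

lemma bracket_bound:
  assumes "u \<in> Minf \<phi>" "g \<in> M1 \<phi>"
  shows "norm (bracket \<phi> u g) \<le> Minf_norm \<phi> u / window_sq \<phi> * M1_norm \<phi> g"
  using bracket_integrable(2)[OF assms] window_sq_pos[OF \<phi> \<phi>_nz]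
  by (simp add: bracket_eq[OF assms] norm_divide divide_right_mono)

lemma bracket_add_right:
  assumes "u \<in> Minf \<phi>" "f \<in> M1 \<phi>" "g \<in> M1 \<phi>"
  shows "bracket \<phi> u (\<lambda>t. f t + g t) = bracket \<phi> u f + bracket \<phi> u g"
  using bracket_integrable(1)[OF assms(1,2)] bracket_integrable(1)[OF assms(1,3)]
  by (simp add: bracket_eq assms M1_add stft_add distrib_left add_divide_distrib)

lemma bracket_cmult_right:
  assumes "u \<in> Minf \<phi>" "f \<in> M1 \<phi>"
  shows "bracket \<phi> u (\<lambda>t. c * f t) = cnj c * bracket \<phi> u f"
  by (simp add: bracket_eq assms M1_cmult stft_cmult mult.left_commute[of _ "cnj c"])

lemma bracket_add_left:
  assumes "u \<in> Minf \<phi>" "v \<in> Minf \<phi>" "(\<lambda>\<psi>. u \<psi> + v \<psi>) \<in> Minf \<phi>" "f \<in> M1 \<phi>"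
  shows "bracket \<phi> (\<lambda>\<psi>. u \<psi> + v \<psi>) f = bracket \<phi> u f + bracket \<phi> v f"
proof -
  have "stft_distr \<phi> (\<lambda>\<psi>. u \<psi> + v \<psi>) = (\<lambda>z. stft_distr \<phi> u z + stft_distr \<phi> v z)"
    by (simp add: fun_eq_iff stft_distr_eq)
  with bracket_integrable(1)[OF assms(1,4)] bracket_integrable(1)[OF assms(2,4)] show ?thesis
    by (simp add: bracket_eq assms distrib_right add_divide_distrib)
qed

lemma bracket_scale_left:
  assumes "u \<in> Minf \<phi>" "scale_distr c u \<in> Minf \<phi>" "f \<in> M1 \<phi>"
  shows "bracket \<phi> (scale_distr c u) f = c * bracket \<phi> u f"
proof -
  have "stft_distr \<phi> (scale_distr c u) = (\<lambda>z. c * stft_distr \<phi> u z)"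
    by (simp add: fun_eq_iff stft_distr_eq scale_distr_def)
  then show ?thesis by (simp add: bracket_eq assms mult.assoc)
qed

text \<open>Testing on Schwartz functions suffices, since elsewhere both functionals are 0 by
  convention. The result is equality of HOL functions, as the representation of \<open>T\<close> by
  a symbol asks.\<close>

lemma Minf_eqI:
  assumes "u \<in> Minf \<phi>" "v \<in> Minf \<phi>" "\<And>g. g \<in> M1 \<phi> \<Longrightarrow> bracket \<phi> u g = bracket \<phi> v g"
  shows "u = v"
proof
  fix \<psi>
  show "u \<psi> = v \<psi>"
  proof (cases "\<psi> \<in> schwartz")
    case True
    then show ?thesis using assms(3)[OF schwartz_M1[OF \<phi> True]] by (simp add: bracket_schwartz assms)
  next
    case False
    then show ?thesis using temperedD(1) MinfD(1) assms by metis
  qed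
qed

text \<open>Antilinear because \<open>bracket\<close> is conjugate-linear in its second argument;
  all conditions are confined to \<open>M1\<close>, where the dual definitions have meaning.\<close>

definition antilinear_functional :: "(('a \<Rightarrow> complex) \<Rightarrow> complex) \<Rightarrow> bool" where
  "antilinear_functional L \<longleftrightarrow>
     (\<forall>f\<in>M1 \<phi>. \<forall>g\<in>M1 \<phi>. L (\<lambda>t. f t + g t) = L f + L g) \<and>
     (\<forall>f\<in>M1 \<phi>. \<forall>c. L (\<lambda>t. c * f t) = cnj c * L f) \<and>
     (\<exists>C. \<forall>f\<in>M1 \<phi>. norm (L f) \<le> C * M1_norm \<phi> f)"

text \<open>The definite description is satisfied by the restriction of L to Schwartz functions: it
  is tempered by \<open>M1_norm_seminorm\<close>, and its transform is bounded since all shifts of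
  \<phi> have the same \<open>M1\<close> norm. Uniqueness is \<open>Minf_eqI\<close>.\<close>

lemma Minf_by_works:
  assumes L: "antilinear_functional L"
  shows "Minf_by \<phi> L \<in> Minf \<phi>" and "\<And>g. g \<in> M1 \<phi> \<Longrightarrow> bracket \<phi> (Minf_by \<phi> L) g = L g"
proof -
  have add: "L (\<lambda>t. f t + g t) = L f + L g" if "f \<in> M1 \<phi>" "g \<in> M1 \<phi>" for f g
    using L that unfolding antilinear_functional_def by blast
  have cm: "L (\<lambda>t. c * f t) = cnj c * L f" if "f \<in> M1 \<phi>" for f c
    using L that unfolding antilinear_functional_def by blast
  obtain C where C: "\<And>f. f \<in> M1 \<phi> \<Longrightarrow> norm (L f) \<le> C * M1_norm \<phi> f"
    using L unfolding antilinear_functional_def by blast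
  have C': "norm (L f) \<le> \<bar>C\<bar> * M1_norm \<phi> f" if "f \<in> M1 \<phi>" for f
    using C[OF that] mult_right_mono[OF abs_ge_self M1_norm_nonneg, of C \<phi> f] by simp
  define u where "u \<psi> = (if \<psi> \<in> schwartz then L \<psi> else 0)" for \<psi>
  obtain N K where K: "K \<ge> 0" "\<And>f. f \<in> schwartz \<Longrightarrow> M1_norm \<phi> f \<le> K * schwartz_seminorm N f"
    using M1_norm_seminorm[OF \<phi>] by blast
  have "norm (u \<psi>) \<le> (\<bar>C\<bar> * K) * schwartz_seminorm N \<psi>" if "\<psi> \<in> schwartz" for \<psi>
    using order_trans[OF C'[OF schwartz_M1[OF \<phi> that]] mult_left_mono[OF K(2)[OF that]]] that
    by (simp add: u_def mult.assoc)
  then have ut: "u \<in> tempered"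
    unfolding tempered_def u_def by (auto simp: schwartz_add schwartz_cmult add cm schwartz_M1[OF \<phi>])
  have "norm (stft_distr \<phi> u z) \<le> \<bar>C\<bar> * M1_norm \<phi> \<phi>" for z
    using C'[OF schwartz_M1[OF \<phi> schwartz_tfs[OF \<phi>]], of z] by (simp add: stft_distr_eq u_def schwartz_tfs \<phi> M1_norm_tfs)
  then have uM: "u \<in> Minf \<phi>" by (rule MinfI[OF ut])
  have ub: "bracket \<phi> u g = L g" if g: "g \<in> M1 \<phi>" for g
  proof (rule bracket_eqI[OF g])
    fix \<psi> :: "'a \<Rightarrow> complex" assume \<psi>: "\<psi> \<in> schwartz"
    show "u \<psi> = L \<psi>" by (simp add: u_def \<psi>)
    have "L \<psi> - L g = L (\<lambda>t. \<psi> t - g t)"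
      using add[OF schwartz_M1[OF \<phi> \<psi>] M1_cmult[OF g, of "-1"]] cm[OF g, of "-1"] by simp
    then show "norm (L \<psi> - L g) \<le> C * M1_norm \<phi> (\<lambda>t. \<psi> t - g t)"
      using C[OF M1_diff[OF schwartz_M1[OF \<phi> \<psi>] g]] by simp
  qed
  let ?P = "\<lambda>u. u \<in> Minf \<phi> \<and> (\<forall>g\<in>M1 \<phi>. bracket \<phi> u g = L g)"
  have "v = u" if "?P v" for v
    by (rule Minf_eqI) (use that uM ub in auto)
  then have "Minf_by \<phi> L \<in> Minf \<phi> \<and> (\<forall>g\<in>M1 \<phi>. bracket \<phi> (Minf_by \<phi> L) g = L g)"
    unfolding Minf_by_def using uM ub by (intro theI[of ?P u]) auto
  then show "Minf_by \<phi> L \<in> Minf \<phi>" "\<And>g. g \<in> M1 \<phi> \<Longrightarrow> bracket \<phi> (Minf_by \<phi> L) g = L g" by auto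
qed

lemma antilinear_functional_bracket: "u \<in> Minf \<phi> \<Longrightarrow> antilinear_functional (bracket \<phi> u)"
  unfolding antilinear_functional_def
  using bracket_add_right bracket_cmult_right bracket_bound by blast

text \<open>The distribution representing L has the transform \<open>L (tfs z \<phi>)\<close>, so
  \<open>bracket_eq\<close> expresses L through its values on shifts alone.\<close>

lemma antilinear_functional_expansion:
  assumes L: "antilinear_functional L" and g: "g \<in> M1 \<phi>"
  shows "of_real (window_sq \<phi>) * L g = (LINT z|lborel. L (tfs z \<phi>) * cnj (stft \<phi> g z))"
proof -
  have "stft_distr \<phi> (Minf_by \<phi> L) z = L (tfs z \<phi>)" for z
    using Minf_by_works(2)[OF L schwartz_M1[OF \<phi> schwartz_tfs[OF \<phi>]], of z]
      bracket_schwartz[OF Minf_by_works(1)[OF L] schwartz_tfs[OF \<phi>], of z] by (simp add: stft_distr_eq)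
  then show ?thesis
    using bracket_eq[OF Minf_by_works(1)[OF L] g] Minf_by_works(2)[OF L g] window_sq_nz by (simp add: field_simps)
qed

end

section \<open>Bounded operators on \<open>M1\<close>\<close>

context window
begin

definition M1_operator :: "(('a \<Rightarrow> complex) \<Rightarrow> 'a \<Rightarrow> complex) \<Rightarrow> bool" where
  "M1_operator S \<longleftrightarrow> (\<forall>f\<in>M1 \<phi>. S f \<in> M1 \<phi>) \<and>
     (\<forall>f\<in>M1 \<phi>. \<forall>g\<in>M1 \<phi>. S (\<lambda>t. f t + g t) = (\<lambda>t. S f t + S g t)) \<and>
     (\<forall>f\<in>M1 \<phi>. \<forall>c. S (\<lambda>t. c * f t) = (\<lambda>t. c * S f t)) \<and>
     (\<exists>C\<ge>0. \<forall>f\<in>M1 \<phi>. M1_norm \<phi> (S f) \<le> C * M1_norm \<phi> f)"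

lemma M1_operatorD: "M1_operator S \<Longrightarrow> f \<in> M1 \<phi> \<Longrightarrow> S f \<in> M1 \<phi>"
  unfolding M1_operator_def by blast

lemma M1_operator_comp:
  assumes S: "M1_operator S" and S': "M1_operator S'"
  shows "M1_operator (\<lambda>f. S (S' f))"
proof -
  obtain C where C: "C \<ge> 0" "\<And>f. f \<in> M1 \<phi> \<Longrightarrow> M1_norm \<phi> (S f) \<le> C * M1_norm \<phi> f"
    using S unfolding M1_operator_def by blast
  obtain C' where C': "C' \<ge> 0" "\<And>f. f \<in> M1 \<phi> \<Longrightarrow> M1_norm \<phi> (S' f) \<le> C' * M1_norm \<phi> f"
    using S' unfolding M1_operator_def by blast
  have "M1_norm \<phi> (S (S' f)) \<le> (C * C') * M1_norm \<phi> f" if f: "f \<in> M1 \<phi>" for f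
    using order_trans[OF C(2)[OF M1_operatorD[OF S' f]] mult_left_mono[OF C'(2)[OF f] C(1)]] by (simp only: mult.assoc)
  moreover have "0 \<le> C * C'" using C(1) C'(1) by simp
  ultimately have "\<exists>C\<ge>0. \<forall>f\<in>M1 \<phi>. M1_norm \<phi> (S (S' f)) \<le> C * M1_norm \<phi> f" by blast
  with S S' show ?thesis unfolding M1_operator_def by simp
qed

text \<open>Pulling a distribution back along an operator on \<open>M1\<close> gives an admissible
  input for \<open>Minf_by\<close>. The factor c makes room for the determinant in
  \<open>coord_change_Minf\<close>.\<close>

lemma antilinear_functional_operator:
  assumes S: "M1_operator S" and u: "u \<in> Minf \<phi>"
  shows "antilinear_functional (\<lambda>f. c * bracket \<phi> u (S f))"
proof -
  obtain C where C: "C \<ge> 0" "\<And>f. f \<in> M1 \<phi> \<Longrightarrow> M1_norm \<phi> (S f) \<le> C * M1_norm \<phi> f"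
    using S unfolding M1_operator_def by blast
  have "norm (c * bracket \<phi> u (S f)) \<le> (norm c * (Minf_norm \<phi> u / window_sq \<phi> * C)) * M1_norm \<phi> f" if f: "f \<in> M1 \<phi>" for f
  proof -
    have "norm (bracket \<phi> u (S f)) \<le> Minf_norm \<phi> u / window_sq \<phi> * M1_norm \<phi> (S f)"
      by (rule bracket_bound[OF u M1_operatorD[OF S f]])
    also have "\<dots> \<le> Minf_norm \<phi> u / window_sq \<phi> * (C * M1_norm \<phi> f)"
      using MinfD(3)[OF u] window_sq_pos[OF \<phi> \<phi>_nz] by (intro mult_left_mono C f) simp
    finally show ?thesis unfolding norm_mult mult.assoc by (intro mult_left_mono) auto
  qed
  moreover have "c * bracket \<phi> u (S (\<lambda>t. f t + g t)) = c * bracket \<phi> u (S f) + c * bracket \<phi> u (S g)"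
    if "f \<in> M1 \<phi>" "g \<in> M1 \<phi>" for f g
    using S that bracket_add_right[OF u M1_operatorD[OF S] M1_operatorD[OF S], of f g]
    unfolding M1_operator_def by (simp add: distrib_left)
  moreover have "c * bracket \<phi> u (S (\<lambda>t. d * f t)) = cnj d * (c * bracket \<phi> u (S f))"
    if "f \<in> M1 \<phi>" for f d
    using S that bracket_cmult_right[OF u M1_operatorD[OF S], of f d]
    unfolding M1_operator_def by simp
  ultimately show ?thesis unfolding antilinear_functional_def by blast
qed

lemma antilinear_functional_cong:
  assumes "antilinear_functional L" "\<And>g. g \<in> M1 \<phi> \<Longrightarrow> L' g = L g"
  shows "antilinear_functional L'"
  using assms unfolding antilinear_functional_def by (simp add: M1_add M1_cmult)

text \<open>An element of \<open>Minf\<close> is recovered from its bracket values by the definite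
  description. Since \<open>pseudodiff\<close> is such a description, this is how \<open>T f\<close>
  is identified with it.\<close>

lemma Minf_eq_Minf_by:
  assumes u: "u \<in> Minf \<phi>" and L: "\<And>g. g \<in> M1 \<phi> \<Longrightarrow> bracket \<phi> u g = L g"
  shows "u = Minf_by \<phi> L"
proof -
  have a: "antilinear_functional L"
    by (rule antilinear_functional_cong[OF antilinear_functional_bracket[OF u]]) (simp add: L)
  show ?thesis
    by (rule Minf_eqI[OF u Minf_by_works(1)[OF a]]) (simp add: L Minf_by_works(2)[OF a])
qed

lemma M1_operator_id: "M1_operator (\<lambda>f. f)"
  unfolding M1_operator_def by (auto intro!: exI[of _ 1])

text \<open>Obtained by duality: the scaled bracket is represented by some element of
  \<open>Minf\<close>, which agrees with the scaled u on every test function.\<close>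

lemma scale_distr_Minf:
  assumes u: "u \<in> Minf \<phi>"
  shows "scale_distr c u \<in> Minf \<phi>"
proof -
  let ?v = "Minf_by \<phi> (\<lambda>g. c * bracket \<phi> u g)"
  have a: "antilinear_functional (\<lambda>g. c * bracket \<phi> u g)"
    by (rule antilinear_functional_operator[OF M1_operator_id u])
  have v: "?v \<in> Minf \<phi>" by (rule Minf_by_works(1)[OF a])
  have "scale_distr c u \<psi> = ?v \<psi>" for \<psi>
  proof (cases "\<psi> \<in> schwartz")
    case True
    have "?v \<psi> = bracket \<phi> ?v \<psi>" by (rule bracket_schwartz[OF v True, symmetric])
    also have "\<dots> = c * bracket \<phi> u \<psi>" by (rule Minf_by_works(2)[OF a schwartz_M1[OF \<phi> True]])
    also have "\<dots> = c * u \<psi>" by (simp add: bracket_schwartz[OF u True])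
    finally show ?thesis by (simp add: scale_distr_def)
  next
    case False
    then show ?thesis
      using temperedD(1)[OF MinfD(1)[OF u] False] temperedD(1)[OF MinfD(1)[OF v] False] by (simp add: scale_distr_def)
  qed
  then have "scale_distr c u = ?v" by (rule ext)
  with v show ?thesis by simp
qed

text \<open>Composition with L carries a shift of \<phi> to a shift of \<phi> composed with L, the
  position moved by the inverse and the frequency by the adjoint; \<open>synthesis\<close> then
  gives the bound.\<close>

lemma M1_operator_linear:
  fixes L :: "'a \<Rightarrow> 'a"
  assumes L: "linear L" "linear L'" "\<And>x. L (L' x) = x" "\<And>x. L' (L x) = x"
  shows "M1_operator (\<lambda>f t. f (L t))"
proof -
  let ?\<eta> = "\<lambda>t. \<phi> (L t)"
  let ?h = "\<lambda>w. (L' (fst w), adjoint L (snd w))"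
  have \<eta>: "?\<eta> \<in> schwartz" by (rule schwartz_linear[OF \<phi> L(1,2,4)])
  have hc: "continuous_on UNIV ?h"
  proof -
    have c: "continuous_on UNIV L'" "continuous_on UNIV (adjoint L)"
      using L(2) adjoint_linear[OF L(1)] by (simp_all add: linear_continuous_on linear_conv_bounded_linear)
    show ?thesis
      by (intro continuous_on_Pair continuous_on_compose2[OF c(1) continuous_on_fst[OF continuous_on_id]]
          continuous_on_compose2[OF c(2) continuous_on_snd[OF continuous_on_id]]) auto
  qed
  have h: "?h \<in> borel_measurable borel" by (rule borel_measurable_continuous_onI[OF hc])
  have tfs: "tfs w \<phi> (L t) = tfs (?h w) ?\<eta> t" for w t
    by (simp add: tfs_apply adjoint_works[OF L(1)] linear_diff[OF L(1)] L(3))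
  have *: "(\<lambda>t. f (L t)) \<in> M1 \<phi> \<and> M1_norm \<phi> (\<lambda>t. f (L t)) \<le> (M1_norm \<phi> ?\<eta> / window_sq \<phi>) * M1_norm \<phi> f" if f: "f \<in> M1 \<phi>" for f
  proof -
    obtain F where F: "integrable lborel F" "f = (\<lambda>t. LINT w|lborel. F w * tfs w \<phi> t)"
      "(LINT w|lborel. norm (F w)) = M1_norm \<phi> f / window_sq \<phi>"
      using M1_synthesis_obtain[OF f] by blast
    have "(\<lambda>t. f (L t)) = (\<lambda>t. LINT w|lborel. F w * tfs (?h w) ?\<eta> t)"
      by (subst F(2)) (simp only: tfs)
    with synthesis(1,2)[OF \<phi> \<eta> F(1) h] show ?thesis by (simp add: F(3) mult_ac)
  qed
  moreover have "0 \<le> M1_norm \<phi> ?\<eta> / window_sq \<phi>"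
    by (rule divide_nonneg_pos[OF M1_norm_nonneg window_sq_pos[OF \<phi> \<phi>_nz]])
  ultimately show ?thesis unfolding M1_operator_def by blast
qed

end

text \<open>\<open>synthesis\<close>, with \<psi> as analysing window, applies to an expansion in
  shifts of \<phi>. The kernel theorem uses this to replace the given window by a tensor.\<close>

lemma M1_change_window:
  assumes "window \<phi>" "window \<psi>"
  shows "f \<in> M1 \<phi> \<Longrightarrow> f \<in> M1 \<psi>"
    and "\<exists>C\<ge>0. \<forall>f\<in>M1 \<phi>. M1_norm \<psi> f \<le> C * M1_norm \<phi> f"
proof -
  interpret \<phi>: window \<phi> by fact
  interpret \<psi>: window \<psi> by fact
  have *: "f \<in> M1 \<psi> \<and> M1_norm \<psi> f \<le> (M1_norm \<psi> \<phi> / window_sq \<phi>) * M1_norm \<phi> f" if f: "f \<in> M1 \<phi>" for f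
  proof -
    obtain F where F: "integrable lborel F" "f = (\<lambda>t. LINT w|lborel. F w * tfs w \<phi> t)"
      "(LINT w|lborel. norm (F w)) = M1_norm \<phi> f / window_sq \<phi>"
      using \<phi>.M1_synthesis_obtain[OF f] by blast
    have id: "(\<lambda>w. w) \<in> borel_measurable borel" by simp
    show ?thesis
      using synthesis(1,2)[OF \<psi>.\<phi> \<phi>.\<phi> F(1) id] F(2)[symmetric] by (simp add: F(3) mult_ac)
  qed
  then show "f \<in> M1 \<phi> \<Longrightarrow> f \<in> M1 \<psi>" by blast
  have "0 \<le> M1_norm \<psi> \<phi> / window_sq \<phi>"
    by (rule divide_nonneg_pos[OF M1_norm_nonneg window_sq_pos[OF \<phi>.\<phi> \<phi>.\<phi>_nz]])
  with * show "\<exists>C\<ge>0. \<forall>f\<in>M1 \<phi>. M1_norm \<psi> f \<le> C * M1_norm \<phi> f" by blast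
qed

section \<open>The partial Fourier transform\<close>

lemma fourier2_eq: "fourier2 f z = (LINT t|lborel. cis (- (2 * pi * (snd z \<bullet> t))) * f (fst z, t))"
  by (simp add: fourier2_def case_prod_beta)

lemma inv_fourier2_eq: "inv_fourier2 f z = fourier2 f (fst z, - snd z)"
  by (simp add: fourier2_def inv_fourier2_def case_prod_beta inner_commute)

lemma schwartz_section_bound:
  fixes f :: "'a::euclidean_space \<times> 'b::euclidean_space \<Rightarrow> complex"
  assumes "f \<in> schwartz"
  obtains K where "K \<ge> 0" "\<And>x t. (1 + norm x) ^ n * norm (f (x, t)) \<le> K * (1 / (1 + norm t) ^ m)"
proof -
  obtain K where K: "K > 0" "\<And>z. (1 + norm z) ^ (n + m) * norm (f z) \<le> K" using schwartz_decay[OF assms] by blast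
  have "(1 + norm x) ^ n * norm (f (x, t)) \<le> K * (1 / (1 + norm t) ^ m)" for x t
  proof -
    have "(1 + norm x) ^ n * (1 + norm t) ^ m \<le> (1 + norm (x, t)) ^ n * (1 + norm (x, t)) ^ m"
      using norm_fst_snd_le[of "(x, t)"] by (intro mult_mono power_mono) auto
    then have "(1 + norm x) ^ n * (1 + norm t) ^ m * norm (f (x, t)) \<le> (1 + norm (x, t)) ^ (n + m) * norm (f (x, t))"
      unfolding power_add by (intro mult_right_mono) auto
    with K(2)[of "(x, t)"] have "(1 + norm x) ^ n * norm (f (x, t)) * (1 + norm t) ^ m \<le> K"
      by (simp add: mult_ac)
    moreover have "0 < (1 + norm t) ^ m" by (simp add: add_pos_nonneg)
    ultimately show ?thesis by (simp add: pos_le_divide_eq)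
  qed
  then show ?thesis using that[of K] K(1) by simp
qed

lemma schwartz_section_measurable:
  fixes f :: "'a::euclidean_space \<times> 'b::euclidean_space \<Rightarrow> complex"
  assumes "f \<in> schwartz"
  shows "(\<lambda>t. f (x, t)) \<in> borel_measurable borel"
  by (intro borel_measurable_continuous_onI continuous_on_compose2[OF schwartz_continuous[OF assms]] continuous_intros) auto

lemma schwartz_section_integrable:
  fixes f :: "'a::euclidean_space \<times> 'b::euclidean_space \<Rightarrow> complex"
  assumes "f \<in> schwartz"
  shows "integrable lborel (\<lambda>t. f (x, t))"
proof -
  obtain K where K: "\<And>x t. (1 + norm x) ^ 0 * norm (f (x, t)) \<le> K * (1 / (1 + norm t) ^ (2 * DIM('b)))"
    using schwartz_section_bound[OF assms, of 0 "2 * DIM('b)"] by blast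
  show ?thesis
  proof (rule Bochner_Integration.integrable_bound)
    show "integrable lborel (\<lambda>t::'b. K * (1 / (1 + norm t) ^ (2 * DIM('b))))"
      by (intro integrable_mult_right integrable_inverse_weight)
    show "AE t in lborel. norm (f (x, t)) \<le> norm (K * (1 / (1 + norm t) ^ (2 * DIM('b))))"
    proof (rule AE_I2)
      fix t
      have "norm (f (x, t)) \<le> K * (1 / (1 + norm t) ^ (2 * DIM('b)))" using K[of x t] by simp
      then show "norm (f (x, t)) \<le> norm (K * (1 / (1 + norm t) ^ (2 * DIM('b))))"
        by (rule order_trans) (simp only: real_norm_def abs_ge_self)
    qed
  qed (simp add: schwartz_section_measurable[OF assms])
qed

lemma cis_mult_integrable:
  fixes g :: "'a::euclidean_space \<Rightarrow> complex"
  assumes "integrable lborel g"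
  shows "integrable lborel (\<lambda>t. cis (- (2 * pi * (w \<bullet> t))) * g t)"
  by (rule integrable_bounded_mult[of _ 1, OF _ _ assms]) auto

lemma has_derivative_fourier2:
  fixes f :: "('d::finite) phase \<Rightarrow> complex"
  assumes f: "f \<in> schwartz"
  shows "(fourier2 f has_derivative (\<lambda>h. LINT t|lborel. cis (- (2 * pi * (snd z \<bullet> t))) * (\<Sum>b\<in>Basis. ((fst h, 0) \<bullet> b) *\<^sub>R pd b f (fst z, t))
      + - (2 * pi * \<i> * of_real (snd h \<bullet> t)) * (cis (- (2 * pi * (snd z \<bullet> t))) * f (fst z, t)))) (at z)"
proof -
  let ?D = "2 * DIM(real^'d)"
  let ?W = "\<lambda>t::real^'d. 1 / (1 + norm t) ^ ?D"
  \<comment> \<open>One power more than integrability in t requires, because differentiating in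
    frequency brings down a factor t.\<close>
  obtain K where K: "K \<ge> 0" "\<And>x t. (1 + norm x) ^ 0 * norm (f (x, t)) \<le> K * (1 / (1 + norm t) ^ (Suc ?D))"
    using schwartz_section_bound[OF f, of 0 "Suc ?D"] by blast
  have "\<forall>b\<in>Basis. \<exists>L\<ge>0. \<forall>x t. norm (pd b f (x, t)) \<le> L * ?W t"
  proof
    fix b :: "'d phase" assume b: "b \<in> Basis"
    obtain L where L: "L \<ge> 0" "\<And>x t. (1 + norm x) ^ 0 * norm (pd b f (x, t)) \<le> L * ?W t"
      using schwartz_section_bound[OF schwartz_pd[OF f b], of 0 ?D] by blast
    then show "\<exists>L\<ge>0. \<forall>x t. norm (pd b f (x, t)) \<le> L * ?W t" by (intro exI[of _ L]) simp
  qed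
  from bchoice[OF this] obtain L where L: "\<And>b. b \<in> Basis \<Longrightarrow> L b \<ge> 0" "\<And>b x t. b \<in> Basis \<Longrightarrow> norm (pd b f (x, t)) \<le> L b * ?W t"
    by blast
  let ?f' = "\<lambda>z t h. cis (- (2 * pi * (snd z \<bullet> t))) * (\<Sum>b\<in>Basis. ((fst h, 0) \<bullet> b) *\<^sub>R pd b f (fst z, t))
      + - (2 * pi * \<i> * of_real (snd h \<bullet> t)) * (cis (- (2 * pi * (snd z \<bullet> t))) * f (fst z, t))"
  have "((\<lambda>z. LINT t|lborel. cis (- (2 * pi * (snd z \<bullet> t))) * f (fst z, t)) has_derivative (\<lambda>h. LINT t|lborel. ?f' z t h)) (at z)"
  proof (rule has_derivative_integral[where G = "\<lambda>t. ((\<Sum>b\<in>Basis. L b) + 2 * pi * K) * ?W t"])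
    fix z :: "'d phase" and t :: "real^'d"
    have "((\<lambda>z::'d phase. - (2 * pi * (snd z \<bullet> t))) has_derivative (\<lambda>h. - (2 * pi * (snd h \<bullet> t)))) (at z)"
      by (auto intro!: derivative_eq_intros)
    then have 1: "((\<lambda>z::'d phase. cis (- (2 * pi * (snd z \<bullet> t)))) has_derivative (\<lambda>h. (- (2 * pi * (snd h \<bullet> t))) *\<^sub>R (\<i> * cis (- (2 * pi * (snd z \<bullet> t)))))) (at z)"
      by (rule has_derivative_cis)
    have 2: "((\<lambda>z. f (fst z, t)) has_derivative (\<lambda>h. \<Sum>b\<in>Basis. ((fst h, 0) \<bullet> b) *\<^sub>R pd b f (fst z, t))) (at z)"
      by (rule has_derivative_compose[OF _ schwartz_has_derivative[OF f]]) (auto intro!: derivative_eq_intros)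
    show "((\<lambda>z. cis (- (2 * pi * (snd z \<bullet> t))) * f (fst z, t)) has_derivative ?f' z t) (at z)"
      by (rule has_derivative_eq_rhs[OF has_derivative_mult[OF 1 2]]) (simp add: fun_eq_iff scaleR_conv_of_real mult_ac)
  next
    show "integrable lborel (\<lambda>t. cis (- (2 * pi * (snd z \<bullet> t))) * f (fst z, t))" for z
      by (intro cis_mult_integrable schwartz_section_integrable f)
  next
    fix z h :: "'d phase"
    have [measurable]: "(\<lambda>t. f (fst z, t)) \<in> borel_measurable borel" by (rule schwartz_section_measurable[OF f])
    have "(\<lambda>t. pd b f (fst z, t)) \<in> borel_measurable borel" if "b \<in> Basis" for b
      by (rule schwartz_section_measurable[OF schwartz_pd[OF f that]])
    then have [measurable]: "(\<lambda>t. \<Sum>b\<in>Basis. ((fst h, 0) \<bullet> b) *\<^sub>R pd b f (fst z, t)) \<in> borel_measurable borel"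
      by (intro borel_measurable_sum borel_measurable_scaleR) auto
    show "(\<lambda>t. ?f' z t h) \<in> borel_measurable lborel" by measurable
  next
    fix z h :: "'d phase" and t :: "real^'d"
    have "norm (?f' z t h) \<le> norm (\<Sum>b\<in>Basis. ((fst h, 0) \<bullet> b) *\<^sub>R pd b f (fst z, t)) + 2 * pi * \<bar>snd h \<bullet> t\<bar> * norm (f (fst z, t))"
      by (rule norm_triangle_le) (simp add: norm_mult del: partials.simps)
    also have "\<dots> \<le> (\<Sum>b\<in>Basis. norm h * (L b * ?W t)) + 2 * pi * (norm h * (1 + norm t)) * (K * (1 / (1 + norm t) ^ (Suc ?D)))"
    proof (intro add_mono mult_mono)
      show "norm (\<Sum>b\<in>Basis. ((fst h, 0) \<bullet> b) *\<^sub>R pd b f (fst z, t)) \<le> (\<Sum>b\<in>Basis. norm h * (L b * ?W t))"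
      proof (rule sum_norm_le)
        fix b :: "'d phase" assume b: "b \<in> Basis"
        have "\<bar>(fst h, 0) \<bullet> b\<bar> \<le> norm (fst h, 0::real^'d)" by (rule Basis_le_norm[OF b])
        also have "\<dots> \<le> norm h" using norm_fst_snd_le(1)[of h] by (simp add: norm_Pair)
        finally have "\<bar>(fst h, 0) \<bullet> b\<bar> * norm (pd b f (fst z, t)) \<le> norm h * (L b * ?W t)"
          by (intro mult_mono L b) auto
        then show "norm (((fst h, 0) \<bullet> b) *\<^sub>R pd b f (fst z, t)) \<le> norm h * (L b * ?W t)"
          by (simp only: norm_scaleR)
      qed
      have "\<bar>snd h \<bullet> t\<bar> \<le> norm (snd h) * norm t" by (rule Cauchy_Schwarz_ineq2)
      also have "\<dots> \<le> norm h * (1 + norm t)" by (intro mult_mono norm_fst_snd_le) auto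
      finally show "\<bar>snd h \<bullet> t\<bar> \<le> norm h * (1 + norm t)" .
      show "norm (f (fst z, t)) \<le> K * (1 / (1 + norm t) ^ (Suc ?D))" using K(2)[of "fst z" t] by simp
    qed (auto simp: K)
    also have "2 * pi * (norm h * (1 + norm t)) * (K * (1 / (1 + norm t) ^ (Suc ?D))) = norm h * (2 * pi * K * ?W t)"
      using norm_ge_zero[of t] by (simp add: add_nonneg_eq_0_iff)
    also have "(\<Sum>b\<in>Basis. norm h * (L b * ?W t)) + norm h * (2 * pi * K * ?W t) = ((\<Sum>b\<in>Basis. L b) + 2 * pi * K) * ?W t * norm h"
      by (simp only: sum_distrib_left[symmetric] sum_distrib_right[symmetric] distrib_right distrib_left mult_ac)
    finally show "norm (?f' z t h) \<le> ((\<Sum>b\<in>Basis. L b) + 2 * pi * K) * ?W t * norm h" .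
  qed (intro integrable_mult_right integrable_inverse_weight)
  then show ?thesis by (simp only: fourier2_eq[abs_def])
qed

lemma pd_fourier2:
  fixes f :: "('d::finite) phase \<Rightarrow> complex"
  assumes f: "f \<in> schwartz" and b: "b \<in> Basis"
  shows "pd (b, 0) (fourier2 f) = fourier2 (pd (b, 0) f)"
    and "pd (0, b) (fourier2 f) = fourier2 (\<lambda>z. - (2 * pi * \<i>) * (of_real (z \<bullet> (0, b)) * f z))"
proof -
  have bB: "(b, 0) \<in> (Basis :: 'd phase set)" using b by (simp add: Basis_prod_def)
  have 1: "(\<Sum>c\<in>Basis. ((b, 0) \<bullet> c) *\<^sub>R pd c f (x, t)) = pd (b, 0) f (x, t)" for x t
    by (rule sum_Basis_pd[OF bB])
  show "pd (b, 0) (fourier2 f) = fourier2 (pd (b, 0) f)"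
    by (subst pd_eqI, rule has_derivative_fourier2[OF f]) (simp add: fun_eq_iff fourier2_eq 1 del: partials.simps)
  have 2: "(\<Sum>c\<in>Basis. ((0, 0) \<bullet> c) *\<^sub>R pd c f (x, t)) = 0" for x t
    by (simp add: zero_prod_def[symmetric])
  show "pd (0, b) (fourier2 f) = fourier2 (\<lambda>z. - (2 * pi * \<i>) * (of_real (z \<bullet> (0, b)) * f z))"
    by (subst pd_eqI, rule has_derivative_fourier2[OF f])
      (simp add: fun_eq_iff fourier2_eq 2 inner_commute[of b] mult_ac del: partials.simps)
qed

text \<open>Integration by parts in the second variable. Read from right to left it trades powers of
  the frequency for derivatives, which gives the decay in \<open>fourier2_decay\<close>.\<close>

lemma fourier2_pd:
  fixes f :: "('d::finite) phase \<Rightarrow> complex"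
  assumes f: "f \<in> schwartz" and b: "b \<in> Basis"
  shows "fourier2 (pd (0, b) f) z = 2 * pi * \<i> * of_real (snd z \<bullet> b) * fourier2 f z"
proof -
  let ?c = "2 * pi * \<i> * complex_of_real (snd z \<bullet> b)"
  let ?e = "\<lambda>t. cis (- (2 * pi * (snd z \<bullet> t)))"
  have bB: "(0, b) \<in> (Basis :: 'd phase set)" using b by (simp add: Basis_prod_def)
  define h' where "h' t h = ?e t * (\<Sum>c\<in>Basis. ((0, h) \<bullet> c) *\<^sub>R pd c f (fst z, t)) + ((- (2 * pi * (snd z \<bullet> h))) *\<^sub>R (\<i> * ?e t)) * f (fst z, t)" for t h
  have h': "h' t b = ?e t * pd (0, b) f (fst z, t) - ?c * (?e t * f (fst z, t))" for t
    unfolding h'_def sum_Basis_pd[OF bB] by (simp add: scaleR_conv_of_real mult_ac)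
  note i = cis_mult_integrable[OF schwartz_section_integrable[OF f, of "fst z"], of "snd z"]
    cis_mult_integrable[OF schwartz_section_integrable[OF schwartz_pd[OF f bB], of "fst z"], of "snd z"]
  have "(LINT t|lborel. h' t b) = 0"
  proof (rule integral_derivative_eq_0[where h = "\<lambda>t. ?e t * f (fst z, t)"])
    fix t
    have "((\<lambda>t. - (2 * pi * (snd z \<bullet> t))) has_derivative (\<lambda>h. - (2 * pi * (snd z \<bullet> h)))) (at t)"
      by (auto intro!: derivative_eq_intros)
    then have 1: "(?e has_derivative (\<lambda>h. (- (2 * pi * (snd z \<bullet> h))) *\<^sub>R (\<i> * ?e t))) (at t)"
      by (rule has_derivative_cis)
    have 2: "((\<lambda>t. f (fst z, t)) has_derivative (\<lambda>h. \<Sum>c\<in>Basis. ((0, h) \<bullet> c) *\<^sub>R pd c f (fst z, t))) (at t)"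
      by (rule has_derivative_compose[OF _ schwartz_has_derivative[OF f]]) (auto intro!: derivative_eq_intros)
    show "((\<lambda>t. ?e t * f (fst z, t)) has_derivative h' t) (at t)"
      unfolding h'_def[abs_def] by (rule has_derivative_mult[OF 1 2])
  next
    show "integrable lborel (\<lambda>t. h' t b)" unfolding h' by (intro Bochner_Integration.integrable_diff integrable_mult_right i)
    show "continuous_on UNIV (\<lambda>t. h' t b)" unfolding h'
      by (intro continuous_intros continuous_on_compose2[OF schwartz_continuous[OF f]]
          continuous_on_compose2[OF schwartz_continuous[OF schwartz_pd[OF f bB]]]) auto
  qed (rule i(1))
  moreover have "(LINT t|lborel. h' t b) = fourier2 (pd (0, b) f) z - ?c * fourier2 f z"
    unfolding h' fourier2_eq
    by (subst Bochner_Integration.integral_diff[OF i(2)], intro integrable_mult_right i) (simp del: partials.simps)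
  ultimately show ?thesis by simp
qed

lemma fourier2_decay:
  fixes f :: "('d::finite) phase \<Rightarrow> complex"
  assumes "f \<in> schwartz"
  shows "\<exists>K. \<forall>z. (1 + norm (snd z)) ^ m * ((1 + norm (fst z)) ^ n * norm (fourier2 f z)) \<le> K"
  using assms
proof (induction m arbitrary: f)
  case 0
  let ?D = "2 * DIM(real^'d)"
  obtain K where K: "K \<ge> 0" "\<And>x t. (1 + norm x) ^ n * norm (f (x, t)) \<le> K * (1 / (1 + norm t) ^ ?D)"
    using schwartz_section_bound[OF 0, of n ?D] by blast
  have "(1 + norm (fst z)) ^ n * norm (fourier2 f z) \<le> (LINT t|lborel. K * (1 / (1 + norm (t::real^'d)) ^ ?D))" for z
  proof -
    have n1: "norm (complex_of_real ((1 + norm (fst z)) ^ n)) = (1 + norm (fst z)) ^ n"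
      by (simp only: norm_of_real) simp
    have "norm (LINT t|lborel. of_real ((1 + norm (fst z)) ^ n) * (cis (- (2 * pi * (snd z \<bullet> t))) * f (fst z, t))) \<le> (LINT t|lborel. K * (1 / (1 + norm (t::real^'d)) ^ ?D))"
    proof (rule norm_integral_le)
      show "integrable lborel (\<lambda>t::real^'d. K * (1 / (1 + norm t) ^ ?D))" by (intro integrable_mult_right integrable_inverse_weight)
      show "norm (of_real ((1 + norm (fst z)) ^ n) * (cis (- (2 * pi * (snd z \<bullet> t))) * f (fst z, t))) \<le> K * (1 / (1 + norm t) ^ ?D)" for t
        using K(2)[of "fst z" t] by (simp only: norm_mult n1 norm_cis mult_1)
    qed
    then show ?thesis by (simp only: integral_mult_right_zero norm_mult n1 fourier2_eq)
  qed
  then show ?case unfolding power_0 mult_1 by blast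
next
  case (Suc m)
  let ?w = "\<lambda>z :: 'd phase. (1 + norm (snd z)) ^ m * (1 + norm (fst z)) ^ n"
  obtain K where K: "\<And>z. ?w z * norm (fourier2 f z) \<le> K" using Suc.IH[OF Suc.prems] unfolding mult.assoc by blast
  have "\<forall>b\<in>Basis. \<exists>L. \<forall>z. ?w z * norm (fourier2 (pd (0, b) f) z) \<le> L"
    using Suc.IH[OF schwartz_pd[OF Suc.prems]] unfolding mult.assoc Basis_prod_def by blast
  from bchoice[OF this] obtain L where L: "\<And>b z. b \<in> Basis \<Longrightarrow> ?w z * norm (fourier2 (pd (0, b) f) z) \<le> L b" by blast
  have "(1 + norm (snd z)) ^ Suc m * ((1 + norm (fst z)) ^ n * norm (fourier2 f z)) \<le> K + (\<Sum>b\<in>Basis. L b)" for z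
  proof -
    have b: "?w z * (\<bar>snd z \<bullet> b\<bar> * norm (fourier2 f z)) \<le> L b" if b: "b \<in> Basis" for b
    proof -
      have "1 * (\<bar>snd z \<bullet> b\<bar> * norm (fourier2 f z)) \<le> 2 * pi * (\<bar>snd z \<bullet> b\<bar> * norm (fourier2 f z))"
        using pi_ge_two by (intro mult_right_mono) auto
      also have "\<dots> = norm (fourier2 (pd (0, b) f) z)"
        unfolding fourier2_pd[OF Suc.prems b] by (simp add: norm_mult)
      finally have "?w z * (\<bar>snd z \<bullet> b\<bar> * norm (fourier2 f z)) \<le> ?w z * norm (fourier2 (pd (0, b) f) z)"
        by (intro mult_left_mono) auto
      with L[OF b, of z] show ?thesis by simp
    qed
    have "norm (snd z) \<le> (\<Sum>b\<in>Basis. \<bar>snd z \<bullet> b\<bar>)" by (rule norm_le_l1)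
    then have "(1 + norm (snd z)) * (?w z * norm (fourier2 f z)) \<le> (1 + (\<Sum>b\<in>Basis. \<bar>snd z \<bullet> b\<bar>)) * (?w z * norm (fourier2 f z))"
      by (intro mult_right_mono) auto
    also have "\<dots> = ?w z * norm (fourier2 f z) + (\<Sum>b\<in>Basis. ?w z * (\<bar>snd z \<bullet> b\<bar> * norm (fourier2 f z)))"
      by (simp only: distrib_right mult_1 sum_distrib_right) (simp only: mult_ac)
    also have "\<dots> \<le> K + (\<Sum>b\<in>Basis. L b)" by (intro add_mono sum_mono b K)
    finally show ?thesis by (simp add: mult_ac)
  qed
  then show ?case by blast
qed

lemma schwartz_fourier2:
  fixes f :: "('d::finite) phase \<Rightarrow> complex"
  assumes "f \<in> schwartz"
  shows "fourier2 f \<in> schwartz"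
proof (rule schwartz_coinduct[where C = "{fourier2 f | f :: 'd phase \<Rightarrow> complex. f \<in> schwartz}"], goal_cases)
  case 1 then show ?case using assms by auto
next
  case (2 h x)
  then show ?case using has_derivative_fourier2 unfolding differentiable_def by blast
next
  case (3 h b)
  then obtain f :: "'d phase \<Rightarrow> complex" where f: "f \<in> schwartz" "h = fourier2 f" by auto
  from 3(2) consider c where "c \<in> Basis" "b = (c, 0)" | c where "c \<in> Basis" "b = (0, c)"
    unfolding Basis_prod_def by auto
  then show ?case
  proof cases
    case (1 c)
    then show ?thesis using pd_fourier2(1)[OF f(1) 1(1)] schwartz_pd[OF f(1) 3(2)] f(2) by auto
  next
    case (2 c)
    then show ?thesis using pd_fourier2(2)[OF f(1) 2(1)] schwartz_cmult[OF schwartz_coord_mult[OF f(1)]] f(2) by blast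
  qed
next
  case (4 h N)
  then obtain f :: "'d phase \<Rightarrow> complex" where f: "f \<in> schwartz" "h = fourier2 f" by auto
  obtain K where K: "\<And>z. (1 + norm (snd z)) ^ N * ((1 + norm (fst z)) ^ N * norm (h z)) \<le> K"
    using fourier2_decay[OF f(1), of N N] f(2) by blast
  have "(1 + norm z) ^ N * norm (h z) \<le> K" for z
  proof -
    have "1 + norm z \<le> (1 + norm (fst z)) * (1 + norm (snd z))"
      using one_plus_norm_add[of "(fst z, 0)" "(0, snd z)"] by (simp add: norm_Pair)
    then have "(1 + norm z) ^ N * norm (h z) \<le> ((1 + norm (fst z)) * (1 + norm (snd z))) ^ N * norm (h z)"
      by (intro mult_right_mono power_mono) auto
    also have "\<dots> \<le> K" using K[of z] by (simp add: power_mult_distrib mult_ac)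
    finally show ?thesis .
  qed
  then show ?case by blast
qed

text \<open>After recentring the integral at the second position, the partial Fourier transform
  exchanges second position and second frequency, up to a sign and a phase depending only on w. So
  shifts go to multiples of shifts.\<close>

lemma fourier2_tfs:
  fixes f :: "('d::finite) phase \<Rightarrow> complex"
  assumes f: "f \<in> schwartz"
  shows "fourier2 (tfs w f) z = cis (2 * pi * (snd (fst w) \<bullet> snd (snd w))) *
     tfs ((fst (fst w), snd (snd w)), (fst (snd w), - snd (fst w))) (fourier2 f) z"
proof -
  let ?a = "fst (fst w)" and ?b = "snd (fst w)" and ?\<alpha> = "fst (snd w)" and ?\<beta> = "snd (snd w)"
  have m: "(\<lambda>t. tfs w f (fst z, t)) \<in> borel_measurable borel"
    by (rule schwartz_section_measurable[OF schwartz_tfs[OF f]])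
  have "fourier2 (tfs w f) z = (LINT t|lborel. cis (- (2 * pi * (snd z \<bullet> (t + ?b)))) * tfs w f (fst z, t + ?b))"
    unfolding fourier2_eq by (subst integral_translate[symmetric, of _ ?b]) (use m in measurable)
  also have "\<dots> = (LINT t|lborel. (cis (2 * pi * (?b \<bullet> ?\<beta>)) * cis (2 * pi * (z \<bullet> (?\<alpha>, - ?b)))) *
     (cis (- (2 * pi * (snd (z - (?a, ?\<beta>)) \<bullet> t))) * f (fst (z - (?a, ?\<beta>)), t)))"
  proof (intro Bochner_Integration.integral_cong refl)
    fix t
    have "cis (- (2 * pi * (snd z \<bullet> (t + ?b)))) * cis (2 * pi * ((fst z, t + ?b) \<bullet> snd w)) =
       cis (2 * pi * (?b \<bullet> ?\<beta>)) * cis (2 * pi * (z \<bullet> (?\<alpha>, - ?b))) * cis (- (2 * pi * (snd (z - (?a, ?\<beta>)) \<bullet> t)))"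
      by (simp add: cis_mult inner_prod_def inner_simps inner_commute algebra_simps)
    moreover have "(fst z, t + ?b) - fst w = (fst (z - (?a, ?\<beta>)), t)" by (simp add: prod_eq_iff)
    ultimately show "cis (- (2 * pi * (snd z \<bullet> (t + ?b)))) * tfs w f (fst z, t + ?b) =
      (cis (2 * pi * (?b \<bullet> ?\<beta>)) * cis (2 * pi * (z \<bullet> (?\<alpha>, - ?b)))) *
     (cis (- (2 * pi * (snd (z - (?a, ?\<beta>)) \<bullet> t))) * f (fst (z - (?a, ?\<beta>)), t))"
      unfolding tfs_apply by (simp only: mult.assoc[symmetric])
  qed
  also have "\<dots> = (cis (2 * pi * (?b \<bullet> ?\<beta>)) * cis (2 * pi * (z \<bullet> (?\<alpha>, - ?b)))) * fourier2 f (z - (?a, ?\<beta>))"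
    unfolding fourier2_eq by (rule integral_mult_right_zero)
  finally show ?thesis by (simp only: tfs_apply fst_conv snd_conv mult.assoc)
qed

text \<open>With x frozen, the integral over t of the modulus of a shift is bounded independently of
  its parameters, so the superposition is integrable jointly in parameter and t. This licenses
  exchanging \<open>fourier2\<close> with the superposition and makes every slice of an
  \<open>M1\<close> function integrable.\<close>

lemma M1_section:
  fixes \<psi> :: "('d::finite) phase \<Rightarrow> complex" and F :: "'d phase \<times> 'd phase \<Rightarrow> complex"
  assumes \<psi>: "\<psi> \<in> schwartz" and F: "integrable lborel F"
  shows "integrable lborel (\<lambda>(w, t). F w * tfs w \<psi> (x, t))"
proof -
  let ?D = "2 * DIM(real^'d)"
  have [measurable]: "F \<in> borel_measurable borel" using F by auto
  note [measurable] = schwartz_measurable[OF \<psi>]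
  obtain K where K: "K \<ge> 0" "\<And>x t. (1 + norm x) ^ 0 * norm (\<psi> (x, t)) \<le> K * (1 / (1 + norm t) ^ ?D)"
    using schwartz_section_bound[OF \<psi>, of 0 ?D] by blast
  let ?W = "LINT t|lborel. K * (1 / (1 + norm (t::real^'d)) ^ ?D)"
  have W: "integrable lborel (\<lambda>t::real^'d. K * (1 / (1 + norm t) ^ ?D))"
    by (intro integrable_mult_right integrable_inverse_weight)
  have m: "(\<lambda>(w, t). F w * tfs w \<psi> (x, t)) \<in> borel_measurable (borel \<Otimes>\<^sub>M borel)"
    unfolding case_prod_beta tfs_apply by measurable
  have le: "(LINT t|lborel. norm (tfs w \<psi> (x, t))) \<le> ?W" for w
  proof -
    have "(LINT t|lborel. norm (tfs w \<psi> (x, t))) = (LINT t|lborel. norm (\<psi> (x - fst (fst w), t + - snd (fst w))))"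
    proof -
      have "(x, t) - fst w = (x - fst (fst w), t + - snd (fst w))" for t by (simp add: prod_eq_iff)
      then show ?thesis by (simp only: norm_tfs)
    qed
    also have "\<dots> = (LINT t|lborel. norm (\<psi> (x - fst (fst w), t)))"
      by (rule integral_translate[of "\<lambda>t. norm (\<psi> (x - fst (fst w), t))"])
        (use schwartz_section_measurable[OF \<psi>, of "x - fst (fst w)"] in measurable)
    also have "\<dots> \<le> ?W"
      by (rule integral_mono'[OF W]) (use K in auto)
    finally show ?thesis .
  qed
  show ?thesis
  proof (rule lborel_pair_integrableI)
    show "(\<lambda>(w, t). F w * tfs w \<psi> (x, t)) \<in> borel_measurable borel" using m by (simp add: borel_prod)
    show "integrable lborel (\<lambda>t. F w * tfs w \<psi> (x, t))" for w
      by (intro integrable_mult_right schwartz_section_integrable schwartz_tfs \<psi>)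
    show "integrable lborel (\<lambda>w. LINT t|lborel. norm (F w * tfs w \<psi> (x, t)))"
    proof (rule Bochner_Integration.integrable_bound)
      show "integrable lborel (\<lambda>w. norm (F w) * ?W)" using F by (intro integrable_mult_left integrable_norm)
      show "AE w in lborel. norm (LINT t|lborel. norm (F w * tfs w \<psi> (x, t))) \<le> norm (norm (F w) * ?W)"
      proof (rule AE_I2)
        fix w
        have "(LINT t|lborel. norm (F w * tfs w \<psi> (x, t))) = norm (F w) * (LINT t|lborel. norm (tfs w \<psi> (x, t)))"
          by (simp only: norm_mult integral_mult_right_zero)
        moreover have "0 \<le> (LINT t|lborel. norm (tfs w \<psi> (x, t)))" by (intro Bochner_Integration.integral_nonneg) auto
        ultimately show "norm (LINT t|lborel. norm (F w * tfs w \<psi> (x, t))) \<le> norm (norm (F w) * ?W)"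
          using le[of w] by (simp add: abs_mult mult_left_mono)
      qed
      have "(\<lambda>(w, t). norm (F w * tfs w \<psi> (x, t))) \<in> borel_measurable (borel \<Otimes>\<^sub>M lborel)"
        using measurable_compose[OF m borel_measurable_norm] by (simp add: case_prod_beta)
      then show "(\<lambda>w. LINT t|lborel. norm (F w * tfs w \<psi> (x, t))) \<in> borel_measurable lborel"
        using lborel.borel_measurable_lebesgue_integral by simp
    qed
  qed
qed

lemma M1_section_integrable:
  fixes \<psi> :: "('d::finite) phase \<Rightarrow> complex"
  assumes "window \<psi>" and f: "f \<in> M1 \<psi>"
  shows "integrable lborel (\<lambda>t. f (x, t))"
proof -
  interpret window \<psi> by fact
  obtain F where F: "integrable lborel F" "f = (\<lambda>t. LINT w|lborel. F w * tfs w \<psi> t)"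
    using M1_synthesis_obtain[OF f] by blast
  have "integrable lborel (\<lambda>(t, w). F w * tfs w \<psi> (x, t))"
    using lborel_pair.integrable_product_swap[of "\<lambda>(w, t). F w * tfs w \<psi> (x, t)"] M1_section[OF \<phi> F(1), of x]
    by (simp add: lborel_prod)
  then show ?thesis
    using lborel_pair.integrable_fst'[of "\<lambda>(t, w). F w * tfs w \<psi> (x, t)"] unfolding F(2) by (simp add: lborel_prod)
qed

text \<open>By \<open>fourier2_tfs\<close> the image is again a superposition, with parameters
  relabelled by \<open>?h\<close>; the phase \<open>?p\<close> has modulus 1 and is absorbed into
  the coefficients.\<close>

lemma M1_operator_fourier2:
  fixes \<psi> :: "('d::finite) phase \<Rightarrow> complex"
  assumes w: "window \<psi>"
  shows "window.M1_operator \<psi> fourier2"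
proof -
  interpret window \<psi> by fact
  let ?\<eta> = "fourier2 \<psi>"
  let ?p = "\<lambda>w :: 'd phase \<times> 'd phase. cis (2 * pi * (snd (fst w) \<bullet> snd (snd w)))"
  let ?h = "\<lambda>w :: 'd phase \<times> 'd phase. ((fst (fst w), snd (snd w)), (fst (snd w), - snd (fst w)))"
  have \<eta>: "?\<eta> \<in> schwartz" by (rule schwartz_fourier2[OF \<phi>])
  have h: "?h \<in> borel_measurable borel" by (intro borel_measurable_continuous_onI continuous_intros)
  have pm: "?p \<in> borel_measurable borel" by (intro borel_measurable_continuous_onI continuous_intros)
  have *: "fourier2 f \<in> M1 \<psi> \<and> M1_norm \<psi> (fourier2 f) \<le> (M1_norm \<psi> ?\<eta> / window_sq \<psi>) * M1_norm \<psi> f" if f: "f \<in> M1 \<psi>" for f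
  proof -
    obtain F where F: "integrable lborel F" "f = (\<lambda>t. LINT w|lborel. F w * tfs w \<psi> t)"
      "(LINT w|lborel. norm (F w)) = M1_norm \<psi> f / window_sq \<psi>"
      using M1_synthesis_obtain[OF f] by blast
    have Fp: "integrable lborel (\<lambda>w. ?p w * F w)"
      by (rule integrable_bounded_mult[OF pm _ F(1), of 1]) simp
    have "fourier2 f z = (LINT w|lborel. (?p w * F w) * tfs (?h w) ?\<eta> z)" for z
    proof -
      let ?e = "\<lambda>t. cis (- (2 * pi * (snd z \<bullet> t)))"
      have i: "integrable lborel (\<lambda>(w, t). ?e t * (F w * tfs w \<psi> (fst z, t)))"
      proof -
        have "integrable lborel (\<lambda>x. ?e (snd x) * (case x of (w, t) \<Rightarrow> F w * tfs w \<psi> (fst z, t)))"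
          by (rule integrable_bounded_mult[OF _ _ M1_section[OF \<phi> F(1)], of _ 1]) auto
        then show ?thesis unfolding case_prod_beta .
      qed
      have "fourier2 f z = (LINT t|lborel. LINT w|lborel. ?e t * (F w * tfs w \<psi> (fst z, t)))"
        unfolding fourier2_eq F(2) by simp
      also have "\<dots> = (LINT w|lborel. LINT t|lborel. ?e t * (F w * tfs w \<psi> (fst z, t)))"
        by (rule lborel_pair_swap[OF i, symmetric])
      also have "\<dots> = (LINT w|lborel. F w * fourier2 (tfs w \<psi>) z)"
        unfolding fourier2_eq by (simp add: mult.left_commute)
      also have "\<dots> = (LINT w|lborel. (?p w * F w) * tfs (?h w) ?\<eta> z)"
        unfolding fourier2_tfs[OF \<phi>] by (simp only: mult_ac)
      finally show ?thesis .
    qed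
    then have eq: "fourier2 f = (\<lambda>z. LINT w|lborel. (?p w * F w) * tfs (?h w) ?\<eta> z)" by (rule ext)
    show ?thesis
      using synthesis(1,2)[OF \<phi> \<eta> Fp h] unfolding eq[symmetric] by (simp add: F(3) norm_mult mult_ac)
  qed
  have add: "fourier2 (\<lambda>t. f t + g t) = (\<lambda>t. fourier2 f t + fourier2 g t)" if "f \<in> M1 \<psi>" "g \<in> M1 \<psi>" for f g
    using cis_mult_integrable[OF M1_section_integrable[OF w that(1)]] cis_mult_integrable[OF M1_section_integrable[OF w that(2)]]
    by (simp add: fun_eq_iff fourier2_eq distrib_left)
  have cm: "fourier2 (\<lambda>t. c * f t) = (\<lambda>t. c * fourier2 f t)" for c and f :: "'d phase \<Rightarrow> complex"
    by (simp add: fun_eq_iff fourier2_eq mult.left_commute[of _ c])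
  have "0 \<le> M1_norm \<psi> ?\<eta> / window_sq \<psi>"
    by (rule divide_nonneg_pos[OF M1_norm_nonneg window_sq_pos[OF \<phi> \<phi>_nz]])
  with * add cm show ?thesis unfolding M1_operator_def by blast
qed

lemma M1_operator_inv_fourier2:
  fixes \<psi> :: "('d::finite) phase \<Rightarrow> complex"
  assumes w: "window \<psi>"
  shows "window.M1_operator \<psi> inv_fourier2"
proof -
  interpret window \<psi> by fact
  have l: "linear (\<lambda>z :: 'd phase. (fst z, - snd z))"
    by (rule linearI) auto
  have "M1_operator (\<lambda>f t. f (fst t, - snd t))"
    by (rule M1_operator_linear[OF l l]) auto
  from M1_operator_comp[OF this M1_operator_fourier2[OF w]] show ?thesis
    by (simp add: inv_fourier2_eq[abs_def])
qed

text \<open>Fourier inversion on each slice. Its hypotheses hold on every slice, not just almost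
  every one, because f and \<open>fourier2 f\<close> both lie in \<open>M1\<close>.\<close>

lemma inv_fourier2_fourier2:
  fixes \<psi> :: "('d::finite) phase \<Rightarrow> complex"
  assumes w: "window \<psi>" and f: "f \<in> M1 \<psi>"
  shows "inv_fourier2 (fourier2 f) = f"
proof
  interpret window \<psi> by fact
  fix z :: "'d phase"
  have F: "fourier2 f \<in> M1 \<psi>" using M1_operatorD[OF M1_operator_fourier2[OF w] f] .
  have H: "(LINT s|lborel. f (fst z, s) * cis (- (2 * pi * (s \<bullet> \<omega>)))) = fourier2 f (fst z, \<omega>)" for \<omega>
    by (simp add: fourier2_eq mult.commute inner_commute)
  have "f (fst z, snd z) = (LINT \<omega>|lborel. (LINT s|lborel. f (fst z, s) * cis (- (2 * pi * (s \<bullet> \<omega>)))) * cis (2 * pi * (snd z \<bullet> \<omega>)))"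
  proof (rule fourier_inversion)
    show "integrable lborel (\<lambda>s. f (fst z, s))" by (rule M1_section_integrable[OF w f])
    show "continuous_on UNIV (\<lambda>s. f (fst z, s))"
      by (rule continuous_on_compose2[OF M1D(1)[OF f \<phi>]]) (auto intro!: continuous_intros)
    show "integrable lborel (\<lambda>\<omega>. LINT s|lborel. f (fst z, s) * cis (- (2 * pi * (s \<bullet> \<omega>))))"
      unfolding H by (rule M1_section_integrable[OF w F])
  qed
  then show "inv_fourier2 (fourier2 f) z = f z"
    unfolding H by (simp add: inv_fourier2_def case_prod_beta mult.commute inner_commute)
qed

section \<open>Tensor products\<close>

lemma lborel_pair_integral_mult:
  fixes f :: "'a::euclidean_space \<Rightarrow> complex" and g :: "'b::euclidean_space \<Rightarrow> complex"
  assumes "integrable lborel f" "integrable lborel g"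
  shows "(LINT z|lborel. f (fst z) * g (snd z)) = (LINT x|lborel. f x) * (LINT y|lborel. g y)"
  using lborel_pair_integral[OF lborel_pair_integrable_mult[OF assms]] by (simp add: case_prod_beta)

text \<open>Conjugation reverses modulations, which accounts for the minus sign in the second
  frequency. Taking \<phi> with its own conjugate matches the tensors of g with the conjugate of f
  on which the kernel is tested.\<close>

lemma tfs_tensor_cnj:
  "tfs v (tensor \<phi> (\<lambda>t. cnj (\<phi> t))) z =
     tfs (fst (fst v), fst (snd v)) \<phi> (fst z) * cnj (tfs (snd (fst v), - snd (snd v)) \<phi> (snd z))"
proof -
  have "cis (2 * pi * (z \<bullet> snd v)) = cis (2 * pi * (fst z \<bullet> fst (snd v))) * cis (2 * pi * (snd z \<bullet> snd (snd v)))"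
    by (simp add: cis_mult inner_prod_def algebra_simps)
  then show ?thesis by (simp add: tfs_apply tensor_def case_prod_beta cis_cnj mult_ac)
qed

text \<open>The product of the expansions of g and of the conjugate of f is a single superposition
  over pairs of parameters, built from shifts of the tensor window.\<close>

lemma tensor_M1:
  fixes \<phi> :: "'a::euclidean_space \<Rightarrow> complex"
  assumes "window \<phi>" "\<psi> \<in> schwartz" and f: "f \<in> M1 \<phi>" and g: "g \<in> M1 \<phi>"
  shows "tensor g (\<lambda>y. cnj (f y)) \<in> M1 \<psi>"
proof -
  interpret window \<phi> by fact
  obtain F where F: "integrable lborel F" "f = (\<lambda>t. LINT w|lborel. F w * tfs w \<phi> t)"
    using M1_synthesis_obtain[OF f] by blast
  obtain G where G: "integrable lborel G" "g = (\<lambda>t. LINT w|lborel. G w * tfs w \<phi> t)"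
    using M1_synthesis_obtain[OF g] by blast
  let ?\<eta> = "tensor \<phi> (\<lambda>t. cnj (\<phi> t))"
  let ?h = "\<lambda>v :: ('a \<times> 'a) \<times> ('a \<times> 'a). ((fst (fst v), fst (snd v)), (snd (fst v), - snd (snd v)))"
  let ?H = "\<lambda>v. G (fst v) * cnj (F (snd v))"
  have h: "?h \<in> borel_measurable borel" by (intro borel_measurable_continuous_onI continuous_intros)
  have \<eta>: "?\<eta> \<in> schwartz" by (intro schwartz_tensor schwartz_cnj \<phi>)
  have H: "integrable lborel ?H"
    using lborel_pair_integrable_mult[OF G(1) integrable_cnj[OF F(1)]] unfolding case_prod_beta .
  obtain B where B: "\<And>x. norm (\<phi> x) \<le> B" using schwartz_bounded[OF \<phi>] by blast
  have i: "integrable lborel (\<lambda>w. E w * tfs w \<phi> t)" if E: "integrable lborel E" for E :: "'a \<times> 'a \<Rightarrow> complex" and t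
    using integrable_bounded_mult[OF _ _ E, of "\<lambda>w. tfs w \<phi> t" B] B
    by (simp add: norm_tfs mult.commute measurable_tfs_comp schwartz_measurable \<phi>)
  have "tensor g (\<lambda>y. cnj (f y)) z = (LINT v|lborel. ?H v * tfs (?h v) ?\<eta> z)" for z
  proof -
    have "tensor g (\<lambda>y. cnj (f y)) z = (LINT w|lborel. G w * tfs w \<phi> (fst z)) * (LINT w|lborel. cnj (F w * tfs w \<phi> (snd z)))"
      unfolding tensor_def case_prod_beta F(2) G(2) Bochner_Integration.integral_cnj ..
    also have "\<dots> = (LINT v|lborel. (G (fst v) * tfs (fst v) \<phi> (fst z)) * cnj (F (snd v) * tfs (snd v) \<phi> (snd z)))"
      by (rule lborel_pair_integral_mult[symmetric]) (rule i[OF G(1)], rule integrable_cnj[OF i[OF F(1)]])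
    also have "\<dots> = (LINT v|lborel. ?H v * tfs (?h v) ?\<eta> z)"
      unfolding tfs_tensor_cnj by (simp add: mult_ac)
    finally show ?thesis .
  qed
  then have "tensor g (\<lambda>y. cnj (f y)) = (\<lambda>z. LINT v|lborel. ?H v * tfs (?h v) ?\<eta> z)" by (rule ext)
  with synthesis(1)[OF assms(2) \<eta> H h] show ?thesis by simp
qed

lemma stft_tensor:
  fixes \<phi> :: "'a::euclidean_space \<Rightarrow> complex"
  assumes "window \<phi>" and f: "f \<in> M1 \<phi>" and g: "g \<in> M1 \<phi>"
  shows "stft (tensor \<phi> (\<lambda>t. cnj (\<phi> t))) (tensor g (\<lambda>y. cnj (f y))) v =
     stft \<phi> g (fst (fst v), fst (snd v)) * cnj (stft \<phi> f (snd (fst v), - snd (snd v)))"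
proof -
  interpret window \<phi> by fact
  let ?p = "(fst (fst v), fst (snd v))" and ?q = "(snd (fst v), - snd (snd v))"
  have "stft (tensor \<phi> (\<lambda>t. cnj (\<phi> t))) (tensor g (\<lambda>y. cnj (f y))) v =
     (LINT z|lborel. (g (fst z) * cnj (tfs ?p \<phi> (fst z))) * cnj (f (snd z) * cnj (tfs ?q \<phi> (snd z))))"
    unfolding stft_eq tfs_tensor_cnj by (simp add: tensor_def case_prod_beta mult_ac)
  also have "\<dots> = (LINT t|lborel. g t * cnj (tfs ?p \<phi> t)) * (LINT t|lborel. cnj (f t * cnj (tfs ?q \<phi> t)))"
    by (rule lborel_pair_integral_mult) (use stft_integrand[OF g] stft_integrand[OF f] in \<open>auto simp del: complex_cnj_mult\<close>)
  also have "(LINT t|lborel. cnj (f t * cnj (tfs ?q \<phi> t))) = cnj (stft \<phi> f ?q)"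
    unfolding stft_eq by (rule Bochner_Integration.integral_cnj)
  finally show ?thesis unfolding stft_eq .
qed

lemma window_sq_tensor:
  fixes \<phi> :: "'a::euclidean_space \<Rightarrow> complex"
  assumes "\<phi> \<in> schwartz"
  shows "window_sq (tensor \<phi> (\<lambda>t. cnj (\<phi> t))) = (window_sq \<phi>)\<^sup>2"
proof -
  have i: "integrable lborel (\<lambda>t. complex_of_real ((norm (\<phi> t))\<^sup>2))"
    using schwartz_sq_integrable[OF assms] by (simp only: complex_of_real_integrable_eq)
  have "complex_of_real (window_sq (tensor \<phi> (\<lambda>t. cnj (\<phi> t)))) = (LINT z|lborel. complex_of_real ((norm (\<phi> (fst z)))\<^sup>2) * complex_of_real ((norm (\<phi> (snd z)))\<^sup>2))"
    unfolding window_sq_def integral_complex_of_real[symmetric]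
    by (simp add: tensor_def case_prod_beta norm_mult power_mult_distrib)
  also have "\<dots> = complex_of_real (window_sq \<phi>) * complex_of_real (window_sq \<phi>)"
    unfolding lborel_pair_integral_mult[OF i i] window_sq_def integral_complex_of_real ..
  finally have "complex_of_real (window_sq (tensor \<phi> (\<lambda>t. cnj (\<phi> t)))) = complex_of_real ((window_sq \<phi>)\<^sup>2)"
    by (simp add: power2_eq_square)
  then show ?thesis by (simp only: of_real_eq_iff)
qed

section \<open>The kernel theorem\<close>

lemma prod_Basis_prod:
  "(\<Prod>b\<in>(Basis :: ('a::euclidean_space \<times> 'b::euclidean_space) set). f b) = (\<Prod>b\<in>Basis. f (b, 0)) * (\<Prod>b\<in>Basis. f (0, b))"
proof -
  have "(\<lambda>u. (u, 0::'b)) ` Basis \<inter> (\<lambda>u. (0::'a, u)) ` Basis = {}"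
    using nonzero_Basis by auto
  moreover have "inj_on (\<lambda>u. (u, 0::'b)) (Basis :: 'a set)" "inj_on (\<lambda>u. (0::'a, u)) (Basis :: 'b set)"
    by (auto simp: inj_on_def)
  ultimately show ?thesis
    unfolding Basis_prod_def by (subst prod.union_disjoint) (auto simp: prod.reindex)
qed

text \<open>P passes between a pair of phase-space points and one point of the doubled phase space,
  where positions and frequencies are grouped; its minus sign is that of
  \<open>tfs_tensor_cnj\<close>. It preserves Lebesgue measure because it only permutes coordinates
  and reflects one block.\<close>

lemma lborel_shuffle:
  fixes H :: "('a::euclidean_space \<times> 'a) \<times> ('a \<times> 'a) \<Rightarrow> complex"
  assumes "integrable lborel H"
  defines "P \<equiv> \<lambda>v :: ('a \<times> 'a) \<times> ('a \<times> 'a). ((fst (fst v), fst (snd v)), (snd (fst v), - snd (snd v)))"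
  shows "integrable lborel (\<lambda>v. H (P v))" and "(LINT v|lborel. H v) = (LINT v|lborel. H (P v))"
proof -
  have Pm: "P \<in> borel_measurable borel"
    unfolding P_def by (intro borel_measurable_continuous_onI continuous_intros)
  have "lborel = distr lborel borel P"
  proof (rule lborel_eqI)
    fix l u :: "('a \<times> 'a) \<times> ('a \<times> 'a)" assume lu: "\<And>b. b \<in> Basis \<Longrightarrow> l \<bullet> b \<le> u \<bullet> b"
    \<comment> \<open>P is its own inverse, so the preimage of a box is the box with permuted
      corners; in the reflected block the two endpoints change places.\<close>
    let ?l = "((fst (fst l), fst (snd l)), (snd (fst l), - snd (snd u)))"
    let ?u = "((fst (fst u), fst (snd u)), (snd (fst u), - snd (snd l)))"
    have "P -` box l u = box ?l ?u"
      unfolding P_def by (auto simp: mem_box Basis_prod_def inner_prod_def ball_Un; fastforce)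
    moreover have "?l \<bullet> b \<le> ?u \<bullet> b" if "b \<in> Basis" for b
    proof -
      have "fst (fst l) \<bullet> c \<le> fst (fst u) \<bullet> c" "snd (fst l) \<bullet> c \<le> snd (fst u) \<bullet> c"
        "fst (snd l) \<bullet> c \<le> fst (snd u) \<bullet> c" "snd (snd l) \<bullet> c \<le> snd (snd u) \<bullet> c" if "c \<in> Basis" for c
        using lu[of "((c, 0), 0)"] lu[of "((0, c), 0)"] lu[of "(0, (c, 0))"] lu[of "(0, (0, c))"] that
        by (simp_all add: Basis_prod_def inner_prod_def zero_prod_def image_iff)
      with that show ?thesis by (auto simp: Basis_prod_def inner_prod_def)
    qed
    ultimately have "emeasure (distr lborel borel P) (box l u) = (\<Prod>b\<in>Basis. (?u - ?l) \<bullet> b)"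
      using Pm by (subst emeasure_distr) (auto simp: emeasure_lborel_box)
    also have "(\<Prod>b\<in>Basis. (?u - ?l) \<bullet> b) = (\<Prod>b\<in>Basis. (u - l) \<bullet> b)"
      by (simp add: prod_Basis_prod inner_prod_def inner_diff_left mult_ac)
    finally show "emeasure (distr lborel borel P) (box l u) = ennreal (\<Prod>b\<in>Basis. (u - l) \<bullet> b)" .
  qed simp
  then have eq: "distr lborel borel P = (lborel :: (('a \<times> 'a) \<times> ('a \<times> 'a)) measure)" ..
  have Hm: "H \<in> borel_measurable borel" using assms(1) by auto
  have "integrable (distr lborel borel P) H" unfolding eq by (rule assms(1))
  then show "integrable lborel (\<lambda>v. H (P v))" using Pm Hm by (subst (asm) integrable_distr_eq) auto
  have "(LINT v|lborel. H v) = (LINT v|distr lborel borel P. H v)" unfolding eq ..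
  also have "\<dots> = (LINT v|lborel. H (P v))" using Pm Hm by (intro integral_distr) auto
  finally show "(LINT v|lborel. H v) = (LINT v|lborel. H (P v))" .
qed

lemma (in window) M1_norm_tfs_lipschitz:
  "\<exists>C M. \<forall>z w. M1_norm \<phi> (\<lambda>t. tfs z \<phi> t - tfs w \<phi> t) \<le> C * ((1 + norm z) * (1 + norm w)) ^ M * norm (z - w)"
proof -
  obtain N K where K: "K \<ge> 0" "\<And>f. f \<in> schwartz \<Longrightarrow> M1_norm \<phi> f \<le> K * schwartz_seminorm N f"
    using M1_norm_seminorm[OF \<phi>] by blast
  obtain C M where CM: "C \<ge> 0" "\<And>z w. schwartz_seminorm N (\<lambda>t. tfs z \<phi> t - tfs w \<phi> t) \<le> C * ((1 + norm z) * (1 + norm w)) ^ M * norm (z - w)"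
    using schwartz_seminorm_tfs_lipschitz[OF \<phi>, of N] by blast
  have "M1_norm \<phi> (\<lambda>t. tfs z \<phi> t - tfs w \<phi> t) \<le> (K * C) * ((1 + norm z) * (1 + norm w)) ^ M * norm (z - w)" for z w
    using order_trans[OF K(2)[OF schwartz_diff[OF schwartz_tfs[OF \<phi>] schwartz_tfs[OF \<phi>]]] mult_left_mono[OF CM(2) K(1)], of z w]
    by (simp only: mult.assoc)
  then show ?thesis by blast
qed

lemma (in window) tendsto_M1_tfs:
  assumes "X \<longlonglongrightarrow> z"
  shows "(\<lambda>n. M1_norm \<phi> (\<lambda>t. tfs (X n) \<phi> t - tfs z \<phi> t)) \<longlonglongrightarrow> 0"
proof -
  obtain C M where CM: "\<And>z w. M1_norm \<phi> (\<lambda>t. tfs z \<phi> t - tfs w \<phi> t) \<le> C * ((1 + norm z) * (1 + norm w)) ^ M * norm (z - w)"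
    using M1_norm_tfs_lipschitz by blast
  show ?thesis
  proof (rule Lim_null_comparison)
    show "\<forall>\<^sub>F n in sequentially. norm (M1_norm \<phi> (\<lambda>t. tfs (X n) \<phi> t - tfs z \<phi> t)) \<le> C * ((1 + norm (X n)) * (1 + norm z)) ^ M * norm (X n - z)"
      using CM by (simp add: M1_norm_nonneg)
    have "(\<lambda>n. C * ((1 + norm (X n)) * (1 + norm z)) ^ M * norm (X n - z)) \<longlonglongrightarrow> C * ((1 + norm z) * (1 + norm z)) ^ M * norm (z - z)"
      by (intro tendsto_intros assms)
    then show "(\<lambda>n. C * ((1 + norm (X n)) * (1 + norm z)) ^ M * norm (X n - z)) \<longlonglongrightarrow> 0" by simp
  qed
qed

lemma (in window) antilinear_functional_diff:
  assumes "antilinear_functional L" "f \<in> M1 \<phi>" "g \<in> M1 \<phi>"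
  shows "L (\<lambda>t. f t - g t) = L f - L g"
proof -
  have add: "L (\<lambda>t. f t + g t) = L f + L g" if "f \<in> M1 \<phi>" "g \<in> M1 \<phi>" for f g
    using assms(1) that unfolding antilinear_functional_def by blast
  have "L (\<lambda>t. c * f t) = cnj c * L f" if "f \<in> M1 \<phi>" for f c
    using assms(1) that unfolding antilinear_functional_def by blast
  from this[OF assms(3), of "-1"] add[OF assms(2) M1_cmult[OF assms(3), of "-1"]] show ?thesis by simp
qed

text \<open>Testing a kernel on the shift of \<Phi> by v must give \<open>b v\<close>, because that
  shift is a tensor of two shifts of \<phi>. So the kernel is defined by pairing these bounded
  coefficients with the transform of the test function. The identity for general f and g follows by
  expanding both arguments, as the transform of their tensor factorises.\<close>

lemma kernel_theorem:
  fixes \<phi> :: "'a::euclidean_space \<Rightarrow> complex" and \<psi> :: "'a \<times> 'a \<Rightarrow> complex"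
  assumes "window \<phi>" "window \<psi>"
    and lin: "\<And>g. g \<in> M1 \<phi> \<Longrightarrow> window.antilinear_functional \<phi> (\<lambda>f. cnj (B f g))"
    and anti: "\<And>f. f \<in> M1 \<phi> \<Longrightarrow> window.antilinear_functional \<phi> (B f)"
    and bound: "\<And>f g. f \<in> M1 \<phi> \<Longrightarrow> g \<in> M1 \<phi> \<Longrightarrow> norm (B f g) \<le> K * M1_norm \<phi> f * M1_norm \<phi> g"
  shows "\<exists>k\<in>Minf \<psi>. \<forall>f\<in>M1 \<phi>. \<forall>g\<in>M1 \<phi>. B f g = bracket \<psi> k (tensor g (\<lambda>y. cnj (f y)))"
proof -
  interpret \<phi>: window \<phi> by fact
  interpret \<psi>: window \<psi> by fact
  note \<phi>S = \<phi>.\<phi>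
  define \<Phi> where "\<Phi> = tensor \<phi> (\<lambda>t. cnj (\<phi> t))"
  interpret \<Phi>: window \<Phi>
  proof
    show "\<Phi> \<in> schwartz" unfolding \<Phi>_def by (intro schwartz_tensor schwartz_cnj \<phi>S)
    obtain x where "\<phi> x \<noteq> 0" using \<phi>.\<phi>_nz by auto
    then have "\<Phi> (x, x) \<noteq> 0" unfolding \<Phi>_def tensor_def by simp
    then show "\<Phi> \<noteq> (\<lambda>_. 0)" by auto
  qed
  have tM: "tfs z \<phi> \<in> M1 \<phi>" for z by (intro schwartz_M1 schwartz_tfs \<phi>S)
  let ?m = "M1_norm \<phi> \<phi>"
  have m0: "0 \<le> ?m" by (rule M1_norm_nonneg)
  have tn: "M1_norm \<phi> (tfs z \<phi>) = ?m" for z by (rule \<phi>.M1_norm_tfs[OF \<phi>S])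
  define p :: "('a \<times> 'a) \<times> ('a \<times> 'a) \<Rightarrow> 'a \<times> 'a" where "p v = (fst (fst v), fst (snd v))" for v :: "('a \<times> 'a) \<times> ('a \<times> 'a)"
  define q :: "('a \<times> 'a) \<times> ('a \<times> 'a) \<Rightarrow> 'a \<times> 'a" where "q v = (snd (fst v), - snd (snd v))" for v :: "('a \<times> 'a) \<times> ('a \<times> 'a)"
  define b where "b v = B (tfs (q v) \<phi>) (tfs (p v) \<phi>)" for v :: "('a \<times> 'a) \<times> ('a \<times> 'a)"
  \<comment> \<open>B is linear in its first argument; \<open>lin\<close> speaks of the conjugate so
    that results on antilinear functionals apply, and the conjugation is undone here.\<close>
  have Bdiff1: "B (\<lambda>t. f t - f' t) g = B f g - B f' g" if "f \<in> M1 \<phi>" "f' \<in> M1 \<phi>" "g \<in> M1 \<phi>" for f f' g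
  proof -
    have "cnj (B (\<lambda>t. f t - f' t) g) = cnj (B f g - B f' g)"
      using \<phi>.antilinear_functional_diff[OF lin[OF that(3)] that(1,2)] by simp
    then show ?thesis by (simp only: complex_cnj_cancel_iff)
  qed
  have bB: "norm (b v) \<le> K * ?m * ?m" for v
    using bound[OF tM tM, of "q v" "p v"] by (simp add: b_def tn)
  \<comment> \<open>Continuity serves to make b measurable. It follows from the bound on B and
    continuity of shifts in the \<open>M1\<close> norm, changing one argument at a time.\<close>
  have "continuous_on UNIV b"
    unfolding continuous_on_sequentially
  proof (intro allI ballI impI)
    fix X :: "nat \<Rightarrow> ('a \<times> 'a) \<times> ('a \<times> 'a)" and v assume "(\<forall>n. X n \<in> UNIV) \<and> X \<longlonglongrightarrow> v"
    then have X: "X \<longlonglongrightarrow> v" by blast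
    have p: "(\<lambda>n. p (X n)) \<longlonglongrightarrow> p v" and q: "(\<lambda>n. q (X n)) \<longlonglongrightarrow> q v"
      unfolding p_def q_def by (intro tendsto_intros X)+
    let ?P = "\<lambda>n. M1_norm \<phi> (\<lambda>t. tfs (p (X n)) \<phi> t - tfs (p v) \<phi> t)"
    let ?Q = "\<lambda>n. M1_norm \<phi> (\<lambda>t. tfs (q (X n)) \<phi> t - tfs (q v) \<phi> t)"
    have le: "norm (b (X n) - b v) \<le> K * ?Q n * ?m + K * ?m * ?P n" for n
    proof -
      let ?f = "tfs (q (X n)) \<phi>" and ?f' = "tfs (q v) \<phi>" and ?g = "tfs (p (X n)) \<phi>" and ?g' = "tfs (p v) \<phi>"
      have 1: "B (\<lambda>t. ?f t - ?f' t) ?g = B ?f ?g - B ?f' ?g" by (rule Bdiff1[OF tM tM tM])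
      have 2: "B ?f' (\<lambda>t. ?g t - ?g' t) = B ?f' ?g - B ?f' ?g'"
        by (rule \<phi>.antilinear_functional_diff[OF anti[OF tM] tM tM])
      have "norm (b (X n) - b v) = norm (B (\<lambda>t. ?f t - ?f' t) ?g + B ?f' (\<lambda>t. ?g t - ?g' t))"
        unfolding 1 2 b_def by simp
      also have "\<dots> \<le> norm (B (\<lambda>t. ?f t - ?f' t) ?g) + norm (B ?f' (\<lambda>t. ?g t - ?g' t))"
        by (rule norm_triangle_ineq)
      also have "\<dots> \<le> K * ?Q n * M1_norm \<phi> ?g + K * M1_norm \<phi> ?f' * ?P n"
        by (rule add_mono[OF bound[OF \<phi>.M1_diff[OF tM tM] tM] bound[OF tM \<phi>.M1_diff[OF tM tM]]])
      finally show ?thesis by (simp only: tn)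
    qed
    have "(\<lambda>n. b (X n) - b v) \<longlonglongrightarrow> 0"
    proof (rule Lim_null_comparison[OF always_eventually[OF allI[OF le]]])
      have "(\<lambda>n. K * ?Q n * ?m + K * ?m * ?P n) \<longlonglongrightarrow> K * 0 * ?m + K * ?m * 0"
        by (intro tendsto_intros \<phi>.tendsto_M1_tfs p q)
      then show "(\<lambda>n. K * ?Q n * ?m + K * ?m * ?P n) \<longlonglongrightarrow> 0" by simp
    qed
    then show "(b \<circ> X) \<longlonglongrightarrow> b v" unfolding comp_def by (simp only: LIM_zero_iff)
  qed
  then have bm: "b \<in> borel_measurable borel" by (rule borel_measurable_continuous_onI)
  have toPhi: "\<Psi> \<in> M1 \<Phi>" if "\<Psi> \<in> M1 \<psi>" for \<Psi>
    using M1_change_window(1)[OF assms(2) \<Phi>.window_axioms] that by blast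
  obtain D where D: "D \<ge> 0" "\<And>\<Psi>. \<Psi> \<in> M1 \<psi> \<Longrightarrow> M1_norm \<Phi> \<Psi> \<le> D * M1_norm \<psi> \<Psi>"
    using M1_change_window(2)[OF assms(2) \<Phi>.window_axioms] by blast
  define L where "L \<Psi> = (LINT v|lborel. b v * cnj (stft \<Phi> \<Psi> v)) / of_real (window_sq \<Phi>)" for \<Psi> :: "'a \<times> 'a \<Rightarrow> complex"
  have bi: "integrable lborel (\<lambda>v. b v * cnj (stft \<Phi> \<Psi> v))" if "\<Psi> \<in> M1 \<psi>" for \<Psi>
    by (rule integrable_bounded_mult[OF bm bB]) (use \<Phi>.M1_stft_integrable[OF toPhi[OF that]] in auto)
  have "\<psi>.antilinear_functional L"
    unfolding \<psi>.antilinear_functional_def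
  proof (intro conjI ballI allI)
    fix \<Psi> \<Psi>' assume "\<Psi> \<in> M1 \<psi>" "\<Psi>' \<in> M1 \<psi>"
    then show "L (\<lambda>t. \<Psi> t + \<Psi>' t) = L \<Psi> + L \<Psi>'"
      using bi by (simp add: L_def \<Phi>.stft_add toPhi distrib_left add_divide_distrib)
  next
    fix \<Psi> c assume "\<Psi> \<in> M1 \<psi>"
    then show "L (\<lambda>t. c * \<Psi> t) = cnj c * L \<Psi>"
      by (simp add: L_def \<Phi>.stft_cmult mult.left_commute[of _ "cnj c"])
  next
    have "norm (L \<Psi>) \<le> (K * ?m * ?m * D / window_sq \<Phi>) * M1_norm \<psi> \<Psi>" if \<Psi>: "\<Psi> \<in> M1 \<psi>" for \<Psi>
    proof -
      have K0: "0 \<le> K * ?m * ?m" using order_trans[OF norm_ge_zero bB] .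
      have "norm (LINT v|lborel. b v * cnj (stft \<Phi> \<Psi> v)) \<le> (LINT v|lborel. (K * ?m * ?m) * norm (stft \<Phi> \<Psi> v))"
        by (rule norm_integral_le)
          (use \<Phi>.M1_stft_integrable[OF toPhi[OF \<Psi>]] bB in \<open>auto simp: norm_mult intro!: mult_right_mono\<close>)
      also have "\<dots> = (K * ?m * ?m) * M1_norm \<Phi> \<Psi>" by (simp add: M1_norm_eq[OF \<Phi>.\<phi>])
      also have "\<dots> \<le> (K * ?m * ?m) * (D * M1_norm \<psi> \<Psi>)" by (intro mult_left_mono D \<Psi> K0)
      finally have "norm (LINT v|lborel. b v * cnj (stft \<Phi> \<Psi> v)) / window_sq \<Phi> \<le> (K * ?m * ?m) * (D * M1_norm \<psi> \<Psi>) / window_sq \<Phi>"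
        using window_sq_pos[OF \<Phi>.\<phi> \<Phi>.\<phi>_nz] by (intro divide_right_mono) auto
      then show ?thesis
        using window_sq_pos[OF \<Phi>.\<phi> \<Phi>.\<phi>_nz] by (simp add: L_def norm_divide mult_ac)
    qed
    then show "\<exists>C. \<forall>f\<in>M1 \<psi>. norm (L f) \<le> C * M1_norm \<psi> f" by blast
  qed
  note k = \<psi>.Minf_by_works[OF this]
  have "L (tensor g (\<lambda>y. cnj (f y))) = B f g" if f: "f \<in> M1 \<phi>" and g: "g \<in> M1 \<phi>" for f g
  proof -
    let ?N = "complex_of_real (window_sq \<phi>)"
    let ?H = "\<lambda>v. b v * cnj (stft \<Phi> (tensor g (\<lambda>y. cnj (f y))) v)"
    let ?P = "\<lambda>v :: ('a \<times> 'a) \<times> ('a \<times> 'a). ((fst (fst v), fst (snd v)), (snd (fst v), - snd (snd v)))"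
    have Hi: "integrable lborel ?H" by (rule bi[OF tensor_M1[OF assms(1) \<psi>.\<phi> f g]])
    \<comment> \<open>In the shuffled variables the two transforms separate: the first point belongs
      to g, the second to f.\<close>
    have HP: "?H (?P v) = B (tfs (snd v) \<phi>) (tfs (fst v) \<phi>) * cnj (stft \<phi> g (fst v)) * stft \<phi> f (snd v)" for v
      unfolding b_def p_def q_def \<Phi>_def stft_tensor[OF assms(1) f g] by simp
    have inner: "(LINT w|lborel. B (tfs w \<phi>) g' * stft \<phi> f w) = ?N * B f g'" if g': "g' \<in> M1 \<phi>" for g'
    proof -
      have "cnj (?N * B f g') = (LINT w|lborel. cnj (B (tfs w \<phi>) g') * cnj (stft \<phi> f w))"
        using \<phi>.antilinear_functional_expansion[OF lin[OF g'] f] by simp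
      also have "\<dots> = (LINT w|lborel. cnj (B (tfs w \<phi>) g' * stft \<phi> f w))" by simp
      also have "\<dots> = cnj (LINT w|lborel. B (tfs w \<phi>) g' * stft \<phi> f w)" by (rule Bochner_Integration.integral_cnj)
      finally show ?thesis by (simp only: complex_cnj_cancel_iff)
    qed
    have "(LINT v|lborel. ?H v) = (LINT v|lborel. ?H (?P v))"
      by (rule lborel_shuffle(2)[OF Hi])
    also have "\<dots> = (LINT z|lborel. LINT w|lborel. ?H (?P (z, w)))"
      by (rule lborel_pair_integral[symmetric]) (rule lborel_shuffle(1)[OF Hi])
    also have "\<dots> = (LINT z|lborel. LINT w|lborel. cnj (stft \<phi> g z) * (B (tfs w \<phi>) (tfs z \<phi>) * stft \<phi> f w))"
      unfolding HP by (simp add: mult_ac)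
    also have "\<dots> = (LINT z|lborel. ?N * (B f (tfs z \<phi>) * cnj (stft \<phi> g z)))"
    proof (intro Bochner_Integration.integral_cong refl)
      fix z
      show "(LINT w|lborel. cnj (stft \<phi> g z) * (B (tfs w \<phi>) (tfs z \<phi>) * stft \<phi> f w)) = ?N * (B f (tfs z \<phi>) * cnj (stft \<phi> g z))"
        unfolding integral_mult_right_zero inner[OF tM] by (simp only: mult_ac)
    qed
    also have "\<dots> = ?N * (?N * B f g)"
      unfolding integral_mult_right_zero \<phi>.antilinear_functional_expansion[OF anti[OF f] g] ..
    \<comment> \<open>The two factors \<open>?N\<close> produced by the expansions cancel against
      \<open>window_sq \<Phi>\<close>, which is the square of
      \<open>window_sq \<phi>\<close>.\<close>
    finally show ?thesis
      using \<phi>.window_sq_nz unfolding L_def \<Phi>_def by (simp add: window_sq_tensor[OF \<phi>S] power2_eq_square)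
  qed
  then show ?thesis
    using k(1) k(2)[OF tensor_M1[OF assms(1) \<psi>.\<phi>]] by (intro bexI[of _ "Minf_by \<psi> L"]) auto
qed

section \<open>Continuous operators and their representations\<close>

text \<open>Continuity at 0 with tolerance 1 yields a bound by homogeneity, as for linear maps
  between normed spaces.\<close>

lemma continuous_linear_form:
  fixes \<phi> :: "'a::euclidean_space \<Rightarrow> complex"
  assumes "window \<phi>" and T: "continuous_linear_M1_Minf \<phi> T"
  shows "g \<in> M1 \<phi> \<Longrightarrow> window.antilinear_functional \<phi> (\<lambda>f. cnj (bracket \<phi> (T f) g))"
    and "\<exists>K. \<forall>f\<in>M1 \<phi>. \<forall>g\<in>M1 \<phi>. norm (bracket \<phi> (T f) g) \<le> K * M1_norm \<phi> f * M1_norm \<phi> g"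
proof -
  interpret window \<phi> by fact
  have TM: "T f \<in> Minf \<phi>" if "f \<in> M1 \<phi>" for f
    using T that unfolding continuous_linear_M1_Minf_def by blast
  have Tadd: "T (\<lambda>x. f x + g x) = (\<lambda>\<psi>. T f \<psi> + T g \<psi>)" if "f \<in> M1 \<phi>" "g \<in> M1 \<phi>" for f g
    using T that unfolding continuous_linear_M1_Minf_def by blast
  have Tcm: "T (\<lambda>x. c * f x) = scale_distr c (T f)" if "f \<in> M1 \<phi>" for f c
    using T that unfolding continuous_linear_M1_Minf_def by blast
  let ?B = "\<lambda>f g. bracket \<phi> (T f) g"
  have Badd: "?B (\<lambda>x. f x + f' x) g = ?B f g + ?B f' g" if "f \<in> M1 \<phi>" "f' \<in> M1 \<phi>" "g \<in> M1 \<phi>" for f f' g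
    using TM[OF M1_add[OF that(1,2)]] bracket_add_left[OF TM[OF that(1)] TM[OF that(2)] _ that(3)] by (simp add: Tadd that)
  have Bcm: "?B (\<lambda>x. c * f x) g = c * ?B f g" if "f \<in> M1 \<phi>" "g \<in> M1 \<phi>" for f g c
    using bracket_scale_left[OF TM[OF that(1)] scale_distr_Minf[OF TM[OF that(1)]] that(2)] by (simp add: Tcm that)
  have z: "(\<lambda>x. 0) \<in> M1 \<phi>" by (rule schwartz_M1[OF \<phi> schwartz_0])
  have T0: "T (\<lambda>x. 0) = (\<lambda>\<psi>. 0)"
    using Tcm[OF z, of 0] by (simp add: scale_distr_def)
  obtain \<delta> where \<delta>: "\<delta> > 0" "\<And>g. g \<in> M1 \<phi> \<Longrightarrow> M1_norm \<phi> g < \<delta> \<Longrightarrow> Minf_norm \<phi> (T g) < 1"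
  proof -
    have "\<exists>\<delta>>0. \<forall>g\<in>M1 \<phi>. M1_norm \<phi> (\<lambda>x. g x - 0) < \<delta> \<longrightarrow> Minf_norm \<phi> (\<lambda>\<psi>. T g \<psi> - T (\<lambda>x. 0) \<psi>) < 1"
    proof -
      have "\<forall>f\<in>M1 \<phi>. \<forall>\<epsilon>>0. \<exists>\<delta>>0. \<forall>g\<in>M1 \<phi>. M1_norm \<phi> (\<lambda>x. g x - f x) < \<delta> \<longrightarrow>
          Minf_norm \<phi> (\<lambda>\<psi>. T g \<psi> - T f \<psi>) < \<epsilon>"
        using T unfolding continuous_linear_M1_Minf_def by blast
      from bspec[OF this z] show ?thesis using zero_less_one by blast
    qed
    then show ?thesis using that by (auto simp: T0)
  qed
  let ?W = "window_sq \<phi>"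
  have W: "?W > 0" by (rule window_sq_pos[OF \<phi> \<phi>_nz])
  have small: "norm c * norm (?B f g) \<le> M1_norm \<phi> g / ?W"
    if f: "f \<in> M1 \<phi>" and g: "g \<in> M1 \<phi>" and c: "norm c * M1_norm \<phi> f < \<delta>" for c :: complex and f g
  proof -
    have "Minf_norm \<phi> (T (\<lambda>x. c * f x)) < 1"
      by (rule \<delta>(2)[OF M1_cmult[OF f]]) (simp add: M1_norm_cmult c)
    moreover have "norm (?B (\<lambda>x. c * f x) g) \<le> Minf_norm \<phi> (T (\<lambda>x. c * f x)) / ?W * M1_norm \<phi> g"
      by (rule bracket_bound[OF TM[OF M1_cmult[OF f]] g])
    moreover have "Minf_norm \<phi> (T (\<lambda>x. c * f x)) / ?W * M1_norm \<phi> g \<le> 1 / ?W * M1_norm \<phi> g"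
      using calculation(1) W M1_norm_nonneg[of \<phi> g] by (intro mult_right_mono divide_right_mono) auto
    ultimately show ?thesis by (simp add: Bcm f g norm_mult)
  qed
  have bnd: "norm (?B f g) \<le> (2 / (\<delta> * ?W)) * M1_norm \<phi> f * M1_norm \<phi> g" if f: "f \<in> M1 \<phi>" and g: "g \<in> M1 \<phi>" for f g
  proof (cases "M1_norm \<phi> f = 0")
    \<comment> \<open>Definiteness of the norm is bypassed: if f has norm 0, so has every multiple
      of f, and scaling by \<open>?r\<close> would push the pairing beyond the bound in
      \<open>small\<close>.\<close>
    case True
    have "norm (?B f g) = 0"
    proof (rule ccontr)
      assume nz: "norm (?B f g) \<noteq> 0"
      let ?r = "(M1_norm \<phi> g / ?W + 1) / norm (?B f g)"
      have r0: "?r \<ge> 0" using M1_norm_nonneg[of \<phi> g] W by simp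
      have "norm (complex_of_real ?r) * norm (?B f g) \<le> M1_norm \<phi> g / ?W"
        by (rule small[OF f g]) (use True \<delta>(1) in simp)
      moreover have "norm (complex_of_real ?r) * norm (?B f g) = M1_norm \<phi> g / ?W + 1"
        unfolding norm_of_real abs_of_nonneg[OF r0] using nz by simp
      ultimately show False by simp
    qed
    then show ?thesis using True by simp
  next
    case False
    then have m: "M1_norm \<phi> f > 0" using M1_norm_nonneg[of \<phi> f] by simp
    \<comment> \<open>Scales f to norm \<delta> / 2, which produces the factor 2 / \<delta> in the
      bound.\<close>
    let ?r = "\<delta> / (2 * M1_norm \<phi> f)"
    have r0: "?r > 0" using m \<delta>(1) by simp
    have "norm (complex_of_real ?r) * norm (?B f g) \<le> M1_norm \<phi> g / ?W"
    proof (rule small[OF f g])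
      have "norm (complex_of_real ?r) * M1_norm \<phi> f = \<delta> / 2"
        unfolding norm_of_real abs_of_pos[OF r0] using m by simp
      then show "norm (complex_of_real ?r) * M1_norm \<phi> f < \<delta>" using \<delta>(1) by simp
    qed
    then have "?r * norm (?B f g) \<le> M1_norm \<phi> g / ?W"
      unfolding norm_of_real abs_of_pos[OF r0] .
    then have "norm (?B f g) \<le> M1_norm \<phi> g / ?W / ?r"
      using r0 by (subst pos_le_divide_eq) (simp_all only: mult.commute)
    also have "\<dots> = (2 / (\<delta> * ?W)) * M1_norm \<phi> f * M1_norm \<phi> g" using m by (simp add: mult_ac)
    finally show ?thesis .
  qed
  then show "\<exists>K. \<forall>f\<in>M1 \<phi>. \<forall>g\<in>M1 \<phi>. norm (?B f g) \<le> K * M1_norm \<phi> f * M1_norm \<phi> g" by blast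
  show "antilinear_functional (\<lambda>f. cnj (?B f g))" if g: "g \<in> M1 \<phi>"
    unfolding antilinear_functional_def
  proof (intro conjI ballI allI)
    have "norm (cnj (?B f g)) \<le> (2 / (\<delta> * ?W) * M1_norm \<phi> g) * M1_norm \<phi> f" if "f \<in> M1 \<phi>" for f
      using bnd[OF that g] by (simp add: mult_ac)
    then show "\<exists>C. \<forall>f\<in>M1 \<phi>. norm (cnj (?B f g)) \<le> C * M1_norm \<phi> f" by blast
  qed (simp_all add: Badd Bcm g)
qed

section \<open>Coordinate changes given by matrices\<close>

lemma vec_split_join: "vec_split (vec_join z) = z"
  by (simp add: vec_split_def vec_join_def case_prod_beta prod_eq_iff vec_eq_iff)

lemma vec_join_split: "vec_join (vec_split v) = v"
  by (auto simp: vec_split_def vec_join_def vec_eq_iff split: sum.split)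

lemma linear_vec_join: "linear vec_join"
  by (rule linearI) (auto simp: vec_join_def vec_eq_iff case_prod_beta split: sum.split)

lemma linear_vec_split: "linear vec_split"
  by (rule linearI) (auto simp: vec_split_def vec_eq_iff)

lemma linear_coord: "linear (\<lambda>z. vec_split (B *v vec_join z))"
  using linear_compose[OF linear_compose[OF linear_vec_join matrix_vector_mul_linear] linear_vec_split]
  by (simp add: comp_def)

lemma matrix_inv_mult:
  assumes "invertible B"
  shows "B ** matrix_inv B = mat 1" "matrix_inv B ** B = mat 1"
  using someI_ex[OF assms[unfolded invertible_def]] unfolding matrix_inv_def by auto

lemma coord_inverse:
  assumes "invertible B"
  shows "vec_split (B *v vec_join (vec_split (matrix_inv B *v vec_join z))) = z"
    and "vec_split (matrix_inv B *v vec_join (vec_split (B *v vec_join z))) = z"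
  using assms by (simp_all add: vec_join_split vec_split_join matrix_vector_mul_assoc matrix_inv_mult)

lemma M1_operator_coord_change:
  assumes "window \<psi>" "invertible B"
  shows "window.M1_operator \<psi> (coord_change B)" "window.M1_operator \<psi> (coord_change (matrix_inv B))"
proof -
  interpret window \<psi> by fact
  show "M1_operator (coord_change B)" "M1_operator (coord_change (matrix_inv B))"
    unfolding coord_change_def[abs_def]
    by (rule M1_operator_linear[OF linear_coord linear_coord], rule coord_inverse[OF assms(2)], rule coord_inverse[OF assms(2)])+
qed

text \<open>Both extensions are defined by testing against the inverse map. Tested on the image of
  \<Psi> they therefore undo the two maps and leave only the determinant factor of
  \<open>coord_change_Minf\<close>. The spreading function is the case of \<open>A_ST\<close>, and
  the symbol, before scaling, the case of A.\<close>

lemma fourier2_coord_change_Minf: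
  fixes \<psi> :: "('d::finite) phase \<Rightarrow> complex"
  assumes w: "window \<psi>" and B: "invertible B" and k: "k \<in> Minf \<psi>"
  shows "fourier2_Minf \<psi> (coord_change_Minf \<psi> B k) \<in> Minf \<psi>"
    and "\<Psi> \<in> M1 \<psi> \<Longrightarrow> bracket \<psi> (fourier2_Minf \<psi> (coord_change_Minf \<psi> B k)) (fourier2 (coord_change B \<Psi>)) =
       of_real (inverse \<bar>det B\<bar>) * bracket \<psi> k \<Psi>"
proof -
  interpret window \<psi> by fact
  note c = Minf_by_works[OF antilinear_functional_operator[OF M1_operator_coord_change(2)[OF w B] k, of "of_real (inverse \<bar>det B\<bar>)"],
      folded coord_change_Minf_def]
  have "antilinear_functional (\<lambda>\<Phi>. bracket \<psi> (coord_change_Minf \<psi> B k) (inv_fourier2 \<Phi>))"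
    using antilinear_functional_operator[OF M1_operator_inv_fourier2[OF w] c(1), of 1] by simp
  note F = Minf_by_works[OF this, folded fourier2_Minf_def]
  show "fourier2_Minf \<psi> (coord_change_Minf \<psi> B k) \<in> Minf \<psi>" by (rule F(1))
  assume \<Psi>: "\<Psi> \<in> M1 \<psi>"
  have B\<Psi>: "coord_change B \<Psi> \<in> M1 \<psi>" by (rule M1_operatorD[OF M1_operator_coord_change(1)[OF w B] \<Psi>])
  have "bracket \<psi> (fourier2_Minf \<psi> (coord_change_Minf \<psi> B k)) (fourier2 (coord_change B \<Psi>)) =
     bracket \<psi> (coord_change_Minf \<psi> B k) (coord_change B \<Psi>)"
    by (simp add: F(2)[OF M1_operatorD[OF M1_operator_fourier2[OF w] B\<Psi>]] inv_fourier2_fourier2[OF w B\<Psi>])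
  also have "\<dots> = of_real (inverse \<bar>det B\<bar>) * bracket \<psi> k (coord_change (matrix_inv B) (coord_change B \<Psi>))"
    by (rule c(2)[OF B\<Psi>])
  also have "coord_change (matrix_inv B) (coord_change B \<Psi>) = \<Psi>"
    unfolding coord_change_def by (simp add: coord_inverse[OF B])
  finally show "bracket \<psi> (fourier2_Minf \<psi> (coord_change_Minf \<psi> B k)) (fourier2 (coord_change B \<Psi>)) =
       of_real (inverse \<bar>det B\<bar>) * bracket \<psi> k \<Psi>" .
qed

lemma A_ST_apply: "A_ST *v vec_join z = vec_join (snd z, snd z - fst z)"
proof -
  have "coord_change A_ST \<Phi> z = \<Phi> (snd z, snd z - fst z)" for \<Phi>
    using coord_change_A_ST[of \<Phi> "fst z" "snd z"] by simp
  \<comment> \<open>The identity is known for the values of arbitrary functions; the indicator of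
    the expected point recovers the point itself.\<close>
  from this[of "\<lambda>w. if w = (snd z, snd z - fst z) then 1 else 0"]
  have "vec_split (A_ST *v vec_join z) = (snd z, snd z - fst z)"
    unfolding coord_change_def by (auto split: if_splits)
  then show ?thesis by (metis vec_join_split)
qed

text \<open>Since \<open>A_ST\<close> has order 6, its determinant is a real root of unity.\<close>

lemma abs_det_A_ST: "\<bar>det (A_ST :: ('d::finite) matrix2d)\<bar> = 1"
proof -
  let ?A = "A_ST :: 'd matrix2d"
  let ?C = "?A ** ?A ** ?A"
  have "?C *v vec_join z = vec_join (- z)" for z
    by (simp add: matrix_vector_mul_assoc[symmetric] A_ST_apply prod_eq_iff)
      (simp add: uminus_prod_def)
  then have "(?C ** ?C) *v vec_join z = vec_join z" for z
    by (simp add: matrix_vector_mul_assoc[symmetric])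
  then have "(?C ** ?C) *v v = mat 1 *v v" for v
    using vec_join_split[of v] by (metis matrix_vector_mul_lid)
  then have "?C ** ?C = mat 1" by (simp add: matrix_eq)
  then have "det (?C ** ?C) = 1" by simp
  then have "\<bar>det ?A\<bar> ^ 6 = 1"
    by (simp add: det_mul power_abs[symmetric] numeral_eq_Suc mult_ac)
  then show ?thesis using power_eq_iff_eq_base[of 6 "\<bar>det ?A\<bar>" 1] by simp
qed

lemma invertible_A_ST: "invertible A_ST"
  using abs_det_A_ST unfolding invertible_det_nz by (metis abs_zero zero_neq_one)

text \<open>Under \<open>A_ST\<close> the tensor becomes g at t times the conjugate of f at t - x,
  whose Fourier transform in t is the short-time Fourier transform of g with window f.
  Representation by time-frequency shifts is thus the pseudodifferential one for the matrix
  \<open>A_ST\<close>.\<close>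

lemma stft_eq_fourier2:
  fixes f g :: "real^('d::finite) \<Rightarrow> complex"
  shows "stft f g = fourier2 (coord_change A_ST (tensor g (\<lambda>y. cnj (f y))))"
proof
  fix z :: "'d phase"
  have "coord_change A_ST (tensor g (\<lambda>y. cnj (f y))) (fst z, t) = g t * cnj (f (t - fst z))" for t
    by (simp add: coord_change_A_ST tensor_def)
  then show "stft f g z = fourier2 (coord_change A_ST (tensor g (\<lambda>y. cnj (f y)))) z"
    by (simp add: stft_eq fourier2_eq tfs_apply cis_cnj inner_commute mult_ac)
qed

theorem theorem14:
  fixes A :: "real^('d::finite + 'd)^('d + 'd)"
    and \<phi> :: "real^'d \<Rightarrow> complex"
    and \<psi> :: "(real^'d) \<times> (real^'d) \<Rightarrow> complex"
    and T :: "(real^'d \<Rightarrow> complex) \<Rightarrow> (real^'d) distr"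
  assumes "\<phi> \<in> schwartz" "\<phi> \<noteq> (\<lambda>_. 0)"
    and "\<psi> \<in> schwartz" "\<psi> \<noteq> (\<lambda>_. 0)"
    and "invertible A"
    and "continuous_linear_M1_Minf \<phi> T"
  shows "\<exists>k\<in>Minf \<psi>. \<exists>\<sigma>\<in>Minf \<psi>. \<exists>F\<in>Minf \<psi>.
    (\<forall>f\<in>M1 \<phi>. \<forall>g\<in>M1 \<phi>. bracket \<phi> (T f) g = bracket \<psi> k (tensor g (\<lambda>y. cnj (f y)))) \<and>
    (\<forall>f\<in>M1 \<phi>. T f = pseudodiff \<phi> \<psi> A \<sigma> f) \<and>
    (\<forall>f\<in>M1 \<phi>. \<forall>g\<in>M1 \<phi>. bracket \<phi> (T f) g = bracket \<psi> F (stft f g)) \<and>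
    \<sigma> = scale_distr (of_real \<bar>det A\<bar>) (fourier2_Minf \<psi> (coord_change_Minf \<psi> A k)) \<and>
    F = fourier2_Minf \<psi> (coord_change_Minf \<psi> A_ST k)"
proof -
  have w\<phi>: "window \<phi>" and w\<psi>: "window \<psi>" using assms by (auto intro: window.intro)
  interpret \<phi>: window \<phi> by fact
  interpret \<psi>: window \<psi> by fact
  have TM: "T f \<in> Minf \<phi>" if "f \<in> M1 \<phi>" for f
    using assms(6) that unfolding continuous_linear_M1_Minf_def by blast
  obtain K where K: "\<And>f g. f \<in> M1 \<phi> \<Longrightarrow> g \<in> M1 \<phi> \<Longrightarrow> norm (bracket \<phi> (T f) g) \<le> K * M1_norm \<phi> f * M1_norm \<phi> g"
    using continuous_linear_form(2)[OF w\<phi> assms(6)] by blast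
  obtain k where k: "k \<in> Minf \<psi>"
      "\<And>f g. f \<in> M1 \<phi> \<Longrightarrow> g \<in> M1 \<phi> \<Longrightarrow> bracket \<phi> (T f) g = bracket \<psi> k (tensor g (\<lambda>y. cnj (f y)))"
    using kernel_theorem[OF w\<phi> w\<psi> continuous_linear_form(1)[OF w\<phi> assms(6)] \<phi>.antilinear_functional_bracket[OF TM] K]
    by blast
  define F where "F = fourier2_Minf \<psi> (coord_change_Minf \<psi> A_ST k)"
  define \<sigma>' where "\<sigma>' = fourier2_Minf \<psi> (coord_change_Minf \<psi> A k)"
  define \<sigma> where "\<sigma> = scale_distr (of_real \<bar>det A\<bar>) \<sigma>'"
  note FS = fourier2_coord_change_Minf[OF w\<psi> invertible_A_ST k(1), folded F_def]
  note \<sigma>S = fourier2_coord_change_Minf[OF w\<psi> assms(5) k(1), folded \<sigma>'_def]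
  have \<sigma>M: "\<sigma> \<in> Minf \<psi>" unfolding \<sigma>_def by (rule \<psi>.scale_distr_Minf[OF \<sigma>S(1)])
  have t: "tensor g (\<lambda>y. cnj (f y)) \<in> M1 \<psi>" if "f \<in> M1 \<phi>" "g \<in> M1 \<phi>" for f g
    by (rule tensor_M1[OF w\<phi> assms(3) that])
  have det: "det A \<noteq> 0" using assms(5) invertible_det_nz by blast
  \<comment> \<open>The determinant factor is 1 for \<open>A_ST\<close>, so F carries no normalising
    constant.\<close>
  have "bracket \<phi> (T f) g = bracket \<psi> F (stft f g)" if "f \<in> M1 \<phi>" "g \<in> M1 \<phi>" for f g
    unfolding stft_eq_fourier2 by (simp add: FS(2)[OF t[OF that]] abs_det_A_ST k(2) that)
  moreover have "T f = pseudodiff \<phi> \<psi> A \<sigma> f" if f: "f \<in> M1 \<phi>" for f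
    unfolding pseudodiff_def
  \<comment> \<open>Equality of distributions is reduced to equality of brackets. Boundedness of the
    functional defining \<open>pseudodiff\<close> comes for free, since it coincides with the
    bracket of \<open>T f\<close>.\<close>
  proof (rule \<phi>.Minf_eq_Minf_by[OF TM[OF f]])
    fix g assume g: "g \<in> M1 \<phi>"
    have "fourier2 (coord_change A (tensor g (\<lambda>y. cnj (f y)))) \<in> M1 \<psi>"
      by (intro \<psi>.M1_operatorD[OF M1_operator_fourier2[OF w\<psi>]] \<psi>.M1_operatorD[OF M1_operator_coord_change(1)[OF w\<psi> assms(5)]] t f g)
    then have "bracket \<psi> \<sigma> (matrix_wigner A g f) = of_real \<bar>det A\<bar> * bracket \<psi> \<sigma>' (fourier2 (coord_change A (tensor g (\<lambda>y. cnj (f y)))))"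
      unfolding \<sigma>_def matrix_wigner_def using \<sigma>M unfolding \<sigma>_def by (intro \<psi>.bracket_scale_left \<sigma>S(1))
    \<comment> \<open>The scaling of \<sigma> cancels the inverse determinant left by the coordinate
      change.\<close>
    also have "\<dots> = bracket \<psi> k (tensor g (\<lambda>y. cnj (f y)))"
      using det by (simp add: \<sigma>S(2)[OF t[OF f g]])
    finally show "bracket \<phi> (T f) g = bracket \<psi> \<sigma> (matrix_wigner A g f)" by (simp add: k(2) f g)
  qed
  ultimately show ?thesis
    using k \<sigma>M FS(1) unfolding \<sigma>_def \<sigma>'_def F_def by blast
qed

end
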